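(* Let $\mathcal{I}$ satisfy (A1)–(A7). Then each half-turn is an automorphism of $\mathcal{I}$; that is, for every finite point $P$ there is an automorphism of $\mathcal{I}$ (a bijection of finite points to finite points and of lines to lines preserving incidence in both directions) which maps each line with rimpoints $M,N$ to the line with rimpoints $M^P,N^P$.
   Context: $\mathcal{I}$ is an incidence structure of (finite) points and lines. Betweenness: for collinear $A,B,C$, $B$ is between $A$ and $C$ if every line through $B$ meets at least one line of each pair of intersecting lines through $A$ and $C$ respectively; segments and rays are defined as usual. Rays $r,s$ with endpoints $R,S$ are parallel if non-collinear and every line meeting one of them meets the other or the segment $\overline{RS}$; lines are parallel if they contain parallel rays. A rimpoint is a pair $(a,b)$ of parallel lines such that some line $\ell$ is parallel to both and some line meets $a,b,\ell$; $(a,b)=(c,d)$ if any two of $a,b,c,d$ are equal or parallel; $(a,b)$ is incident with $\ell$ if $\ell\in\{a,b\}$ or $\ell$ is parallel to both and some line meets $a,b,\ell$. "Point" means finite point or rimpoint; $AB$ is the line through distinct points $A,B$. Axioms: (A1) two distinct points lie on a unique line; (A2) each line is on at least one point; (A3) there exist three non-collinear points and three collinear points; (A4) of three collinear points, at least one has the property that every line through it meets at least one of each pair of intersecting lines through the other two; (A5) if $P$ is not on $\ell$, there are two distinct lines on $P$ not meeting $\ell$ such that each line meeting $\ell$ meets at least one of them; (A6) any two non-collinear rays have a common parallel line; (A7) if $A,\dots,F$ are rimpoints such that $AB\cap DE$, $BC\cap EF$, $CD\cap FA$ exist as finite points, they are collinear. Every line carries exactly two rimpoints. For a finite point $P$,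 the half-turn about $P$ is the permutation of the set of rimpoints sending $X$ to $X^P$, the other rimpoint on $XP$.
   Formalization: Rimpoints (a,b),(c,d) are equal only if also c,d are incident with (a,b), since mutual parallelism alone would identify different rimpoints of a triangle of pairwise parallel lines; in (A6) a line containing a ray counts as parallel to it. *)

theory Defs
  imports Main
begin

type_synonym 'l rim = "('l \<times> 'l) set"

datatype ('p, 'l) gpoint = Fin 'p | Rim "'l rim"

locale incidence_structure =
  fixes inc :: "'p \<Rightarrow> 'l \<Rightarrow> bool"
begin

definition points_of :: "'l \<Rightarrow> 'p set" where
  "points_of l = {X. inc X l}"

definition collinear :: "'p set \<Rightarrow> bool" where
  "collinear S \<longleftrightarrow> (\<exists>l. S \<subseteq> points_of l)"

(* A line does not meet itself: otherwise the parallel axiom (in the locale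
   hyperbolic_incidence below) would be refuted by the line l itself, which
   meets neither of its two non-intersecting lines. *)
definition meets :: "'l \<Rightarrow> 'l \<Rightarrow> bool" where
  "meets l m \<longleftrightarrow> l \<noteq> m \<and> (\<exists>X. inc X l \<and> inc X m)"

definition meets_set :: "'l \<Rightarrow> 'p set \<Rightarrow> bool" where
  "meets_set l S \<longleftrightarrow> (\<exists>X \<in> S. inc X l)"

definition separates :: "'p \<Rightarrow> 'p \<Rightarrow> 'p \<Rightarrow> bool" where
  "separates B A C \<longleftrightarrow>
     (\<forall>l m n. inc B l \<and> inc A m \<and> inc C n \<and> meets m n \<longrightarrow> meets l m \<or> meets l n)"

definition between :: "'p \<Rightarrow> 'p \<Rightarrow> 'p \<Rightarrow> bool" where
  "between A B C \<longleftrightarrow> distinct [A, B, C] \<and> collinear {A, B, C} \<and> separates B A C"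

definition segment :: "'p \<Rightarrow> 'p \<Rightarrow> 'p set" where
  "segment A B = {A, B} \<union> {X. between A X B}"

definition ray :: "'p \<Rightarrow> 'p \<Rightarrow> 'p set" where
  "ray R Q = segment R Q \<union> {X. between R Q X}"

definition is_ray :: "'p \<Rightarrow> 'p set \<Rightarrow> bool" where
  "is_ray R r \<longleftrightarrow> (\<exists>Q. Q \<noteq> R \<and> r = ray R Q)"

definition rays_parallel :: "'p set \<Rightarrow> 'p set \<Rightarrow> bool" where
  "rays_parallel r s \<longleftrightarrow>
     (\<exists>R S. is_ray R r \<and> is_ray S s \<and> \<not> collinear (r \<union> s) \<and>
        (\<forall>l. (meets_set l r \<longrightarrow> meets_set l s \<or> meets_set l (segment R S)) \<and>
             (meets_set l s \<longrightarrow> meets_set l r \<or> meets_set l (segment R S))))"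

definition parallel :: "'l \<Rightarrow> 'l \<Rightarrow> bool" where
  "parallel l m \<longleftrightarrow> (\<exists>r s. r \<subseteq> points_of l \<and> s \<subseteq> points_of m \<and> rays_parallel r s)"

(* The line carrying r counts as parallel to r.  If r and s lie on distinct lines
   and s is parallel to the ray opposite to r, then the only line through the
   ends of r and s is the one carrying r. *)
definition line_parallel_ray :: "'l \<Rightarrow> 'p set \<Rightarrow> bool" where
  "line_parallel_ray l r \<longleftrightarrow>
     r \<subseteq> points_of l \<or> (\<exists>t. t \<subseteq> points_of l \<and> rays_parallel t r)"

definition concurrent_parallels :: "'l \<Rightarrow> 'l \<Rightarrow> 'l \<Rightarrow> bool" where
  "concurrent_parallels a b l \<longleftrightarrow>
     parallel l a \<and> parallel l b \<and> (\<exists>t. meets t a \<and> meets t b \<and> meets t l)"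

definition rim_pairs :: "('l \<times> 'l) set" where
  "rim_pairs = {(a, b). parallel a b \<and> (\<exists>l. concurrent_parallels a b l)}"

definition pair_on :: "'l \<times> 'l \<Rightarrow> 'l \<Rightarrow> bool" where
  "pair_on = (\<lambda>(a, b) l. l = a \<or> l = b \<or> concurrent_parallels a b l)"

(* Pairwise equality or parallelism of a, b, c, d alone does not suffice when the
   four lines are only three: the sides a, b, c of a triangle with three ends as
   vertices are mutually parallel, but (a, b) and (b, c) are different ends.
   Incidence of c and d with (a, b) excludes exactly this case. *)
definition rim_rel :: "(('l \<times> 'l) \<times> ('l \<times> 'l)) set" where
  "rim_rel = {((a, b), (c, d)). (a, b) \<in> rim_pairs \<and> (c, d) \<in> rim_pairs \<and>
     (\<forall>x \<in> {a, b, c, d}. \<forall>y \<in> {a, b, c, d}. x = y \<or> parallel x y) \<and>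
     pair_on (a, b) c \<and> pair_on (a, b) d}"

definition rimpoints :: "'l rim set" where
  "rimpoints = rim_pairs // rim_rel"

definition rim_on :: "'l rim \<Rightarrow> 'l \<Rightarrow> bool" where
  "rim_on X l \<longleftrightarrow> X \<in> rimpoints \<and> (\<exists>p \<in> X. pair_on p l)"

definition on :: "('p, 'l) gpoint \<Rightarrow> 'l \<Rightarrow> bool" where
  "on A l \<longleftrightarrow> (case A of Fin P \<Rightarrow> inc P l | Rim X \<Rightarrow> rim_on X l)"

(* only meaningful for distinct points A and B *)
definition join :: "('p, 'l) gpoint \<Rightarrow> ('p, 'l) gpoint \<Rightarrow> 'l" where
  "join A B = (THE l. on A l \<and> on B l)"

definition meet_at :: "'l \<Rightarrow> 'l \<Rightarrow> 'p \<Rightarrow> bool" where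
  "meet_at l m U \<longleftrightarrow> l \<noteq> m \<and> inc U l \<and> inc U m"

definition has_rimpoints :: "'l \<Rightarrow> 'l rim \<Rightarrow> 'l rim \<Rightarrow> bool" where
  "has_rimpoints l M N \<longleftrightarrow> M \<noteq> N \<and> rim_on M l \<and> rim_on N l"

definition half_turn :: "'p \<Rightarrow> 'l rim \<Rightarrow> 'l rim" where
  "half_turn P X = (THE Y. Y \<noteq> X \<and> rim_on Y (join (Fin P) (Rim X)))"

definition automorphism :: "('p \<Rightarrow> 'p) \<Rightarrow> ('l \<Rightarrow> 'l) \<Rightarrow> bool" where
  "automorphism f g \<longleftrightarrow> bij f \<and> bij g \<and> (\<forall>X l. inc (f X) (g l) \<longleftrightarrow> inc X l)"

end

locale hyperbolic_incidence = incidence_structure inc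
  for inc :: "'p \<Rightarrow> 'l \<Rightarrow> bool" +
  assumes A1: "A \<noteq> B \<Longrightarrow> \<exists>!l. inc A l \<and> inc B l"
    and A2: "\<exists>X. inc X l"
    and A3: "\<exists>A B C. distinct [A, B, C] \<and> \<not> collinear {A, B, C}"
      "\<exists>A B C. distinct [A, B, C] \<and> collinear {A, B, C}"
    and A4: "distinct [A, B, C] \<Longrightarrow> collinear {A, B, C} \<Longrightarrow>
      separates A B C \<or> separates B A C \<or> separates C A B"
    and A5: "\<not> inc P l \<Longrightarrow>
      \<exists>m n. m \<noteq> n \<and> inc P m \<and> inc P n \<and> \<not> meets m l \<and> \<not> meets n l \<and>
        (\<forall>k. meets k l \<longrightarrow> meets k m \<or> meets k n)"
    and A6: "is_ray R r \<Longrightarrow> is_ray S s \<Longrightarrow> \<not> collinear (r \<union> s) \<Longrightarrow>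
      \<exists>l. line_parallel_ray l r \<and> line_parallel_ray l s"
    and A7: "\<And>(A :: ('p, 'l) gpoint) B C D E F U V W.
      {A, B, C, D, E, F} \<subseteq> Rim ` rimpoints \<Longrightarrow>
      A \<noteq> B \<Longrightarrow> B \<noteq> C \<Longrightarrow> C \<noteq> D \<Longrightarrow> D \<noteq> E \<Longrightarrow> E \<noteq> F \<Longrightarrow> F \<noteq> A \<Longrightarrow>
      meet_at (join A B) (join D E) U \<Longrightarrow>
      meet_at (join B C) (join E F) V \<Longrightarrow>
      meet_at (join C D) (join F A) W \<Longrightarrow>
      collinear {U, V, W}"

end

theory Submission
  imports Defs
begin

text \<open>
  Since betweenness of points \<open>A, B, C\<close> says that missing lines compose through \<open>B\<close>, the existence
  of two asymptotes yields uniqueness of the middle point, the linear order of each line and the axiom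
  of Pasch. The asymptotes from \<open>P\<close> to a line are its two limiting parallels, and limiting parallelism
  of rays is an equivalence relation whose classes, the ends, are the rimpoints; two ends span a line
  by (A6), and whether two lines meet is decided by the cyclic order of their ends.

  Let \<open>P \<noteq> Q\<close> and write \<open>X'\<close> for the image of an end \<open>X\<close> under the half-turn about \<open>P\<close>. If \<open>MN\<close> and \<open>KL\<close>
  are lines through \<open>Q\<close>, then by the cyclic order \<open>M'N'\<close> and \<open>K'L'\<close> meet, and after exchanging \<open>K\<close> and
  \<open>L\<close> if necessary so do \<open>N'L\<close> and \<open>MK'\<close>. Applying (A7) twice puts the intersection of \<open>M'N'\<close> and
  \<open>K'L'\<close> on the line \<open>PQ\<close>. So the images of all lines through \<open>Q\<close> pass through one point, the image of \<open>Q\<close>.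
\<close>


section \<open>The order of the points of a line\<close>

text \<open>Neither order nor parallelism is primitive, and there is no congruence or continuity:
  every argument has to exhibit lines that meet or miss each other. The usual device is to take the
  two asymptotes of a line through a point and then a third line that meets one of them but not the
  other; betweenness forces or forbids further intersections until two demands collide.

  The obstacle in the final step is that (A7) is silent unless the three pairs of opposite sides of
  the hexagon meet in finite points. A half-turn about \<open>P\<close> swaps the two sides of
  \<open>PQ\<close> and reverses the order of the ends on each of them, and this is what guarantees
  that at least one of the two labelings of a pair of lines through \<open>Q\<close> gives hexagons
  with the required intersection points.\<close>

text \<open>A finite case check on the position of a fifth point \<open>Y\<close> relative to all
  six pairs from \<open>A\<close>, \<open>B\<close>, \<open>C\<close>, \<open>X\<close>, stated for
  an arbitrary relation \<open>b\<close> to keep geometry out of it. The rules \<open>e1\<close> and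
  \<open>e2\<close> are later supplied by \<open>btw_not_nested\<close> and
  \<open>btw_not_crossed\<close>.\<close>

lemma no_cyclic_quadruple:
  assumes sym: "\<And>x y z. b x y z \<Longrightarrow> b z y x"
    and uniq: "\<And>x y z. b x y z \<Longrightarrow> \<not> b y x z"
    and e1: "\<And>a x c y. b a x y \<Longrightarrow> b y x c \<Longrightarrow> b a y c \<Longrightarrow> False"
    and e2: "\<And>a x y c. b a x y \<Longrightarrow> b a y c \<Longrightarrow> b y c x \<Longrightarrow> False"
    and cyc: "b A B C" "b B C X" "b C X A" "b X A B"
    and tot: "b A B Y \<or> b B A Y \<or> b A Y B" "b B C Y \<or> b C B Y \<or> b B Y C"
      "b C X Y \<or> b X C Y \<or> b C Y X" "b X A Y \<or> b A X Y \<or> b X Y A"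
      "b A C Y \<or> b C A Y \<or> b A Y C" "b B X Y \<or> b X B Y \<or> b B Y X"
  shows False
  by (smt (verit) sym uniq e1 e2 cyc tot)

context incidence_structure begin

text \<open>Opposite sides of \<open>l\<close>. Only \<open>P\<close> is required to be off
  \<open>l\<close>; the point of \<open>l\<close> between \<open>P\<close> and \<open>Q\<close> then
  forces \<open>Q\<close> off \<open>l\<close> as well, see \<open>oppD\<close>.\<close>

definition opp :: "'l \<Rightarrow> 'p \<Rightarrow> 'p \<Rightarrow> bool" where
  "opp l P Q \<longleftrightarrow> \<not> inc P l \<and> (\<exists>X. inc X l \<and> between P X Q)"

definition ss :: "'l \<Rightarrow> 'p \<Rightarrow> 'p \<Rightarrow> bool" where
  "ss l P Q \<longleftrightarrow> \<not> inc P l \<and> \<not> inc Q l \<and> \<not> opp l P Q"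

end

context hyperbolic_incidence begin

section \<open>Incidence, asymptotes and the middle of three points\<close>

lemma meetsI: "inc X a \<Longrightarrow> inc X b \<Longrightarrow> a \<noteq> b \<Longrightarrow> meets a b"
  unfolding meets_def by blast

lemma meetsE: assumes "meets a b" obtains X where "inc X a" "inc X b" "a \<noteq> b"
  using assms unfolding meets_def by blast

lemma meets_sym: "meets a b \<longleftrightarrow> meets b a"
  unfolding meets_def by blast

lemma line_eq: "A \<noteq> B \<Longrightarrow> inc A l \<Longrightarrow> inc B l \<Longrightarrow> inc A m \<Longrightarrow> inc B m \<Longrightarrow> l = m"
  using A1 by blast

lemma ex_line: "\<exists>l. inc A l \<and> inc B l"
proof (cases "A = B")
  case True
  obtain C where "C \<noteq> A" using A3(1) by (metis distinct_length_2_or_more)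
  then show ?thesis using A1 True by metis
qed (use A1 in blast)

lemma off_line: "\<exists>X. \<not> inc X l"
  using A3(1) unfolding collinear_def points_of_def by blast

lemma cover:
  assumes "\<not> inc P l"
  obtains m n where "m \<noteq> n" "inc P m" "inc P n" "\<not> meets m l" "\<not> meets n l"
    "\<And>k. meets k l \<Longrightarrow> meets k m \<or> meets k n"
  using A5[OF assms] by blast

text \<open>Of the two asymptotes of \<open>v\<close> through \<open>Z\<close>, one meets
  \<open>u\<close> because \<open>u\<close> meets \<open>v\<close>, and neither meets
  \<open>v\<close>.\<close>

lemma meeting_only_one:
  assumes "meets u v" "\<not> inc Z v"
  obtains z where "inc Z z" "meets z u" "\<not> meets z v"
  using assms(1) cover[OF assms(2)] meets_sym by metis

lemma sepD: "separates B A C \<Longrightarrow> inc B b \<Longrightarrow> inc A a \<Longrightarrow> inc C c \<Longrightarrow> meets a c \<Longrightarrow> meets b a \<or> meets b c"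
  unfolding separates_def by blast

lemma sep_sym: "separates B A C \<longleftrightarrow> separates B C A"
  unfolding separates_def using meets_sym by blast

lemma btwD: "between A B C \<Longrightarrow> inc B b \<Longrightarrow> inc A a \<Longrightarrow> inc C c \<Longrightarrow> meets a c \<Longrightarrow> meets a b \<or> meets c b"
  unfolding between_def using sepD meets_sym by blast

lemma btw_sym: "between A B C \<longleftrightarrow> between C B A"
proof -
  have "between A B C \<Longrightarrow> between C B A" for A B C
    unfolding between_def using sep_sym by (auto simp: insert_commute)
  then show ?thesis by blast
qed

lemma btw_distinct: "between A B C \<Longrightarrow> A \<noteq> B \<and> B \<noteq> C \<and> A \<noteq> C"
  unfolding between_def by auto

lemma btw_line: assumes "between A B C" obtains l where "inc A l" "inc B l" "inc C l"
  using assms unfolding between_def collinear_def points_of_def by auto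

lemma btw_inc1: "between A B C \<Longrightarrow> inc A l \<Longrightarrow> inc B l \<Longrightarrow> inc C l"
  using btw_line btw_distinct line_eq by metis
lemma btw_inc2: "between A B C \<Longrightarrow> inc A l \<Longrightarrow> inc C l \<Longrightarrow> inc B l"
  using btw_line btw_distinct line_eq by metis
lemma btw_inc3: "between A B C \<Longrightarrow> inc B l \<Longrightarrow> inc C l \<Longrightarrow> inc A l"
  using btw_line btw_distinct line_eq by metis

text \<open>With \<open>u\<close>, \<open>v\<close> the asymptotes through \<open>B\<close> of a
  line \<open>a\<close> through \<open>A\<close>, some \<open>c\<close> through \<open>C\<close>
  meets \<open>u\<close> but misses \<open>v\<close>. \<open>A\<close> in the middle makes
  \<open>a\<close> meet \<open>c\<close>; then \<open>B\<close> in the middle would make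
  \<open>v\<close> meet \<open>a\<close> or \<open>c\<close>.\<close>

lemma sep_unique:
  assumes d: "A \<noteq> B" "A \<noteq> C" "B \<noteq> C" and t: "inc A t" "inc B t" "inc C t"
    and s1: "separates A B C" and s2: "separates B A C"
  shows False
proof -
  obtain X where X: "\<not> inc X t" using off_line by blast
  obtain a where a: "inc A a" "inc X a" using ex_line by blast
  have at: "a \<noteq> t" using a X by blast
  have "\<not> inc B a" using at a t d line_eq by blast
  then obtain u v where uv: "u \<noteq> v" "inc B u" "inc B v" "\<not> meets u a" "\<not> meets v a"
    by (rule cover)
  have ta: "meets t a" using at a t meetsI by metis
  have "meets u v" using uv meetsI by blast
  moreover have "\<not> inc C v" using uv ta t d line_eq by metis
  ultimately obtain c where c: "inc C c" "meets c u" "\<not> meets c v" by (rule meeting_only_one)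
  have "meets a u \<or> meets a c" using sepD[OF s1 a(1) uv(2) c(1)] c meets_sym by blast
  then have "meets a c" using uv meets_sym by blast
  then have "meets v a \<or> meets v c" using sepD[OF s2 uv(3) a(1) c(1)] by blast
  then show False using uv c meets_sym by blast
qed

lemma btw_unique: "between A B C \<Longrightarrow> \<not> between B A C"
  using sep_unique btw_distinct btw_line unfolding between_def by metis

lemma btw_unique': "between A B C \<Longrightarrow> \<not> between A C B"
  using btw_unique btw_sym by blast

lemma btw_total:
  assumes "A \<noteq> B" "A \<noteq> C" "B \<noteq> C" "inc A t" "inc B t" "inc C t"
  shows "between A B C \<or> between B A C \<or> between A C B"
proof -
  have c: "collinear {A,B,C}" using assms unfolding collinear_def points_of_def by auto
  have "separates A B C \<or> separates B A C \<or> separates C A B"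
    using A4[of A B C] assms c by auto
  then show ?thesis using assms c unfolding between_def by (auto simp: insert_commute)
qed

text \<open>\<open>u\<close> and \<open>v\<close> meet in \<open>B\<close>, so a line missing both
  of them cannot pass through a point between \<open>U\<close> and \<open>V\<close>.\<close>

lemma ruleE:
  assumes "u \<noteq> v" "inc B u" "inc B v" "\<not> meets u a" "\<not> meets v a" "inc X a" "inc U u" "inc V v"
  shows "\<not> between U X V"
  using assms btwD meetsI by metis

section \<open>Four points on a line\<close>

text \<open>A line \<open>a\<close> through \<open>A\<close> that meets one asymptote
  \<open>b1\<close> of \<open>x\<close> at \<open>B\<close> but misses the other, \<open>b2\<close>,
  must meet \<open>x\<close> and therefore an asymptote \<open>cc\<close> of \<open>x\<close> at
  \<open>C\<close>. Since \<open>b2\<close> and \<open>cc\<close> both miss \<open>x\<close>, they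
  miss each other, so \<open>b2\<close> misses both of the meeting lines \<open>a\<close> and
  \<open>cc\<close>, against \<open>B\<close> being between \<open>A\<close> and
  \<open>C\<close>.\<close>

lemma btw_not_nested:
  assumes "between A X B" "between B X C" "between A B C"
  shows False
proof -
  obtain t where t: "inc A t" "inc B t" "inc C t" using btw_line assms(3) by blast
  have Xt: "inc X t" using btw_inc2 assms(1) t by blast
  have d: "A \<noteq> B" "B \<noteq> C" "A \<noteq> C" "X \<noteq> A" "X \<noteq> B" "X \<noteq> C" using assms btw_distinct by blast+
  obtain Z where Z: "\<not> inc Z t" using off_line by blast
  obtain x where x: "inc X x" "inc Z x" using ex_line by blast
  have xt: "meets t x" using x Z Xt meetsI by metis
  have nx: "\<not> inc B x" "\<not> inc C x" using d Xt x Z t line_eq by metis+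
  obtain b1 b2 where b: "b1 \<noteq> b2" "inc B b1" "inc B b2" "\<not> meets b1 x" "\<not> meets b2 x"
    using cover[OF nx(1)] by metis
  obtain c1 c2 where c: "inc C c1" "inc C c2" "\<not> meets c1 x" "\<not> meets c2 x"
    "\<And>k. meets k x \<Longrightarrow> meets k c1 \<or> meets k c2"
    using cover[OF nx(2)] by metis
  have "meets b1 b2" using b meetsI by metis
  moreover have "\<not> inc A b2" using b xt t d line_eq by metis
  ultimately obtain a where a: "inc A a" "meets a b1" "\<not> meets a b2" by (rule meeting_only_one)
  have "meets a x" using btwD[OF assms(1) x(1) a(1) b(2)] a b by blast
  then obtain cc where cc: "inc C cc" "\<not> meets cc x" "meets a cc" using c by blast
  have "\<not> meets b2 cc" using btwD[OF assms(2) x(1) b(3) cc(1)] b cc by blast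
  then show False using btwD[OF assms(3) b(3) a(1) cc(1) cc(3)] a meets_sym by blast
qed

text \<open>Missing is passed along the points: \<open>c1\<close> misses \<open>b\<close> and
  \<open>x\<close>, so \<open>b\<close> and \<open>x\<close> miss; \<open>x\<close> misses
  \<open>a\<close> and \<open>b\<close>, so these miss; finally \<open>b\<close> misses
  \<open>a\<close> and \<open>c2\<close>, although \<open>a\<close> was chosen to meet
  \<open>c2\<close>.\<close>

lemma btw_not_crossed:
  assumes "between A X B" "between A B C" "between B C X"
  shows False
proof -
  obtain t where t: "inc A t" "inc B t" "inc C t" using btw_line assms(2) by blast
  have Xt: "inc X t" using btw_inc2 assms(1) t by blast
  have d: "A \<noteq> B" "B \<noteq> C" "A \<noteq> C" "X \<noteq> A" "X \<noteq> B" "X \<noteq> C" using assms btw_distinct by blast+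
  obtain Z where Z: "\<not> inc Z t" using off_line by blast
  obtain b where b: "inc B b" "inc Z b" using ex_line by blast
  have bt: "meets t b" using b Z t meetsI by metis
  have nb: "\<not> inc C b" using d b Z t line_eq by metis
  obtain c1 c2 where c: "c1 \<noteq> c2" "inc C c1" "inc C c2" "\<not> meets c1 b" "\<not> meets c2 b"
    using cover[OF nb] by metis
  have c1: "meets t c1" using c bt t meetsI by metis
  have Xc: "\<not> inc X c1" using c bt t Xt d line_eq by metis
  have c12: "meets c2 c1" using c meetsI by metis
  then obtain x where x: "inc X x" "\<not> meets x c1" "meets c2 x" using cover[OF Xc] by metis
  have xb: "\<not> meets x b" using btwD[OF assms(3) c(2) b(1) x(1)] x c meets_sym by blast
  have "\<not> inc A x" using x c1 Xt t d line_eq by metis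
  then obtain a where a: "inc A a" "\<not> meets a x" "meets c2 a" using cover[of A x] x(3) by metis
  have ab: "\<not> meets a b" using btwD[OF assms(1) x(1) a(1) b(1)] a xb meets_sym by blast
  show False using btwD[OF assms(2) b(1) a(1) c(3)] a ab c meets_sym by blast
qed

text \<open>The expected law for a fourth point \<open>X\<close> fails only if betweenness runs
  cyclically through \<open>A\<close>, \<open>B\<close>, \<open>C\<close>, \<open>X\<close>:
  totality and the two preceding exclusions leave nothing else.\<close>

lemma four_or_cyclic:
  assumes "between A B C" "inc A t" "inc B t" "inc X t" "X \<noteq> A" "X \<noteq> B" "X \<noteq> C"
    "\<not> between A B X" "\<not> between X B C"
  shows "between B A X \<and> between B C X \<and> between A X C"
proof -
  have t: "inc C t" using assms btw_inc1 by blast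
  have d: "A \<noteq> B" "B \<noteq> C" "A \<noteq> C" using assms(1) btw_distinct by blast+
  have 1: "between B A X \<or> between A X B" using btw_total[of A B X t] assms d by metis
  have 2: "between B X C \<or> between B C X" using btw_total[of X B C t] assms d t btw_sym by metis
  have 3: "between A X C \<or> between X A C \<or> between A C X" using btw_total[of A X C t] assms d t by metis
  show ?thesis using 1 2 3 assms(1) btw_not_nested btw_not_crossed btw_sym by metis
qed

section \<open>Lines with five points and the linear order\<close>

text \<open>For \<open>D\<close> on \<open>c\<close>, the two asymptotes of the line
  \<open>AD\<close> through \<open>B\<close> must meet \<open>c\<close>, because \<open>B\<close> is
  between \<open>A\<close> and \<open>C\<close>; they cut \<open>c\<close> in two points that do not
  have \<open>D\<close> between them. \<open>D = X\<close> yields \<open>U\<close> and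
  \<open>V\<close>. Repeating this with the one of them that lies between \<open>X\<close> and the
  other cannot return just these two, so a further point appears.\<close>

lemma five_on_line:
  assumes "between A B C" "inc A t" "inc B t" "inc C t" "\<not> inc X t" "inc C c" "inc X c"
  shows "\<exists>U V W. inc U c \<and> inc V c \<and> inc W c \<and> distinct [C, X, U, V, W]"
proof -
  have d: "A \<noteq> B" "B \<noteq> C" "A \<noteq> C" using assms(1) btw_distinct by blast+
  have ct: "c \<noteq> t" using assms by blast
  have An: "\<not> inc A c" "\<not> inc B c" using ct d assms line_eq by metis+
  have key: "\<exists>W1 W2 w1 w2. W1 \<noteq> W2 \<and> inc W1 c \<and> inc W2 c \<and> W1 \<noteq> D \<and> W2 \<noteq> D \<and> W1 \<noteq> C \<and> W2 \<noteq> C \<and>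
      inc W1 w1 \<and> inc W2 w2 \<and> inc B w1 \<and> inc B w2 \<and> w1 \<noteq> w2 \<and> \<not> meets w1 a \<and> \<not> meets w2 a"
    if D: "inc D c" "D \<noteq> C" "inc A a" "inc D a" for D a
  proof -
    have at: "a \<noteq> t" using D ct assms line_eq by metis
    have ta: "meets t a" using at D assms meetsI by metis
    have Ba: "\<not> inc B a" using at D d assms line_eq by metis
    obtain w1 w2 where w: "w1 \<noteq> w2" "inc B w1" "inc B w2" "\<not> meets w1 a" "\<not> meets w2 a"
      using cover[OF Ba] by metis
    have ac: "meets a c" using D An meetsI by metis
    have "meets w1 c" "meets w2 c" using btwD[OF assms(1) _ D(3) assms(6) ac] w meets_sym by metis+
    then obtain W1 W2 where W: "inc W1 w1" "inc W1 c" "inc W2 w2" "inc W2 c" by (metis meetsE)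
    have "W1 \<noteq> W2" using W w An line_eq by metis
    moreover have "W1 \<noteq> C" "W2 \<noteq> C" using W w ta assms d line_eq by metis+
    moreover have "W1 \<noteq> D" "W2 \<noteq> D" using W w D Ba meetsI by metis+
    ultimately show ?thesis using w W by blast
  qed
  have XC: "X \<noteq> C" using assms by blast
  obtain a where a: "inc A a" "inc X a" using ex_line by blast
  obtain U V u v where uv: "U \<noteq> V" "inc U c" "inc V c" "U \<noteq> X" "V \<noteq> X" "U \<noteq> C" "V \<noteq> C"
    "inc U u" "inc V v" "inc B u" "inc B v" "u \<noteq> v" "\<not> meets u a" "\<not> meets v a"
    using key[OF assms(7) XC a] by metis
  have E1: "\<not> between U X V" using ruleE[of u v B a X U V] uv a by blast
  have main: "\<exists>W. inc W c \<and> W \<noteq> C \<and> W \<noteq> X \<and> W \<noteq> U' \<and> W \<noteq> V'"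
    if h: "inc U' c" "inc V' c" "U' \<noteq> C" "between X U' V'" for U' V'
  proof (rule ccontr)
    assume "\<not> ?thesis"
    then have all: "\<And>W. inc W c \<Longrightarrow> W = C \<or> W = X \<or> W = U' \<or> W = V'" by blast
    obtain a' where a': "inc A a'" "inc U' a'" using ex_line by blast
    obtain W1 W2 w1 w2 where w: "W1 \<noteq> W2" "inc W1 c" "inc W2 c" "W1 \<noteq> U'" "W2 \<noteq> U'" "W1 \<noteq> C" "W2 \<noteq> C"
      "inc W1 w1" "inc W2 w2" "inc B w1" "inc B w2" "w1 \<noteq> w2" "\<not> meets w1 a'" "\<not> meets w2 a'"
      using key[OF h(1) h(3) a'] by metis
    have "(W1 = X \<and> W2 = V') \<or> (W1 = V' \<and> W2 = X)" using all w by metis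
    then show False using ruleE[of w1 w2 B a' U' W1 W2] ruleE[of w2 w1 B a' U' W2 W1] w a' h by metis
  qed
  have "between X U V \<or> between X V U" using btw_total[of X U V c] uv assms E1 by metis
  then obtain W where "inc W c" "W \<noteq> C" "W \<noteq> X" "W \<noteq> U" "W \<noteq> V" using main uv by metis
  then show ?thesis using uv XC by (intro exI[of _ U] exI[of _ V] exI[of _ W]) auto
qed

text \<open>A point has only two sides on its line: one of \<open>X\<close>, \<open>U\<close>,
  \<open>V\<close> is between the other two, and \<open>A\<close> fits nowhere relative to these
  three in \<open>four_or_cyclic\<close>.\<close>

lemma no_star: "between X A U \<Longrightarrow> between X A V \<Longrightarrow> between U A V \<Longrightarrow> False"
proof -
  assume h: "between X A U" "between X A V" "between U A V"
  obtain t where t: "inc X t" "inc A t" "inc U t" using h(1) btw_line by blast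
  have V: "inc V t" using h t btw_inc1 by blast
  have d: "X \<noteq> U" "X \<noteq> V" "U \<noteq> V" "A \<noteq> X" "A \<noteq> U" "A \<noteq> V" using h btw_distinct by blast+
  have *: False if "between P Q R" "between P A Q" "between Q A R" "between P A R" "inc P t" "inc Q t" "P \<noteq> A" "Q \<noteq> A" "R \<noteq> A" for P Q R
    using four_or_cyclic[of P Q R t A] that t btw_unique btw_unique' btw_sym by metis
  have "between X U V \<or> between U X V \<or> between X V U" using btw_total[of X U V t] t V d by blast
  then show False using * h d t V btw_sym by metis
qed

text \<open>Needed because Menger's pseudo-linear quadruples, in which the betweenness of four points is
  cyclic, can only be excluded on lines with at least five points.\<close>
lemma fifth_point:
  assumes "A \<noteq> B" "A \<noteq> C" "B \<noteq> C" "inc A t" "inc B t" "inc C t"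
  shows "\<exists>Y. inc Y t \<and> Y \<notin> {P, Q, R, S}"
proof -
  have gen: "\<exists>Y. inc Y t \<and> Y \<notin> {P, Q, R, S}"
    if b: "between A B C" and t: "inc A t" "inc B t" "inc C t" for A B C
  proof -
    obtain X where X: "\<not> inc X t" using off_line by blast
    obtain a where a: "inc A a" "inc X a" using ex_line by blast
    have b': "between C B A" using b btw_sym by blast
    obtain U V W where U: "inc U a" "inc V a" "inc W a" "distinct [A, X, U, V, W]"
      using five_on_line[OF b' t(3,2,1) X a] by blast
    \<comment> \<open>To return from \<open>a\<close> to \<open>t\<close> by
      \<open>five_on_line\<close>, a betweenness on \<open>a\<close> having \<open>A\<close> as an
      extreme point is required. Without one, \<open>A\<close> would be between any two of three
      other points of \<open>a\<close>.\<close>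
    have "\<exists>p q. inc p a \<and> inc q a \<and> between A p q"
    proof (rule ccontr)
      assume "\<not> ?thesis"
      then have n: "\<not> between A p q" if "inc p a" "inc q a" for p q using that by blast
      have "between X A U" using btw_total[of A X U a] n[of X U] n[of U X] a U btw_sym by (metis distinct_length_2_or_more)
      moreover have "between X A V" using btw_total[of A X V a] n[of X V] n[of V X] a U btw_sym by (metis distinct_length_2_or_more)
      moreover have "between U A V" using btw_total[of A U V a] n[of U V] n[of V U] a U btw_sym by (metis distinct_length_2_or_more)
      ultimately show False using no_star by blast
    qed
    then obtain p q where pq: "inc p a" "inc q a" "between q p A" using btw_sym by blast
    have Ba: "\<not> inc B a" using a X t b btw_distinct line_eq by metis
    obtain U V W where U: "inc U t" "inc V t" "inc W t" "distinct [A, B, U, V, W]"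
      using five_on_line[OF pq(3) pq(2,1) a(1) Ba t(1,2)] by blast
    have c5: "card {A,B,U,V,W} = 5" using U by auto
    have c4: "card {P,Q,R,S} \<le> 4" by (simp add: card_insert_if)
    have "\<not> {A,B,U,V,W} \<subseteq> {P,Q,R,S}"
    proof
      assume "{A,B,U,V,W} \<subseteq> {P,Q,R,S}"
      then have "card {A,B,U,V,W} \<le> card {P,Q,R,S}" by (rule card_mono[rotated]) simp
      then show False using c4 c5 by linarith
    qed
    then obtain Y where "Y \<in> {A,B,U,V,W}" "Y \<notin> {P,Q,R,S}" by blast
    then show ?thesis using U t by blast
  qed
  show ?thesis using btw_total[OF assms] gen assms by blast
qed

lemma not_cyclic:
  assumes "between A B C" "between B C X" "between C X A" "between X A B"
  shows False
proof -
  obtain t where t: "inc A t" "inc B t" "inc C t" using assms btw_line by blast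
  have Xt: "inc X t" using assms t btw_inc1 by blast
  have d: "A \<noteq> B" "B \<noteq> C" "A \<noteq> C" "B \<noteq> X" "C \<noteq> X" "A \<noteq> X" using assms btw_distinct by blast+
  obtain Y where Y: "inc Y t" "Y \<noteq> A" "Y \<noteq> B" "Y \<noteq> C" "Y \<noteq> X"
    using fifth_point[of A B C t A B C X] d t by auto
  have tt: "between P Q Y \<or> between Q P Y \<or> between P Y Q" if "P \<noteq> Q" "inc P t" "inc Q t" "P \<noteq> Y" "Q \<noteq> Y" for P Q
    using btw_total[of P Q Y t] that Y(1) by blast
  show False
  proof (rule no_cyclic_quadruple[of between A B C X Y])
    show "between z y x" if "between x y z" for x y z using that btw_sym by blast
    show "\<not> between y x z" if "between x y z" for x y z using that btw_unique by blast
    show False if "between a x y" "between y x c" "between a y c" for a x c y using that btw_not_nested by blast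
    show False if "between a x y" "between a y c" "between y c x" for a x c y using that btw_not_crossed by blast
  qed (use assms tt d t Xt Y in auto)
qed

lemma btw_four:
  assumes "between A B C" "inc A t" "inc B t" "inc X t" "X \<noteq> B"
  shows "between A B X \<or> between X B C"
proof (cases "X = A \<or> X = C")
  case True then show ?thesis using assms btw_sym by auto
next
  case False
  then show ?thesis using four_or_cyclic[OF assms(1-4)] not_cyclic[of A B C X] assms btw_sym by metis
qed

section \<open>The two sides of a line\<close>

lemma opp_miss:
  "opp l P Q \<Longrightarrow> inc P p \<Longrightarrow> inc Q q \<Longrightarrow> \<not> meets p l \<Longrightarrow> \<not> meets q l \<Longrightarrow> \<not> meets p q"
  unfolding opp_def using btwD by blast

lemma opp_sym: "opp l P Q \<longleftrightarrow> opp l Q P"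
proof -
  have "opp l P Q \<Longrightarrow> opp l Q P" for P Q
    unfolding opp_def using btw_sym btw_inc1 btw_distinct btw_line line_eq by metis
  then show ?thesis by blast
qed

lemma oppD: "opp l P Q \<Longrightarrow> \<not> inc P l \<and> \<not> inc Q l \<and> P \<noteq> Q"
  using opp_sym opp_def btw_distinct by metis

lemma opp_btw: "opp l P Q \<Longrightarrow> inc P t \<Longrightarrow> inc Q t \<Longrightarrow> inc X t \<Longrightarrow> inc X l \<Longrightarrow> between P X Q"
  unfolding opp_def using btw_inc2 btw_distinct line_eq by metis

lemma btw_opp: "between P X Q \<Longrightarrow> inc X l \<Longrightarrow> \<not> inc P l \<Longrightarrow> opp l P Q"
  unfolding opp_def by blast

lemma opp_meets: "opp l P Q \<Longrightarrow> inc P t \<Longrightarrow> inc Q t \<Longrightarrow> meets t l"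
  unfolding opp_def using btw_inc2 meetsI by metis

lemma miss_not_opp: "inc P t \<Longrightarrow> inc Q t \<Longrightarrow> \<not> meets t l \<Longrightarrow> \<not> opp l P Q"
  using opp_meets by blast

text \<open>The converse of \<open>opp_miss\<close>. In the main case \<open>P\<close> lies between
  \<open>Q\<close> and the point \<open>X\<close> where \<open>PQ\<close> meets \<open>l\<close>; a
  line \<open>q\<close> through \<open>Q\<close> meeting one asymptote of \<open>l\<close> at
  \<open>P\<close> but not the other, \<open>p2\<close>, misses \<open>l\<close>, since
  \<open>p2\<close> misses both \<open>l\<close> and \<open>q\<close>.\<close>

lemma not_opp_ex:
  assumes "\<not> inc P l" "\<not> inc Q l" "\<not> opp l P Q"
  shows "\<exists>p q. inc P p \<and> inc Q q \<and> \<not> meets p l \<and> \<not> meets q l \<and> (p = q \<or> meets p q)"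
proof (cases "P = Q")
  case True then show ?thesis using cover[OF assms(1)] by metis
next
  case False
  obtain t where t: "inc P t" "inc Q t" using ex_line by blast
  show ?thesis
  proof (cases "meets t l")
    case False then show ?thesis using t by blast
  next
    case True
    then obtain X where X: "inc X t" "inc X l" using meetsE by metis
    have XP: "X \<noteq> P" "X \<noteq> Q" using X assms by blast+
    have main: "\<exists>p q. inc P p \<and> inc Q q \<and> \<not> meets p l \<and> \<not> meets q l \<and> meets p q"
      if h: "between X P Q" "\<not> inc P l" "\<not> inc Q l" "inc P t" "inc Q t" for P Q
    proof (rule ccontr)
      assume "\<not> ?thesis"
      then have all: "\<And>p q. inc P p \<Longrightarrow> inc Q q \<Longrightarrow> \<not> meets p l \<Longrightarrow> \<not> meets q l \<Longrightarrow> \<not> meets p q" by blast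
      obtain p1 p2 where p: "p1 \<noteq> p2" "inc P p1" "inc P p2" "\<not> meets p1 l" "\<not> meets p2 l"
        using cover[OF h(2)] by metis
      have "meets p1 p2" using p meetsI by blast
      moreover have "\<not> inc Q p2" using p h btw_distinct True line_eq by metis
      ultimately obtain q where q: "inc Q q" "meets q p1" "\<not> meets q p2" by (rule meeting_only_one)
      have "\<not> meets q l" using btwD[OF h(1) p(3) X(2) q(1)] q p meets_sym by blast
      then show False using all p q meets_sym by blast
    qed
    have "\<not> between P X Q" using assms X btw_opp by blast
    then have "between X P Q \<or> between X Q P" using btw_total[of X P Q t] X t False XP btw_sym by metis
    then show ?thesis using main[of P Q] main[of Q P] assms t meets_sym by metis
  qed
qed

text \<open>Otherwise two lines through \<open>D\<close> missing \<open>r\<close> would meet the same lines through \<open>A\<close>,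
  which \<open>meeting_only_one\<close> forbids.\<close>
lemma pasch_miss1:
  assumes "between A D C" "inc D l" "inc B r" "inc C r" "B \<noteq> C" "\<not> meets l r" "l \<noteq> r" "inc E l"
  shows "\<not> between A B E"
proof
  assume ABE: "between A B E"
  obtain t where t: "inc A t" "inc B t" "inc E t" using btw_line ABE by blast
  obtain s where s: "inc A s" "inc D s" "inc C s" using btw_line assms(1) by blast
  have d: "A \<noteq> D" "D \<noteq> C" "A \<noteq> C" "A \<noteq> B" "B \<noteq> E" "A \<noteq> E" using assms(1) ABE btw_distinct by blast+
  have Dr: "\<not> inc D r" using assms(2,6,7) meetsI by metis
  have Ar: "\<not> inc A r" using s assms(4) Dr d line_eq by metis
  have tr: "meets t r" using t(1,2) assms(3) Ar meetsI by metis
  have sr: "meets s r" using s(1,3) assms(4) Ar meetsI by metis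
  obtain d1 d2 where dd: "d1 \<noteq> d2" "inc D d1" "inc D d2" "\<not> meets d1 r" "\<not> meets d2 r"
    using cover[OF Dr] by metis
  have beyond: "\<exists>E'. inc E' e \<and> between A B E'" if e: "inc D e" "\<not> meets e r" for e
  proof (cases "e = l")
    case True then show ?thesis using assms ABE by blast
  next
    case False
    have "meets t e" using btwD[OF assms(1) e(1) t(1) assms(4) tr] e meets_sym by blast
    then obtain E' where E': "inc E' t" "inc E' e" using meetsE by metis
    have "\<not> between E' B E" by (rule ruleE[OF False e(1) assms(2) e(2) assms(6,3) E'(2) assms(8)])
    moreover have "E' \<noteq> B" using E' e assms(3) meetsI Dr by metis
    ultimately have "between A B E'" using btw_four[OF ABE t(1,2) E'(1)] by blast
    then show ?thesis using E' by blast
  qed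
  have "meets d1 d2" using dd meetsI by blast
  moreover have "\<not> inc A d2" using dd(3,5) s(1,2) sr d(1) line_eq by metis
  ultimately obtain a where a: "inc A a" "meets a d1" "\<not> meets a d2" by (rule meeting_only_one)
  obtain E1 where E1: "inc E1 d1" "between A B E1" using beyond dd by blast
  have "meets a r" using btwD[OF E1(2) assms(3) a(1) E1(1) a(2)] dd by blast
  then show False using btwD[OF assms(1) dd(3) a(1) assms(4)] a dd meets_sym by blast
qed

text \<open>The other half of Pasch: with \<open>p1, p2\<close> the asymptotes of \<open>l\<close> through \<open>P\<close>, some point \<open>E'\<close> of \<open>l\<close>
  has the property that the lines through it meeting \<open>p1\<close> also meet \<open>r\<close>; comparing with \<open>p2\<close>,
  either all lines through \<open>E'\<close> except \<open>l\<close> meet \<open>r\<close>, or those meeting \<open>p1\<close> all meet \<open>p2\<close>.\<close>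
lemma pasch_miss2:
  assumes P: "between P X R" and l: "inc X l" "inc E l" and r: "inc Q r" "inc R r" "Q \<noteq> R"
    and lr: "\<not> meets l r" "l \<noteq> r"
  shows "\<not> between E P Q"
proof
  assume EPQ: "between E P Q"
  have d: "P \<noteq> X" "X \<noteq> R" "P \<noteq> R" "E \<noteq> P" "P \<noteq> Q" "E \<noteq> Q" using P EPQ btw_distinct by blast+
  obtain s where s: "inc P s" "inc X s" "inc R s" using btw_line P by blast
  obtain h where h: "inc E h" "inc P h" "inc Q h" using btw_line EPQ by blast
  have nl: "\<not> inc R l" "\<not> inc Q l" using lr l r meetsI by metis+
  have nr: "\<not> inc X r" "\<not> inc E r" using lr l r meetsI by metis+
  have Pr: "\<not> inc P r" using nr s d r line_eq by metis
  have Pl: "\<not> inc P l" using nl s d l line_eq by metis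
  have PR: "opp l P R" using btw_opp P l Pl by blast
  have nPQ: "\<not> opp l P Q" using opp_btw[of l P Q h E] h l EPQ btw_unique by blast
  obtain p0 q0 where pq: "inc P p0" "inc Q q0" "\<not> meets p0 l" "\<not> meets q0 l" "p0 = q0 \<or> meets p0 q0"
    using not_opp_ex[OF Pl nl(2) nPQ] by blast
  have hl: "meets h l" using h l Pl meetsI by metis
  have p0q0: "p0 \<noteq> q0" using pq h d hl line_eq by metis
  then obtain Y where Y: "inc Y p0" "inc Y q0" using pq meetsE by metis
  have rl: "\<not> meets r l" using lr meets_sym by blast
  have pr: "\<not> meets p r" if "inc P p" "\<not> meets p l" for p
    using opp_miss[OF PR that(1) r(2) that(2) rl] .
  have Yr: "\<not> inc Y r" using pr[of p0] pq Y Pr meetsI by metis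
  have Yl: "\<not> inc Y l" using Y pq Pl meetsI by metis
  have YP: "Y \<noteq> P" using Y pq p0q0 h d hl line_eq by metis
  \<comment> \<open>Origin of \<open>E'\<close>: the line from \<open>R\<close> to the common point
    \<open>Y\<close> of \<open>p0\<close> and \<open>q0\<close> meets \<open>l\<close>, because
    \<open>X\<close> is between \<open>P\<close> and \<open>R\<close> and \<open>l\<close> misses
    \<open>p0\<close>. The aim is to have \<open>R\<close> between \<open>E'\<close> and the point
    of this line on an asymptote of \<open>l\<close>.\<close>
  obtain g where g: "inc R g" "inc Y g" using ex_line by blast
  have gp: "meets p0 g" using g Y(1) pr[of p0] pq(1,3) r(2) Pr meetsI by metis
  have "meets g l" using btwD[OF P l(1) pq(1) g(1) gp] pq by blast
  then obtain E' where E': "inc E' g" "inc E' l" using meetsE by metis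
  have dE: "E' \<noteq> Y" "E' \<noteq> R" using E' Yl nl by blast+
  have RY: "R \<noteq> Y" using Yr r by blast
  have "\<not> opp l Y R"
    using opp_miss[of l Y R q0 r] Y pq rl r Yr meetsI by metis
  then have n1: "\<not> between Y E' R" using btw_opp E' Yl by blast
  have lp: "\<not> meets l p0" "l \<noteq> p0" using pq meets_sym Pl by blast+
  have n2: "\<not> between R Y E'"
    using pasch_miss1[of R X P l Y p0 E'] P btw_sym l pq Y YP lp E' by blast
  have ERY: "between E' R Y" using btw_total[of E' R Y g] n1 n2 E' g dE RY btw_sym by metis
  obtain p1' p2' where pp: "p1' \<noteq> p2'" "inc P p1'" "inc P p2'" "\<not> meets p1' l" "\<not> meets p2' l"
    "\<And>k. meets k l \<Longrightarrow> meets k p1' \<or> meets k p2'" using cover[OF Pl] by metis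
  have "meets g p1' \<or> meets g p2'" using pp E' g nl meetsI by metis
  then obtain p1 p2 where p: "p1 \<noteq> p2" "inc P p1" "inc P p2" "\<not> meets p1 l" "\<not> meets p2 l"
    "\<And>k. meets k l \<Longrightarrow> meets k p1 \<or> meets k p2" "meets g p1" using pp by metis
  obtain W where W: "inc W g" "inc W p1" using p meetsE by metis
  have Wl: "\<not> inc W l" using W p Pl meetsI by metis
  have WR: "W \<noteq> R" using W p pr[of p1] Pr r meetsI by metis
  have WP: "W \<noteq> P"
  proof
    assume "W = P"
    then have "g = p0" using W Y g pq YP line_eq by metis
    then show False using gp meets_def by blast
  qed
  have WE: "W \<noteq> E'" using Wl E' by blast
  have n3: "\<not> between Y E' W"
  proof (cases "p0 = p1")
    case True
    then have "W = Y" using W Y gp g line_eq meets_def by metis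
    then show ?thesis using btw_distinct by blast
  next
    case False then show ?thesis using ruleE[of p0 p1 P l E' Y W] p pq Y W E' by blast
  qed
  have n4: "\<not> between R E' W"
  proof
    assume "between R E' W"
    then have "between R E' Y \<or> between Y E' W" using btw_four[of R E' W g Y] g E' dE by blast
    then show False using n3 ERY btw_unique by blast
  qed
  have lp1: "\<not> meets l p1" "l \<noteq> p1" using p meets_sym Pl by blast+
  have n5: "\<not> between R W E'"
    using pasch_miss1[of R X P l W p1 E'] P btw_sym l p W WP lp1 E' by blast
  have ERW: "between E' R W" using btw_total[of E' R W g] n4 n5 E' g dE WR WE W btw_sym by metis
  have p1r: "\<not> meets p1 r" "\<not> meets p2 r" using pr p by blast+
  have i1: "meets e p1 \<Longrightarrow> meets e r" if "inc E' e" for e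
    using btwD[OF ERW r(2) that W(2)] p1r by blast
  obtain k where k: "inc E' k" "inc Q k" using ex_line by blast
  have "meets k l" using k E' nl meetsI by metis
  then have lk: "meets l k" using meets_sym by blast
  have "meets k p2" using btwD[OF EPQ p(3) l(2) k(2) lk] p meets_sym by blast
  then obtain M where M: "inc M k" "inc M p2" using meetsE by metis
  have Er: "\<not> inc E' r" using E' lr meetsI by metis
  have p2E: "\<not> inc E' p2" using E' p Pl meetsI by metis
  have Qp2: "\<not> inc Q p2" using r p1r Pr p(3) meetsI by metis
  have QE': "Q \<noteq> E'" using Er r by blast
  have lp2: "\<not> meets p2 l" "p2 \<noteq> l" using p Pl by blast+
  have n6: "\<not> between Q E' M"
  proof (cases "E = E'")
    case True
    then have "M = P" using M p k h line_eq d hl by metis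
    then show ?thesis using EPQ True btw_unique btw_sym by blast
  next
    case False
    then show ?thesis
      using pasch_miss1[of Q P E p2 E' l M] EPQ btw_sym p(3) E'(2) l(2) lp2 M by blast
  qed
  have "between E' M Q \<or> between E' Q M"
    using btw_total[of E' M Q k] n6 M k p2E Qp2 QE' btw_sym by metis
  then show False
  proof
    assume b: "between E' M Q"
    have "meets p1 p2" using p meetsI by blast
    then obtain e where e: "inc E' e" "meets e p1" "\<not> meets e p2" using p2E by (rule meeting_only_one)
    then have "meets e r" using i1 by blast
    then show False using btwD[OF b M(2) e(1) r(1)] e p1r meets_sym by blast
  next
    assume b: "between E' Q M"
    have i2: "meets e p2 \<Longrightarrow> meets e r" if "inc E' e" for e
      using btwD[OF b r(1) that M(2)] p1r by blast
    obtain e1 e2 where e: "e1 \<noteq> e2" "inc E' e1" "inc E' e2" "\<not> meets e1 r" "\<not> meets e2 r"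
      using cover[OF Er] by metis
    have "meets e r" if "inc E' e" "e \<noteq> l" for e
      using i1 i2 that p(6)[of e] E' meetsI by metis
    then show False using e by metis
  qed
qed

text \<open>The line \<open>PQ\<close> meets \<open>l\<close> in some \<open>E\<close>, since
  \<open>X\<close> is between \<open>P\<close> and \<open>R\<close> and \<open>r\<close> misses
  \<open>l\<close>. The two preceding lemmas exclude the orders of \<open>P\<close>,
  \<open>E\<close>, \<open>Q\<close> in which \<open>E\<close> is not in the middle.\<close>

lemma opp_along:
  assumes "opp l P R" "inc R r" "inc Q r" "\<not> meets r l"
  shows "opp l P Q"
proof (cases "Q = R")
  case True then show ?thesis using assms by blast
next
  case False
  obtain X where X: "inc X l" "between P X R" using assms opp_def by blast
  have Pl: "\<not> inc P l" "\<not> inc R l" using assms oppD by blast+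
  have rl: "r \<noteq> l" using assms(2) Pl(2) by blast
  have lr: "\<not> meets l r" "l \<noteq> r" using assms(4) meets_sym rl by blast+
  have Ql: "\<not> inc Q l" using assms(3,4) rl meetsI by metis
  obtain s where s: "inc P s" "inc X s" "inc R s" using btw_line X by blast
  have d: "P \<noteq> X" "X \<noteq> R" "P \<noteq> R" using X btw_distinct by blast+
  have Xr: "\<not> inc X r" using assms(4) rl X(1) meetsI by metis
  have Pr: "\<not> inc P r" using s d(3) assms(2) Xr line_eq by metis
  obtain t where t: "inc P t" "inc Q t" using ex_line by blast
  have "meets t r" using t Pr assms(3) meetsI by metis
  then have "meets t l" using btwD[OF X(2) X(1) t(1) assms(2)] assms by blast
  then obtain E where E: "inc E t" "inc E l" using meetsE by metis
  have dE: "E \<noteq> P" "E \<noteq> Q" "P \<noteq> Q" using E(2) Pl Ql Pr assms(3) by blast+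
  have "\<not> between P Q E" by (rule pasch_miss1[OF X(2,1) assms(3,2) False lr E(2)])
  moreover have "\<not> between E P Q" by (rule pasch_miss2[OF X(2,1) E(2) assms(3,2) False lr])
  ultimately have "between P E Q" using btw_total[of P E Q t] t E(1) dE btw_sym by metis
  then show ?thesis using btw_opp E Pl by blast
qed

text \<open>A point \<open>B\<close> not opposite to \<open>C\<close> is joined to it by one or two
  lines missing \<open>l\<close> (\<open>not_opp_ex\<close>), and \<open>opp_along\<close> carries
  the side along them.\<close>

lemma opp_trans:
  assumes "opp l A C" "\<not> inc B l"
  shows "opp l A B \<or> opp l B C"
proof (rule ccontr)
  assume n: "\<not> ?thesis"
  have C: "\<not> inc C l" "\<not> inc A l" using assms oppD by blast+
  obtain b c where bc: "inc B b" "inc C c" "\<not> meets b l" "\<not> meets c l" "b = c \<or> meets b c"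
    using not_opp_ex[OF assms(2) C(1)] n by blast
  obtain Y where Y: "inc Y b" "inc Y c" using bc by (metis meetsE)
  have "opp l A Y" using opp_along[OF assms(1) bc(2) Y(2) bc(4)] .
  then have "opp l A B" using opp_along Y bc by blast
  then show False using n by blast
qed

text \<open>A line through \<open>A\<close> missing \<open>l\<close> moves \<open>A\<close> to a
  point \<open>W\<close> of the line \<open>BC\<close> without changing its side; there the claim
  reduces to \<open>no_star\<close>.\<close>

lemma opp_opp:
  assumes "opp l A B" "opp l B C"
  shows "\<not> opp l A C"
proof
  assume AC: "opp l A C"
  have nl: "\<not> inc A l" "\<not> inc B l" "\<not> inc C l" using assms oppD by blast+
  obtain X where X: "inc X l" "between B X C" using assms opp_def by blast
  obtain k where k: "inc B k" "inc X k" "inc C k" using btw_line X by blast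
  have "meets k l" using k X nl meetsI by metis
  then obtain a where a: "inc A a" "\<not> meets a l" "meets k a" using cover[OF nl(1)] by metis
  obtain W where W: "inc W k" "inc W a" using a meetsE by metis
  have "opp l B W" using opp_along[of l B A a W] assms opp_sym a W by blast
  then have 1: "between B X W" using opp_btw k W X by blast
  have "opp l C W" using opp_along[of l C A a W] AC opp_sym a W by blast
  then have 2: "between C X W" using opp_btw k W X by blast
  show False using no_star X 1 2 by blast
qed

lemma ss_refl: "\<not> inc P l \<Longrightarrow> ss l P P"
  unfolding ss_def using oppD by blast

lemma ss_sym: "ss l P Q \<longleftrightarrow> ss l Q P"
  unfolding ss_def using opp_sym by blast

lemma ss_trans: "ss l A B \<Longrightarrow> ss l B C \<Longrightarrow> ss l A C"
  unfolding ss_def using opp_trans opp_sym by blast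

lemma ss_opp: "ss l A B \<Longrightarrow> opp l B C \<Longrightarrow> opp l A C"
  unfolding ss_def using opp_trans opp_sym by blast

lemma opp_opp_ss: "opp l A B \<Longrightarrow> opp l B C \<Longrightarrow> ss l A C"
  unfolding ss_def using opp_opp oppD by blast

lemma ss_or_opp: "\<not> inc A l \<Longrightarrow> \<not> inc B l \<Longrightarrow> ss l A B \<or> opp l A B"
  unfolding ss_def by blast

lemma ss_not_opp: "ss l A B \<Longrightarrow> \<not> opp l A B"
  unfolding ss_def by blast

lemma ssD: "ss l A B \<Longrightarrow> \<not> inc A l \<and> \<not> inc B l"
  unfolding ss_def by blast

lemma ss_miss: "inc P t \<Longrightarrow> inc Q t \<Longrightarrow> \<not> meets t l \<Longrightarrow> \<not> inc P l \<Longrightarrow> ss l P Q"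
  unfolding ss_def using miss_not_opp meetsI by metis

lemma btw_ss: "between A B C \<Longrightarrow> inc C l \<Longrightarrow> \<not> inc A l \<Longrightarrow> ss l A B"
proof -
  assume h: "between A B C" "inc C l" "\<not> inc A l"
  obtain t where t: "inc A t" "inc B t" "inc C t" using btw_line h(1) by blast
  have "\<not> inc B l" using btw_inc3[OF h(1)] h by blast
  moreover have "\<not> opp l A B" using opp_btw[of l A B t C] t h btw_unique' by blast
  ultimately show ?thesis using h unfolding ss_def by blast
qed

section \<open>Points on both sides of every point of a line\<close>

lemma third_line: "\<exists>a. inc A a \<and> a \<noteq> k \<and> a \<noteq> k'"
proof -
  obtain X where X: "X \<noteq> A" using A3(1) by (metis distinct_length_2_or_more)
  obtain r where r: "inc A r" "inc X r" using ex_line by blast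
  obtain Y where Y: "\<not> inc Y r" using off_line by blast
  obtain l where l: "inc X l" "inc Y l" using ex_line by blast
  have Al: "\<not> inc A l" using l r X Y line_eq by metis
  obtain m n where mn: "m \<noteq> n" "inc A m" "inc A n" "\<not> meets m l" "\<not> meets n l" using cover[OF Al] by metis
  have "meets r l" using r l Y meetsI by metis
  then show ?thesis using mn r by metis
qed

text \<open>As \<open>k\<close> meets \<open>l\<close>, it also meets an asymptote of
  \<open>l\<close> at \<open>P\<close> and one at \<open>Q\<close>, which gives points of
  \<open>k\<close> on both sides of \<open>l\<close>.\<close>

lemma opp_mid:
  assumes "opp l P Q" "inc A k" "inc A l" "k \<noteq> l"
  shows "\<exists>B C. inc B k \<and> inc C k \<and> between B A C"
proof -
  have kl: "meets k l" using assms meetsI by blast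
  have n: "\<not> inc P l" "\<not> inc Q l" using assms oppD by blast+
  obtain p where p: "inc P p" "\<not> meets p l" "meets k p" using cover[OF n(1)] kl by metis
  obtain q where q: "inc Q q" "\<not> meets q l" "meets k q" using cover[OF n(2)] kl by metis
  obtain B where B: "inc B k" "inc B p" using p meetsE by metis
  obtain C where C: "inc C k" "inc C q" using q meetsE by metis
  have "ss l B P" "ss l Q C" using ss_miss p q B C n ss_sym by metis+
  then have "opp l P C" using assms(1) ss_opp[of l C Q P] opp_sym ss_sym by blast
  then have "opp l B C" using \<open>ss l B P\<close> ss_opp by blast
  then have "between B A C" using opp_btw B C assms by blast
  then show ?thesis using B C by blast
qed

text \<open>(A3) provides a single betweenness. \<open>opp_mid\<close> spreads it first to all lines
  through its middle point \<open>A0\<close> and then, along the line joining \<open>A0\<close> to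
  \<open>A\<close>, to any other point \<open>A\<close>.\<close>

lemma mid: "inc A k \<Longrightarrow> \<exists>B C. inc B k \<and> inc C k \<and> between B A C"
proof -
  have all_lines: "\<exists>B C. inc B k \<and> inc C k \<and> between B A C" if h: "between B A C" "inc A k" for A B C k
  proof -
    obtain k0 where k0: "inc B k0" "inc A k0" "inc C k0" using h btw_line by metis
    obtain a where a: "inc A a" "a \<noteq> k0" "a \<noteq> k" using third_line by blast
    have "\<not> inc B a" using a k0 h btw_distinct line_eq by metis
    then have "opp a B C" using btw_opp h a by blast
    then show ?thesis using opp_mid a h by metis
  qed
  obtain A0 B0 C0 where "distinct [A0, B0, C0]" "collinear {A0, B0, C0}" using A3(2) by blast
  then obtain A0 B0 C0 where m0: "between B0 A0 C0"
    unfolding collinear_def points_of_def using btw_total[of A0 B0 C0] that by auto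
  have "\<exists>B C. between B A C" for A
  proof (cases "A = A0")
    case True then show ?thesis using m0 by blast
  next
    case False
    obtain a where a: "inc A a" "inc A0 a" using ex_line by blast
    obtain k where k: "inc A0 k" "k \<noteq> a" using third_line by metis
    obtain B C where BC: "inc B k" "inc C k" "between B A0 C" using all_lines m0 k by metis
    have "\<not> inc B a" using BC k a btw_distinct line_eq by metis
    then have o: "opp a B C" using btw_opp BC a by blast
    obtain k' where k': "inc A k'" "k' \<noteq> a" using third_line by metis
    show ?thesis using opp_mid[OF o k'(1) a(1) k'(2)] by blast
  qed
  then show "inc A k \<Longrightarrow> ?thesis" using all_lines by metis
qed

lemma extend: "A \<noteq> B \<Longrightarrow> \<exists>C. between A B C"
proof -
  assume d: "A \<noteq> B"
  obtain t where t: "inc A t" "inc B t" using ex_line by blast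
  obtain D E where DE: "inc D t" "inc E t" "between D B E" using mid t by metis
  show ?thesis using btw_four[OF DE(3) DE(1) t(2) t(1)] d btw_sym by metis
qed

section \<open>Rays and angles at a point\<close>

lemma ray_point:
  assumes "inc P m" "inc P t" "m \<noteq> t" "\<not> inc U t"
  shows "\<exists>Z. inc Z m \<and> ss t Z U"
proof -
  obtain B C where BC: "inc B m" "inc C m" "between B P C" using mid assms by metis
  have nB: "\<not> inc B t" using BC assms btw_distinct line_eq by metis
  have o: "opp t B C" using btw_opp BC assms nB by metis
  have "ss t B U \<or> opp t B U" using ss_or_opp nB assms by blast
  then show ?thesis using BC o opp_opp_ss opp_sym by metis
qed

text \<open>For points of a line \<open>w\<close> through \<open>P\<close>, the sides of any other
  line through \<open>P\<close> only record on which side of \<open>P\<close> the points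
  lie.\<close>

lemma line_side:
  assumes "inc P w" "inc P t" "inc P t'" "w \<noteq> t'" "inc Z w" "inc G w" "ss t Z G"
  shows "ss t' Z G"
proof -
  have n: "\<not> inc Z t" "\<not> inc G t" using assms ssD by blast+
  have n': "\<not> inc Z t'" "\<not> inc G t'" using n assms line_eq by metis+
  have "\<not> opp t' Z G"
  proof
    assume "opp t' Z G"
    then have "between Z P G" using opp_btw assms by blast
    then have "opp t Z G" using btw_opp assms n by blast
    then show False using assms ss_not_opp by blast
  qed
  then show ?thesis using n' ss_or_opp by blast
qed

text \<open>Let \<open>X'\<close> lie beyond \<open>P\<close> on \<open>t\<close>. If
  \<open>w\<close> did not separate \<open>X\<close> from \<open>U\<close>, it would separate
  \<open>U\<close> from \<open>X'\<close> at some \<open>G\<close>. This \<open>G\<close> is on the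
  same ray of \<open>w\<close> as \<open>Z\<close>, being on \<open>U\<close>'s side of
  \<open>t\<close>, and yet on the side of \<open>m\<close> that contains \<open>X'\<close>.\<close>

lemma crossbar:
  assumes "inc P t" "inc X t" "X \<noteq> P" "inc P m" "inc U m" "inc P w" "inc Z w"
    "ss t Z U" "ss m Z X"
  shows "opp w X U"
proof (rule ccontr)
  assume n: "\<not> ?thesis"
  have nt: "\<not> inc Z t" "\<not> inc U t" and nm: "\<not> inc Z m" "\<not> inc X m" using assms ssD by blast+
  have nw: "\<not> inc X w" "\<not> inc U w" using nt nm assms line_eq by metis+
  obtain X' where X': "between X P X'" using extend assms by metis
  have X't: "inc X' t" using X' assms btw_inc1 by blast
  have o: "opp w X X'" using btw_opp X' assms nw by blast
  have om: "opp m X X'" using btw_opp X' assms nm by blast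
  have "opp w U X'" using n o nw ss_or_opp ss_opp ss_sym by metis
  then obtain G where G: "inc G w" "between U G X'" using opp_def by blast
  have 1: "ss t U G" using btw_ss G X't nt by blast
  have 2: "ss m X' G" using btw_ss[of X' G U m] G btw_sym assms om oppD by blast
  have "ss t Z G" using assms 1 ss_trans by blast
  then have "ss m Z G" using line_side[of P w t m Z G] assms G nm by blast
  then have "ss m X X'" using 2 assms ss_trans ss_sym by metis
  then show False using om ss_not_opp by blast
qed

text \<open>Of two rays from \<open>P\<close> on one side of \<open>t\<close>, the one nearer to
  \<open>PX\<close> runs inside the angle of the other.\<close>

lemma angle_swap:
  assumes "inc P t" "inc X t" "X \<noteq> P" "inc P m" "inc U m" "inc P m'" "inc U' m'" "m \<noteq> m'"
    "ss t U U'" "opp m U' X"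
  shows "ss m' U X"
proof (rule ccontr)
  assume n: "\<not> ?thesis"
  have nt: "\<not> inc U t" "\<not> inc U' t" and nm: "\<not> inc U' m" "\<not> inc X m" using assms ssD oppD by blast+
  have nm': "\<not> inc U m'" "\<not> inc X m'" using nt nm assms line_eq by metis+
  have "opp m' U X" using n nm' ss_or_opp by blast
  then obtain G where G: "inc G m'" "between U G X" using opp_def by blast
  have 1: "ss t U G" using btw_ss G assms nt by blast
  have 2: "ss m X G" using btw_ss[of X G U m] G btw_sym assms nm by blast
  have "ss t U' G" using assms 1 ss_trans ss_sym by metis
  then have "ss m U' G" using line_side[of P m' t m U' G] assms G by blast
  then have "ss m U' X" using 2 ss_trans ss_sym by metis
  then show False using assms ss_not_opp by blast
qed

end

section \<open>Limiting parallels\<close>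

context incidence_structure begin

text \<open>The ray from \<open>P\<close> through \<open>U\<close> is a limiting parallel of the ray from \<open>X\<close> through \<open>Y\<close>:
  \<open>t\<close> is the line \<open>PX\<close>, and \<open>w\<close> runs over the lines entering the angle between \<open>PX\<close> and \<open>PU\<close>.\<close>
definition par :: "'p \<Rightarrow> 'p \<Rightarrow> 'p \<Rightarrow> 'p \<Rightarrow> bool" where
  "par P U X Y \<longleftrightarrow> P \<noteq> X \<and> (\<exists>t m l. inc P t \<and> inc X t \<and> inc P m \<and> inc U m \<and> inc X l \<and> inc Y l \<and>
     \<not> meets m l \<and> m \<noteq> l \<and> ss t U Y \<and>
     (\<forall>Z w. ss t Z U \<longrightarrow> ss m Z X \<longrightarrow> inc P w \<longrightarrow> inc Z w \<longrightarrow> meets w l))"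

end

context hyperbolic_incidence begin

section \<open>Existence, uniqueness and symmetry of limiting parallels\<close>

lemma parE:
  assumes "par P U X Y"
  obtains t m l where "inc P t" "inc X t" "inc P m" "inc U m" "inc X l" "inc Y l"
  using assms unfolding par_def by blast

lemma par_points: "par P U X Y \<Longrightarrow> P \<noteq> X \<and> U \<noteq> P \<and> Y \<noteq> X"
  unfolding par_def using ssD by blast

lemma parD:
  assumes "par P U X Y" "inc P t" "inc X t" "inc P m" "inc U m" "inc X l" "inc Y l"
  shows "\<not> meets m l" "m \<noteq> l" "ss t U Y"
    "\<And>Z w. ss t Z U \<Longrightarrow> ss m Z X \<Longrightarrow> inc P w \<Longrightarrow> inc Z w \<Longrightarrow> meets w l"
proof -
  have d: "P \<noteq> X" "U \<noteq> P" "Y \<noteq> X" using par_points assms by blast+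
  obtain t' m' l' where h: "inc P t'" "inc X t'" "inc P m'" "inc U m'" "inc X l'" "inc Y l'"
     "\<not> meets m' l'" "m' \<noteq> l'" "ss t' U Y"
     "\<And>Z w. ss t' Z U \<Longrightarrow> ss m' Z X \<Longrightarrow> inc P w \<Longrightarrow> inc Z w \<Longrightarrow> meets w l'"
    using assms(1) unfolding par_def by blast
  have e: "t' = t" "m' = m" "l' = l" using h(1-6) assms d line_eq by metis+
  show "\<not> meets m l" "m \<noteq> l" "ss t U Y"
    "\<And>Z w. ss t Z U \<Longrightarrow> ss m Z X \<Longrightarrow> inc P w \<Longrightarrow> inc Z w \<Longrightarrow> meets w l"
    using h(7-10) unfolding e by blast+
qed

lemma parI:
  assumes "P \<noteq> X" "inc P t" "inc X t" "inc P m" "inc U m" "inc X l" "inc Y l"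
    "\<not> meets m l" "m \<noteq> l" "ss t U Y"
    "\<And>Z w. ss t Z U \<Longrightarrow> ss m Z X \<Longrightarrow> inc P w \<Longrightarrow> inc Z w \<Longrightarrow> meets w l"
  shows "par P U X Y"
  unfolding par_def using assms by blast

lemma par_off:
  assumes "par P U X Y" "inc P m" "inc U m" "inc X l" "inc Y l"
  shows "\<not> inc P l" "\<not> inc X m"
proof -
  obtain t where t: "inc P t" "inc X t" using ex_line by blast
  show "\<not> inc P l" "\<not> inc X m" using parD(1,2)[OF assms(1) t assms(2-5)] assms meetsI by metis+
qed

text \<open>The line \<open>x\<close>, which meets \<open>m\<close> but misses \<open>n\<close>,
  selects the limiting ray of \<open>m\<close>. If a line \<open>w\<close> inside the angle missed
  \<open>l\<close>, some \<open>c\<close> through \<open>X\<close> would meet \<open>w\<close>, miss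
  \<open>m\<close>, and so meet \<open>n\<close>. If it does so on \<open>U\<close>'s side of
  \<open>t\<close>, then \<open>n\<close> separates \<open>X\<close> from \<open>U\<close>, but
  \<open>x\<close> misses \<open>n\<close>. Otherwise \<open>l\<close> separates a point of
  \<open>n\<close> from one of \<open>w\<close>, but both lines miss \<open>l\<close> and pass
  through \<open>P\<close>.\<close>

lemma asymptote_par:
  assumes "\<not> inc P l" "inc X l" "inc P m" "inc P n" "m \<noteq> n" "\<not> meets m l" "\<not> meets n l"
    and cov: "\<And>k. meets k l \<Longrightarrow> meets k m \<or> meets k n"
    and x: "inc X x" "\<not> meets x n" "inc U x" "inc U m"
    and Y: "inc Y l" "inc P t" "inc X t" "ss t U Y"
  shows "par P U X Y"
proof (rule parI[OF _ Y(2,3) assms(3) x(4) assms(2) Y(1) assms(6) _ Y(4)])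
  show PX: "P \<noteq> X" and ml: "m \<noteq> l" using assms by blast+
  fix Z w assume Z: "ss t Z U" "ss m Z X" "inc P w" "inc Z w"
  show "meets w l"
  proof (rule ccontr)
    assume wl: "\<not> meets w l"
    have nZ: "\<not> inc Z t" "\<not> inc Z m" "\<not> inc U t" "\<not> inc X m" using Z ssD by blast+
    have wt: "w \<noteq> t" "w \<noteq> m" "w \<noteq> l" using nZ Z assms(1) by blast+
    have "meets w m" using Z(3) assms(3) wt(2) by (rule meetsI)
    then obtain c where c: "inc X c" "meets c w" "\<not> meets c m" using nZ(4) by (rule meeting_only_one)
    have "c \<noteq> l" using c wl meets_sym by blast
    then have "meets c l" using c(1) assms(2) meetsI by blast
    then have "meets c n" using cov c by blast
    then obtain W where W: "inc W c" "inc W n" using meetsE by metis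
    obtain Z' where Z': "inc Z' c" "inc Z' w" using c meetsE by metis
    have Xn: "\<not> inc X n" using assms(1,2,4,7) meetsI by metis
    have cm: "c \<noteq> m" using c nZ by blast
    have Pc: "\<not> inc P c" using c cm assms(3) meetsI by blast
    have Z'P: "Z' \<noteq> P" "W \<noteq> P" using Pc Z' W by blast+
    have Z'm: "\<not> inc Z' m" using Z' Z'P wt Z(3) assms(3) line_eq by metis
    have Z't: "\<not> inc Z' t" using Z' Z'P wt Z(3) Y(2) line_eq by metis
    have "\<not> opp m Z' X" using c(3) Z'(1) c(1) opp_meets by blast
    then have "ss m Z' X" using Z'm nZ ss_or_opp by blast
    then have sm: "ss m Z' Z" using Z(2) ss_trans ss_sym by metis
    then have "ss t Z' Z" using line_side[of P w m t Z' Z] Z assms(3) Y(2) wt Z' by blast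
    then have Z'U: "ss t Z' U" using Z(1) ss_trans by blast
    have nt: "n \<noteq> t" using Xn Y by blast
    have Wt: "\<not> inc W t" using W Z'P nt assms(4) Y(2) line_eq by metis
    have Wm: "\<not> inc W m" using W(2) Z'P assms(3,4,5) line_eq by metis
    show False
    proof (cases "ss t W U")
      case True
      have "\<not> opp m W X" using c(3) W(1) c(1) opp_meets by blast
      then have "ss m W X" using Wm nZ(4) ss_or_opp by blast
      then have "opp n X U" using crossbar[of P t X m U n W] Y PX assms(3,4) x W True by blast
      then show False using opp_meets x by blast
    next
      case False
      then have "opp t W U" using ss_or_opp Wt nZ by blast
      then have "opp t W Z'" using Z'U ss_opp opp_sym by metis
      then have b: "between W X Z'" using opp_btw W Z' c Y by metis
      have Wl: "ss l W P" using ss_miss[of P n W l] assms(1,4,7) W ss_sym by metis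
      have Z'l: "ss l Z' P" using ss_miss[of P w Z' l] assms(1) Z(3) wl Z' ss_sym by metis
      have "opp l W Z'" using btw_opp[OF b assms(2)] Wl ssD by blast
      then show False using Wl Z'l ss_trans ss_sym ss_not_opp by metis
    qed
  qed
qed

text \<open>Each of the two asymptotes carries one limiting ray. By \<open>crossbar\<close> these
  rays lie on opposite sides of \<open>PX\<close>, so one of them runs in the direction of
  \<open>Y\<close>.\<close>

lemma par_exists:
  assumes "\<not> inc P l" "inc X l" "inc Y l" "X \<noteq> Y"
  shows "\<exists>U. par P U X Y"
proof -
  obtain m n where mn: "m \<noteq> n" "inc P m" "inc P n" "\<not> meets m l" "\<not> meets n l"
    and cov: "\<And>k. meets k l \<Longrightarrow> meets k m \<or> meets k n" by (rule cover[OF assms(1)]) blast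
  have Xmn: "\<not> inc X m" "\<not> inc X n" using mn assms meetsI by metis+
  obtain t where t: "inc P t" "inc X t" using ex_line by blast
  have tl: "t \<noteq> l" using t assms by blast
  have Yt: "\<not> inc Y t" using t tl assms line_eq by metis
  \<comment> \<open>One of the two asymptotes of \<open>n\<close> through \<open>X\<close> differs
    from \<open>l\<close>; it meets \<open>l\<close> in \<open>X\<close> and so, missing
    \<open>n\<close>, it meets \<open>m\<close>.\<close>
  have ex: "\<exists>x. inc X x \<and> \<not> meets x n \<and> meets x m"
    if h: "\<not> inc X n" "\<And>k. meets k l \<Longrightarrow> meets k m \<or> meets k n" for m n
  proof -
    obtain a b where "a \<noteq> b" "inc X a" "inc X b" "\<not> meets a n" "\<not> meets b n" using cover[OF h(1)] by metis
    then obtain x where "inc X x" "\<not> meets x n" "x \<noteq> l" by metis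
    then show ?thesis using h assms meetsI by metis
  qed
  obtain x where x: "inc X x" "\<not> meets x n" "meets x m" using ex[of n m] Xmn cov by blast
  obtain y where y: "inc X y" "\<not> meets y m" "meets y n" using ex[of m n] Xmn cov by blast
  obtain U where U: "inc U x" "inc U m" using x meetsE by metis
  obtain V where V: "inc V y" "inc V n" using y meetsE by metis
  have PX: "P \<noteq> X" using assms by blast
  have mt: "m \<noteq> t" "n \<noteq> t" using Xmn t by blast+
  have UP: "U \<noteq> P" using x U mn(3) Xmn meetsI by metis
  have VP: "V \<noteq> P" using y V mn(2) Xmn meetsI by metis
  have Ut: "\<not> inc U t" using U UP mt mn t line_eq by metis
  have Vt: "\<not> inc V t" using V VP mt mn t line_eq by metis
  have "opp t U V"
  proof (rule ccontr)
    assume "\<not> opp t U V"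
    then have s: "ss t V U" using Ut Vt ss_or_opp ss_sym by metis
    have Vm: "\<not> inc V m" using V VP mn line_eq by metis
    have "\<not> opp m V X" using y V opp_meets by blast
    then have "ss m V X" using Vm Xmn ss_or_opp by blast
    then have "opp n X U" using crossbar[of P t X m U n V] t PX mn U V s by metis
    then show False using opp_meets x U by blast
  qed
  then have "ss t U Y \<or> ss t V Y" using Ut Vt Yt ss_or_opp opp_opp_ss opp_sym by metis
  then show ?thesis
  proof
    assume "ss t U Y"
    then show ?thesis using asymptote_par[OF assms(1,2) mn(2,3,1,4,5) cov x(1,2) U assms(3) t] by blast
  next
    assume s: "ss t V Y"
    have cov': "\<And>k. meets k l \<Longrightarrow> meets k n \<or> meets k m" using cov by blast
    show ?thesis using asymptote_par[OF assms(1,2) mn(3,2) mn(1)[symmetric] mn(5,4) cov' y(1,2) V assms(3) t s] by blast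
  qed
qed

text \<open>The inner of two limiting rays would enter the angle of the outer one and therefore meet
  \<open>l\<close>.\<close>

lemma par_unique:
  assumes "par P U X Y" "par P U' X Y" "inc P m" "inc U m" "inc P m'" "inc U' m'"
  shows "m = m'"
proof (rule ccontr)
  assume n: "m \<noteq> m'"
  obtain t l where tl: "inc P t" "inc X t" "inc X l" "inc Y l" using ex_line by metis
  have PX: "X \<noteq> P" using par_points assms by blast
  note A = parD[OF assms(1) tl(1,2) assms(3,4) tl(3,4)]
  note B = parD[OF assms(2) tl(1,2) assms(5,6) tl(3,4)]
  have s: "ss t U U'" using A(3) B(3) ss_trans ss_sym by metis
  have U'm: "\<not> inc U' m" using n assms(3,5,6) par_points[OF assms(2)] line_eq by metis
  have Xm: "\<not> inc X m" using par_off[OF assms(1,3,4) tl(3,4)] by blast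
  show False
  proof (cases "ss m U' X")
    case True
    then show False using A(4)[of U' m'] s ss_sym assms(5,6) B(1) by metis
  next
    case False
    then have "opp m U' X" using U'm Xm ss_or_opp by blast
    then have "ss m' U X" using angle_swap[OF tl(1,2) PX assms(3,4,5,6) n s] by blast
    then show False using B(4)[of U m] s assms(3,4) A(1) by metis
  qed
qed

lemma par_cong1:
  assumes "par P U X Y" "inc P m" "inc U m" "inc U1 m" "inc P t" "inc X t" "ss t U1 U"
  shows "par P U1 X Y"
proof -
  obtain l where l: "inc X l" "inc Y l" using ex_line by metis
  note A = parD[OF assms(1,5,6,2,3) l]
  show ?thesis
  proof (rule parI[OF _ assms(5,6,2,4) l A(1,2)])
    show "P \<noteq> X" using par_points assms by blast
    show "ss t U1 Y" using assms(7) A(3) ss_trans by blast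
    show "meets w l" if "ss t Z U1" "ss m Z X" "inc P w" "inc Z w" for Z w
      using A(4) that assms(7) ss_trans by blast
  qed
qed

lemma par_cong2:
  assumes "par P U X Y" "inc X l" "inc Y l" "inc Y1 l" "inc P t" "inc X t" "ss t Y1 Y"
  shows "par P U X Y1"
proof -
  obtain m where m: "inc P m" "inc U m" using ex_line by metis
  note A = parD[OF assms(1,5,6) m assms(2,3)]
  show ?thesis
    by (rule parI[OF _ assms(5,6) m assms(2,4) A(1,2)]) (use par_points assms A ss_trans ss_sym in metis)+
qed

text \<open>Suppose \<open>k\<close> through \<open>X\<close> enters the angle at \<open>X\<close>
  but misses \<open>m\<close>. A line \<open>z\<close> through \<open>P\<close> that meets
  \<open>k\<close> and misses \<open>l\<close> meets it inside the angle at \<open>P\<close>,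
  because \<open>k\<close> stays on one side of \<open>m\<close>; then \<open>z\<close> has to meet
  \<open>l\<close>.\<close>

lemma par_sym:
  assumes "par P U X Y"
  shows "par X Y P U"
proof -
  obtain t m l where I: "inc P t" "inc X t" "inc P m" "inc U m" "inc X l" "inc Y l" by (rule parE[OF assms])
  note A = parD[OF assms I]
  have PX: "P \<noteq> X" using par_points assms by blast
  have off: "\<not> inc P l" "\<not> inc X m" using par_off[OF assms I(3-6)] by blast+
  show ?thesis
  proof (rule parI[OF _ I(2,1,5,6,3,4)])
    show "X \<noteq> P" "l \<noteq> m" "\<not> meets l m" "ss t Y U" using PX A meets_sym ss_sym by metis+
    fix Z k assume Z: "ss t Z Y" "ss l Z P" "inc X k" "inc Z k"
    show "meets k m"
    proof (rule ccontr)
      assume km: "\<not> meets k m"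
      have nZ: "\<not> inc Z t" "\<not> inc Z l" using Z ssD by blast+
      have kl: "k \<noteq> l" "k \<noteq> t" "k \<noteq> m" using nZ Z off by blast+
      have "meets k l" using meetsI Z(3) I(5) kl by blast
      then obtain z where z: "inc P z" "meets z k" "\<not> meets z l" using off(1) by (rule meeting_only_one)
      obtain Z' where Z': "inc Z' z" "inc Z' k" using z meetsE by metis
      have zl: "z \<noteq> l" using z off by blast
      have Z'X: "Z' \<noteq> X" using Z'(1) z zl I(5) meetsI by blast
      have Z'l: "\<not> inc Z' l" using Z'(1) z(3) zl meetsI by blast
      have "\<not> opp l Z' P" using z Z' opp_meets by blast
      then have "ss l Z' P" using Z'l off ss_or_opp by blast
      then have "ss l Z' Z" using Z ss_trans ss_sym by metis
      then have "ss t Z' Z" using line_side[of X k l t Z' Z] Z I kl Z' by blast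
      then have "ss t Z' U" using Z(1) A(3) ss_trans ss_sym by metis
      moreover have "ss m Z' X" using ss_miss[of X k Z' m] Z(3) Z' km off ss_sym by metis
      ultimately have "meets z l" using A(4) z Z' by blast
      then show False using z by blast
    qed
  qed
qed

section \<open>Limiting parallels and change of origin\<close>

text \<open>Pasch for the triangle \<open>P\<close>, \<open>X\<close> and the common end of the two
  rays: a line \<open>k\<close> entering through the side \<open>PU\<close> leaves through one of
  the others. The limiting property replaces the missing third vertex.\<close>

lemma par_cross:
  assumes "par P U X Y" and I: "inc P t" "inc X t" "inc P m" "inc U m" "inc X l" "inc Y l"
    and k: "inc U1 m" "ss t U1 U" "inc U1 k" "k \<noteq> m"
  shows "(\<exists>V. inc V k \<and> inc V l \<and> ss t V Y) \<or> opp k P X \<or> inc X k"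
proof (rule ccontr)
  assume n: "\<not> ?thesis"
  note A = parD[OF assms(1) I]
  have PX: "P \<noteq> X" using par_points assms by blast
  have off: "\<not> inc P l" "\<not> inc X m" using par_off[OF assms(1) I(3-6)] by blast+
  have U1: "\<not> inc U1 t" "U1 \<noteq> P" using k ssD I by blast+
  have Pk: "\<not> inc P k" using k I U1 line_eq by metis
  have kPX: "ss k P X" using n Pk ss_or_opp by blast
  have Xk: "\<not> inc X k" using n by blast
  have U1l: "ss l U1 P" using ss_miss[of P m U1 l] I k A(1) off ss_sym by metis
  have U1Y: "ss t U1 Y" using k(2) A(3) ss_trans by blast
  \<comment> \<open>If \<open>k\<close> reaches a point \<open>Z\<close> beyond \<open>l\<close>
    within the closed half-plane of \<open>U1\<close>, it has crossed \<open>l\<close> on the ray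
    \<open>XY\<close> on its way from \<open>U1\<close>.\<close>
  have fin: False if Z: "inc Z k" "opp l P Z" "inc Z t \<or> ss t Z U1" for Z
  proof -
    have "opp l U1 Z" using U1l Z ss_opp by blast
    then obtain V where V: "inc V l" "between U1 V Z" using opp_def by blast
    have Vk: "inc V k" using V Z k btw_inc2 by blast
    have "ss t V U1"
    proof (cases "inc Z t")
      case True then show ?thesis using btw_ss V U1 ss_sym by metis
    next
      case False
      then have s: "ss t Z U1" using Z by blast
      have Zt: "\<not> inc Z t" using s ssD by blast
      have Vt: "\<not> inc V t"
        using V s btw_opp[of U1 V Z t] U1 ss_not_opp opp_sym by metis
      have "\<not> opp t V U1"
      proof
        assume "opp t V U1"
        then obtain Q where Q: "inc Q t" "between V Q U1" using opp_def by blast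
        then have Qk: "inc Q k" using Vk k btw_inc2 by metis
        have "\<not> between U1 Q Z" using s btw_opp Q U1 ss_not_opp opp_sym by metis
        moreover have "between V Q Z \<or> between Z Q U1" using btw_four[of V Q U1 k Z] Q Qk Vk Z Zt by metis
        ultimately have "between V Q Z" using btw_sym by blast
        then have "between U1 V Z \<and> between U1 Q V \<and> between V Q Z" using Q V btw_sym by metis
        then show False using btw_not_nested by blast
      qed
      then show ?thesis using Vt U1 ss_or_opp by blast
    qed
    then have "ss t V Y" using U1Y ss_trans by blast
    then show False using n V Vk by blast
  qed
  \<comment> \<open>A crossing with \<open>t\<close> on the ray \<open>PX\<close> cannot lie between
    \<open>P\<close> and \<open>X\<close>, so it lies beyond \<open>X\<close> and hence beyond
    \<open>l\<close>.\<close>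
  have t_case: False if Z: "inc Z k" "inc Z t" "ss m Z X" for Z
  proof -
    have "\<not> inc Z m" using Z ssD by blast
    then have ZP: "Z \<noteq> P" "Z \<noteq> X" using I Z Xk by blast+
    have n1: "\<not> between P Z X" using btw_opp Pk Z kPX ss_not_opp by blast
    have n2: "\<not> between Z P X" using btw_opp[of Z P X m] Z ssD I ss_not_opp by blast
    have "between P X Z" using btw_total[of P X Z t] n1 n2 I Z ZP PX btw_sym by metis
    then have "opp l P Z" using btw_opp I off by blast
    then show False using fin Z by blast
  qed
  obtain Z where Z: "inc Z k" "ss m Z X" using ray_point[of U1 k m X] k off by blast
  have Zm: "\<not> inc Z m" using Z ssD by blast
  show False
  proof (cases "inc Z t")
    case True then show False using t_case Z by blast
  next
    case Zt: False
    show False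
    proof (cases "ss t Z U1")
      case True
      then have ZU: "ss t Z U" using k(2) ss_trans by blast
      obtain w where w: "inc P w" "inc Z w" using ex_line by blast
      have "meets w l" using A(4) ZU Z w by blast
      then obtain Y1 where Y1: "inc Y1 w" "inc Y1 l" using meetsE by metis
      have Y1P: "Y1 \<noteq> P" using Y1 off by blast
      have Y1m: "ss m Y1 X" using ss_miss[of X l Y1 m] I Y1 A(1) meets_sym off ss_sym by metis
      have wt: "w \<noteq> t" using w Zt by blast
      have "ss m Y1 Z" using Y1m Z ss_trans ss_sym by metis
      then have Y1Z: "ss t Y1 Z" using line_side[of P w m t Y1 Z] w I wt Y1 by blast
      then have Y1Y: "ss t Y1 Y" using True U1Y ss_trans by metis
      have ZP: "Z \<noteq> P" using Z(1) Pk by blast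
      show False
      proof (cases "inc Y1 k")
        case True then show False using n Y1 Y1Y by blast
      next
        case Y1k: False
        then have ZY1: "Z \<noteq> Y1" using Z by blast
        have "\<not> between Z P Y1" using btw_opp[of Z P Y1 t] I Zt Y1Z ss_not_opp opp_sym by metis
        then have "between P Z Y1 \<or> between P Y1 Z"
          using btw_total[of P Z Y1 w] w Y1 Y1P ZP ZY1 btw_sym by metis
        then show False
        proof
          assume "between P Z Y1"
          then have "opp k P Y1" using btw_opp Z Pk by blast
          then have "opp k X Y1" using kPX ss_opp ss_sym by metis
          then obtain V where V: "inc V k" "between X V Y1" using opp_def by blast
          have Vl: "inc V l" using V I Y1 btw_inc2 by blast
          have "ss t Y1 V" using btw_ss[of Y1 V X t] V btw_sym I Y1Z ssD by metis
          then have "ss t V Y" using Y1Y ss_trans ss_sym by metis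
          then show False using n V Vl by blast
        next
          assume "between P Y1 Z"
          then have "opp l P Z" using btw_opp Y1 off by blast
          then show False using fin Z True by blast
        qed
      qed
    next
      case False
      then have "opp t U1 Z" using Zt U1 ss_or_opp ss_sym by metis
      then obtain T where T: "inc T t" "between U1 T Z" using opp_def by blast
      have Tk: "inc T k" using T Z k btw_inc2 by blast
      have "ss m Z T" using btw_ss[of Z T U1 m] T btw_sym k Zm by blast
      then have "ss m T X" using Z ss_trans ss_sym by metis
      then show False using t_case T Tk by blast
    qed
  qed
qed

lemma btw_same_side: "between A B C \<Longrightarrow> inc A t \<Longrightarrow> \<not> inc B t \<or> \<not> inc C t \<Longrightarrow> ss t B C"
proof -
  assume h: "between A B C" "inc A t" "\<not> inc B t \<or> \<not> inc C t"
  have "\<not> inc C t" using h btw_inc2 btw_sym btw_inc1 by blast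
  then show ?thesis using btw_ss[of C B A t] h btw_sym ss_sym by metis
qed

text \<open>The angle at \<open>P\<close> shrinks, so the lines entering it should still meet
  \<open>l\<close>. That the new angle is contained in the old one is read off from the point
  \<open>G\<close> where \<open>w\<close> crosses the segment \<open>X1 U\<close>.\<close>

lemma par_fwd:
  assumes "par P U X Y" "between X X1 Y1" "inc X l" "inc Y l" "inc X1 l" "inc P t" "inc X t" "ss t X1 Y"
  shows "par P U X1 Y1"
proof -
  obtain m where m: "inc P m" "inc U m" using ex_line by metis
  note A = parD[OF assms(1,6,7) m assms(3,4)]
  have off: "\<not> inc P l" "\<not> inc X m" using par_off[OF assms(1) m assms(3,4)] by blast+
  have Y1: "inc Y1 l" using assms btw_inc1 by blast
  have d: "X \<noteq> X1" "X1 \<noteq> Y1" "P \<noteq> X" "X \<noteq> P" "P \<noteq> X1" "X1 \<noteq> P"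
    using assms btw_distinct par_points off by blast+
  obtain t1 where t1: "inc P t1" "inc X1 t1" using ex_line by blast
  have X1m: "ss m X1 X" using ss_miss[of X l X1 m] assms(3,5) A(1,2) meets_sym off ss_sym by metis
  have X1t: "ss t X1 U" using assms(8) A(3) ss_trans ss_sym by metis
  have o: "opp t1 X U" using crossbar[of P t X m U t1 X1] assms d m t1 X1t X1m by blast
  have Xt1: "\<not> inc X t1" using o oppD by blast
  have "opp t1 X Y1" using btw_opp assms t1 Xt1 by blast
  then have s: "ss t1 U Y1" using o opp_opp_ss opp_sym by metis
  show ?thesis
  proof (rule parI[OF d(5) t1 m assms(5) Y1 A(1,2) s])
    fix Z w assume Z: "ss t1 Z U" "ss m Z X1" "inc P w" "inc Z w"
    have "opp w X1 U" using crossbar[of P t1 X1 m U w Z] t1 d m Z by blast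
    then obtain G where G: "inc G w" "between X1 G U" using opp_def by blast
    have Gm: "ss m X1 G" using btw_ss[OF G(2) m(2)] X1m ssD by blast
    have wt: "w \<noteq> t" "w \<noteq> m"
    proof -
      show "w \<noteq> m" using Z ssD by blast
      show "w \<noteq> t"
      proof
        assume "w = t"
        then have "opp t X1 U" using \<open>opp w X1 U\<close> by blast
        then show False using X1t ss_not_opp by blast
      qed
    qed
    have "ss m Z G" using Z Gm ss_trans by blast
    then have zg: "ss t Z G" using line_side[of P w m t Z G] Z m assms wt G by blast
    have "ss t G U"
    proof -
      have "\<not> opp t G U"
      proof
        assume "opp t G U"
        then obtain H where H: "inc H t" "between G H U" using opp_def by blast
        obtain k where k: "inc X1 k" "inc G k" "inc U k" using btw_line G by blast
        have Hk: "inc H k" using H k btw_inc2 by metis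
        have nb: "\<not> between X1 H U" using btw_opp H X1t ss_not_opp ssD by blast
        have "X1 \<noteq> H" using H X1t ssD by blast
        then have "between G H X1" using btw_four[OF H(2) k(2) Hk k(1)] nb by blast
        then have "between X1 H G \<and> between G H U \<and> between X1 G U" using H G btw_sym by blast
        then show False using btw_not_nested[of X1 H G U] btw_not_nested[of U H G X1] btw_sym by metis
      qed
      then show ?thesis using zg X1t ssD ss_or_opp by blast
    qed
    then have "ss t Z U" using zg ss_trans by blast
    moreover have "ss m Z X" using Z X1m ss_trans by blast
    ultimately show "meets w l" using A(4) Z by blast
  qed
qed

text \<open>The angle at \<open>P\<close> grows. A line in the new angle is \<open>PX\<close>, or
  enters the old angle, or lies in the angle between \<open>PX1\<close> and \<open>PX\<close> and
  meets \<open>l\<close> by \<open>crossbar\<close>.\<close>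

lemma par_bwd:
  assumes "par P U X Y" "between X1 X Y"
  shows "par P U X1 Y"
proof -
  obtain t m l where I: "inc P t" "inc X t" "inc P m" "inc U m" "inc X l" "inc Y l" by (rule parE[OF assms(1)])
  note A = parD[OF assms(1) I]
  have off: "\<not> inc P l" "\<not> inc X m" using par_off[OF assms(1) I(3-6)] by blast+
  have X1: "inc X1 l" using assms I btw_inc3 by blast
  have d: "X1 \<noteq> X" "X \<noteq> Y" "X1 \<noteq> Y" "P \<noteq> X" "X \<noteq> P" "P \<noteq> X1" "X1 \<noteq> P"
    using assms btw_distinct par_points off X1 by blast+
  obtain t1 where t1: "inc P t1" "inc X1 t1" using ex_line by blast
  have Yt: "\<not> inc Y t" "\<not> inc U t" using A ssD by blast+
  have X1t: "\<not> inc X1 t" using X1 d I Yt line_eq by metis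
  have tt: "t1 \<noteq> t" using X1t t1 by blast
  have Xt1: "\<not> inc X t1" using tt t1 I d line_eq by metis
  have X1m: "ss m X1 X" using ss_miss[of X l X1 m] I X1 A(1,2) meets_sym off ss_sym by metis
  have mt1: "m \<noteq> t1" using X1m t1 ssD by blast
  have UP: "U \<noteq> P" using par_points assms by blast
  have Ut1: "\<not> inc U t1" using UP mt1 t1 I line_eq by metis
  have Xt: "opp t X1 Y" using btw_opp assms I X1t by blast
  then have X1U: "opp t X1 U" using A(3) ss_opp opp_sym ss_sym by metis
  have "ss t1 X Y" using btw_same_side assms t1 Xt1 by blast
  have s: "ss t1 X U"
  proof (rule ccontr)
    assume "\<not> ?thesis"
    then have "opp t1 U X" using Xt1 Ut1 ss_or_opp opp_sym by blast
    then obtain G where G: "inc G t1" "between U G X" using opp_def by blast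
    have 1: "ss t U G" using btw_ss G I Yt by blast
    have 2: "ss m X G" using btw_ss[of X G U m] G btw_sym I off by blast
    have "opp t G X1" using 1 X1U ss_opp opp_sym ss_sym by metis
    then have "between G P X1" using opp_btw G t1 I by blast
    then have "opp m G X1" using btw_opp I 2 ssD by blast
    then show False using 2 X1m ss_trans ss_sym ss_not_opp by metis
  qed
  have UY: "ss t1 U Y" using s \<open>ss t1 X Y\<close> ss_trans ss_sym by metis
  show ?thesis
  proof (rule parI[OF d(6) t1 I(3,4) X1 I(6) A(1,2) UY])
    fix Z w assume Z: "ss t1 Z U" "ss m Z X1" "inc P w" "inc Z w"
    have Zm: "ss m Z X" using Z X1m ss_trans by blast
    show "meets w l"
    proof (cases "inc Z t")
      case True
      then have "w = t" using Z I line_eq[of P Z w t] ssD by metis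
      then show ?thesis using I d off meetsI by metis
    next
      case Zt: False
      show ?thesis
      proof (cases "ss t Z U")
        case True then show ?thesis using A(4) Zm Z by blast
      next
        case False
        then have "opp t Z U" using Zt Yt ss_or_opp by blast
        then have "ss t Z X1" using X1U opp_opp_ss opp_sym by metis
        moreover have "ss t1 Z X" using Z s ss_trans ss_sym by metis
        ultimately have "opp w X1 X" using crossbar[of P t1 X1 t X w Z] t1 d I Z by blast
        then show ?thesis using opp_meets X1 I meets_sym by metis
      qed
    qed
  qed
qed

lemma par_dir:
  assumes "inc Q m" "inc U m" "inc W m" "inc Q t" "ss t U W"
  shows "par R V Q U \<longleftrightarrow> par R V Q W"
proof -
  have *: "par R V Q W'" if h: "par R V Q U'" "inc U' m" "inc W' m" "ss t U' W'" for U' W'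
  proof -
    obtain t' where t': "inc R t'" "inc Q t'" using ex_line by blast
    obtain k where k: "inc R k" "inc V k" using ex_line by blast
    have "ss t' V U'" using parD(3)[OF h(1) t' k assms(1) h(2)] .
    then have "m \<noteq> t'" using h ssD by blast
    then have "ss t' U' W'" using line_side[of Q m t t'] assms h t' by blast
    then show ?thesis using par_cong2[OF h(1) assms(1) h(2,3) t'] ss_sym by blast
  qed
  show ?thesis using * assms ss_sym by metis
qed

text \<open>Limiting parallelism depends on a direction along \<open>l\<close> and not on the origin
  of the ray. When \<open>X1\<close> lies behind \<open>X\<close> the point \<open>Y\<close> still
  marks the direction; on the ray itself a point beyond \<open>X1\<close> does.\<close>

lemma par_move:
  assumes "X \<noteq> Y" "inc X l" "inc Y l" "inc X1 l"
  shows "\<exists>Y1. inc Y1 l \<and> X1 \<noteq> Y1 \<and> (\<forall>P U. par P U X Y \<longleftrightarrow> par P U X1 Y1)"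
proof -
  consider "X1 = X" | "between X1 X Y" | "X1 \<noteq> X" "\<not> between X1 X Y" by blast
  then show ?thesis
  proof cases
    case 1 then show ?thesis using assms by blast
  next
    case 2
    have "par P U X Y" if h: "par P U X1 Y" for P U
    proof -
      obtain t where t: "inc P t" "inc X1 t" using ex_line by blast
      obtain m where m: "inc P m" "inc U m" using ex_line by blast
      have "\<not> inc Y t" using parD(3)[OF h t m assms(4,3)] ssD by blast
      then have "ss t X Y" using btw_same_side 2 t by blast
      then show ?thesis using par_fwd[OF h 2 assms(4,3,2) t] by blast
    qed
    then show ?thesis using par_bwd 2 assms btw_distinct by metis
  next
    case 3
    obtain Y1 where Y1: "between X X1 Y1" using extend 3 by metis
    have Y1l: "inc Y1 l" using Y1 assms btw_inc1 by blast
    have tX: "ss t X1 Y" if "inc X t" "\<not> inc Y t" for t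
    proof -
      have n: "\<not> inc X1 t" using that assms 3 line_eq by metis
      have "\<not> opp t X1 Y" using opp_btw[of t X1 Y l X] that assms 3 by blast
      then show ?thesis using n that ss_or_opp by blast
    qed
    have "par P U X Y \<longleftrightarrow> par P U X1 Y1" for P U
    proof
      assume h: "par P U X Y"
      obtain t where t: "inc P t" "inc X t" using ex_line by blast
      obtain m where m: "inc P m" "inc U m" using ex_line by blast
      have "\<not> inc Y t" using parD(3)[OF h t m assms(2,3)] ssD by blast
      then have "ss t X1 Y" using tX t by blast
      then show "par P U X1 Y1" using par_fwd[OF h Y1 assms(2,3,4) t] by blast
    next
      assume h: "par P U X1 Y1"
      have "par P U X Y1" using par_bwd h Y1 by blast
      moreover obtain t where t: "inc X t" "t \<noteq> l" using third_line by metis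
      have Yt: "\<not> inc Y t" using t assms line_eq by metis
      have X1t: "ss t X1 Y" using tX t Yt by blast
      then have "ss t X1 Y1" using btw_same_side Y1 t ssD by blast
      then have "ss t Y1 Y" using X1t ss_trans ss_sym by metis
      ultimately show "par P U X Y" using par_dir[of X l Y1 Y t P U] assms Y1l t by blast
    qed
    then show ?thesis using Y1 Y1l btw_distinct by metis
  qed
qed

lemma par_move_left:
  assumes "par P U X Y" "inc P m" "inc U m" "inc P1 m"
  shows "\<exists>U1. inc U1 m \<and> par P1 U1 X Y"
  using par_move[of P U m P1] assms par_points par_sym by metis

section \<open>Transitivity\<close>

text \<open>A line entering the angle at \<open>P\<close> first meets the middle line
  \<open>l\<close>. From there \<open>par_cross\<close>, applied to the second pair of rays, leads
  it to \<open>n\<close>: it meets the line \<open>PQ\<close> only in \<open>P\<close>, which is not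
  between \<open>X\<close> and \<open>Q\<close>.\<close>

lemma par_trans_between_aux:
  assumes "par P U X Y" "par X Y Q W" "between P X Q"
  shows "par P U Q W"
proof -
  obtain t m l where I: "inc P t" "inc X t" "inc P m" "inc U m" "inc X l" "inc Y l" by (rule parE[OF assms(1)])
  note A = parD[OF assms(1) I]
  have Qt: "inc Q t" using assms I btw_inc1 by blast
  obtain n where n: "inc Q n" "inc W n" using ex_line by blast
  note B = parD[OF assms(2) I(2) Qt I(5,6) n]
  have off: "\<not> inc P l" "\<not> inc X m" using par_off[OF assms(1) I(3-6)] by blast+
  have d: "P \<noteq> X" "X \<noteq> Q" "P \<noteq> Q" using assms(3) btw_distinct by blast+
  have o: "opp l P Q" using btw_opp assms I off by blast
  have mn: "\<not> meets m n" using opp_miss[OF o I(3) n(1) A(1)] B meets_sym by blast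
  have mn': "m \<noteq> n" using o opp_meets[OF o I(3)] n A by blast
  show ?thesis
  proof (rule parI[OF d(3) I(1) Qt I(3,4) n mn mn'])
    show "ss t U W" using A(3) B(3) ss_trans by blast
    fix Z w assume Z: "ss t Z U" "ss m Z Q" "inc P w" "inc Z w"
    have Qm: "\<not> inc Q m" using Z ssD by blast
    have "ss m Q X" using btw_ss[of Q X P m] assms(3) btw_sym I Qm by blast
    then have "ss m Z X" using Z ss_trans by blast
    then have "meets w l" using A(4) Z by blast
    then obtain Y1 where Y1: "inc Y1 w" "inc Y1 l" using meetsE by metis
    have wm: "w \<noteq> m" "w \<noteq> t" using Z ssD by blast+
    have Y1m: "ss m Y1 X" using ss_miss[of X l Y1 m] I Y1 A(1) meets_sym off ss_sym by metis
    then have "ss m Y1 Z" using \<open>ss m Z X\<close> ss_trans ss_sym by metis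
    then have "ss t Y1 Z" using line_side[of P w m t Y1 Z] Z I wm Y1 by blast
    then have Y1Y: "ss t Y1 Y" using Z A(3) ss_trans by blast
    have wl: "w \<noteq> l" using Z off by blast
    have Qw: "\<not> inc Q w" using wm Z I Qt d line_eq by metis
    have "\<not> opp w X Q"
    proof
      assume "opp w X Q"
      then have "between X P Q" using opp_btw I Qt Z by blast
      then show False using assms(3) btw_unique by blast
    qed
    then show "meets w n"
      using par_cross[OF assms(2) I(2) Qt I(5,6) n Y1(2) Y1Y Y1(1) wl] Qw n meetsI by metis
  qed
qed

lemma par_trans_between:
  assumes "par P U X Y" "par X Y Q W" "inc X l" "inc Y l" "opp l P Q"
  shows "par P U Q W"
proof -
  obtain X1 where X1: "inc X1 l" "between P X1 Q" using assms opp_def by blast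
  obtain Y1 where Y1: "\<And>P U. par P U X Y \<longleftrightarrow> par P U X1 Y1"
    using par_move[of X Y l X1] par_points[OF assms(1)] assms X1 by metis
  have "par P U X1 Y1" "par X1 Y1 Q W" using Y1 assms par_sym by metis+
  then show ?thesis using par_trans_between_aux X1 by blast
qed

lemma par_common_miss:
  assumes "par P U X Y" "par Q W X Y" "inc P m" "inc U m" "inc Q n" "inc W n"
  shows "\<not> meets m n"
proof
  assume "meets m n"
  then obtain G where G: "inc G m" "inc G n" "m \<noteq> n" using meetsE by metis
  obtain U1 where "inc U1 m" "par G U1 X Y" using par_move_left[OF assms(1,3,4) G(1)] by blast
  moreover obtain W1 where "inc W1 n" "par G W1 X Y" using par_move_left[OF assms(2,5,6) G(2)] by blast
  ultimately show False using par_unique G by metis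
qed

text \<open>Here \<open>n\<close> is the middle line. The limiting parallel from \<open>P\<close> to
  \<open>QW\<close> is, by the case already settled, also one to \<open>XY\<close>, so by uniqueness
  it is \<open>m\<close>.\<close>

lemma par_third:
  assumes "par P U X Y" "par Q W X Y" "inc P m" "inc U m" "inc Q n" "inc W n" "m \<noteq> n" "opp n P X"
  shows "par P U Q W"
proof -
  have mn: "\<not> meets m n" by (rule par_common_miss[OF assms(1-6)])
  have Pn: "\<not> inc P n" using assms oppD by blast
  have Qm: "\<not> inc Q m" using mn assms meetsI by metis
  obtain U' where U': "par P U' Q W" using par_exists[OF Pn assms(5,6)] par_points[OF assms(2)] by metis
  have p: "par P U' X Y" using par_trans_between[OF U' assms(2,5,6,8)] .
  obtain m' where m': "inc P m'" "inc U' m'" using ex_line by blast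
  have "m' = m" using par_unique[OF p assms(1) m' assms(3,4)] .
  then have U'm: "inc U' m" using m' by blast
  obtain t l where tl: "inc P t" "inc X t" "inc X l" "inc Y l" using ex_line by metis
  have "ss t U U'" using parD(3)[OF assms(1) tl(1,2) assms(3,4) tl(3,4)]
    parD(3)[OF p tl(1,2) assms(3) U'm tl(3,4)] ss_trans ss_sym by metis
  moreover obtain t' where t': "inc P t'" "inc Q t'" using ex_line by blast
  moreover have "m \<noteq> t'" using Qm t' by blast
  ultimately have "ss t' U U'" using line_side[of P m t t' U U'] assms tl U'm by blast
  then show ?thesis using par_cong1[OF U' assms(3) U'm assms(4) t'] by blast
qed

text \<open>If no line separated the other two, then by \<open>no\<close> the point \<open>Q\<close>
  would lie off the angle at \<open>P\<close> and \<open>P\<close> off the angle at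
  \<open>Q\<close>, each beyond the line joining the other to \<open>X\<close>.
  \<open>angle_swap\<close> at \<open>X\<close> does not allow both.\<close>

lemma one_between:
  assumes "par P U X Y" "par Q W X Y" "inc P m" "inc U m" "inc Q n" "inc W n" "m \<noteq> n" "inc X l" "inc Y l"
  shows "opp l P Q \<or> opp n P X \<or> opp m Q X"
proof (rule ccontr)
  assume N: "\<not> ?thesis"
  obtain t where t: "inc P t" "inc X t" using ex_line by blast
  obtain u where u: "inc Q u" "inc X u" using ex_line by blast
  note A = parD[OF assms(1) t assms(3,4,8,9)]
  note B = parD[OF assms(2) u assms(5,6,8,9)]
  have mn: "\<not> meets m n" by (rule par_common_miss[OF assms(1-6)])
  have offA: "\<not> inc P l" "\<not> inc X m" using par_off[OF assms(1,3,4,8,9)] by blast+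
  have offB: "\<not> inc Q l" "\<not> inc X n" using par_off[OF assms(2,5,6,8,9)] by blast+
  have offm: "\<not> inc P n" "\<not> inc Q m" using mn assms(3,5,7) meetsI by metis+
  have sl: "ss l P Q" and sn: "ss n P X" and sm: "ss m Q X"
    using N offA offB offm ss_or_opp by blast+
  have d: "P \<noteq> Q" "P \<noteq> X" "Q \<noteq> X" using offm assms offA offB by blast+
  have Qt: "\<not> inc Q t"
  proof
    assume "inc Q t"
    then have "between P Q X \<or> between Q P X \<or> between P X Q" using btw_total[of P Q X t] t d by blast
    moreover have "\<not> between P Q X" using btw_opp[OF _ assms(5) offm(1)] N by blast
    moreover have "\<not> between Q P X" using btw_opp[OF _ assms(3) offm(2)] N by blast
    moreover have "\<not> between P X Q" using btw_opp[OF _ assms(8) offA(1)] N by blast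
    ultimately show False by blast
  qed
  have tu: "t \<noteq> u" using Qt u by blast
  \<comment> \<open>With \<open>Q\<close> inside the angle at \<open>P\<close>, the line
    \<open>PQ\<close> would run on to a point \<open>Y1\<close> of \<open>l\<close>. Then
    \<open>n\<close> separates \<open>P\<close> from \<open>Y1\<close>, and therefore from
    \<open>X\<close>, since \<open>l\<close> misses \<open>n\<close>.\<close>
  have no: "\<not> ss t Q U"
    if h: "par P U X Y" "inc P m" "inc U m" "inc Q n" "inc X l" "inc Y l" "ss m Q X" "ss l P Q" "ss n P X"
      "inc P t" "inc X t" "\<not> meets l n" "\<not> inc X n" "P \<noteq> Q" for P Q U m n t
  proof
    assume s: "ss t Q U"
    note A = parD[OF h(1,10,11,2,3,5,6)]
    obtain w where w: "inc P w" "inc Q w" using ex_line by blast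
    have "meets w l" using A(4)[OF s h(7) w] .
    then obtain Y1 where Y1: "inc Y1 w" "inc Y1 l" using meetsE by metis
    have Xm: "\<not> inc X m" "\<not> inc Q m" "\<not> inc Q l" "\<not> inc P l" "\<not> inc P n" using h(7-9) ssD by blast+
    have Y1m: "ss m Y1 X" using ss_miss[of X l Y1 m] h Y1 A(1) meets_sym Xm ss_sym by metis
    have "ss m Y1 Q" using Y1m h(7) ss_trans ss_sym by metis
    then have n1: "\<not> between Y1 P Q" using btw_opp[of Y1 P Q m] h ss_not_opp ssD by metis
    have n2: "\<not> between P Y1 Q" using btw_opp[of P Y1 Q l] Y1 h(8) ss_not_opp ssD by metis
    have "Y1 \<noteq> P" "Y1 \<noteq> Q" using Y1 Xm by blast+
    then have "between P Q Y1" using btw_total[of P Q Y1 w] w Y1 h(14) n1 n2 btw_sym by metis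
    then have "opp n P Y1" using btw_opp h Xm by blast
    moreover have "ss n X Y1" using ss_miss[of X l Y1 n] h Y1 by blast
    ultimately have "opp n P X" using ss_opp opp_sym ss_sym by metis
    then show False using h(9) ss_not_opp by blast
  qed
  have ln: "\<not> meets l n" "\<not> meets l m" using A B meets_sym by blast+
  have 1: "\<not> ss t Q U" using no[OF assms(1,3,4,5,8,9) sm sl sn t ln(1) offB(2) d(1)] .
  have slr: "ss l Q P" using sl ss_sym by blast
  have 2: "\<not> ss u P W" using no[OF assms(2,5,6,3,8,9) sn slr sm u ln(2) offA(2)] d by blast
  have Yt: "\<not> inc Y t" "\<not> inc U t" "\<not> inc Y u" "\<not> inc W u" using A B ssD by blast+
  have 3: "opp t Q Y" using 1 Qt Yt A(3) ss_or_opp ss_opp opp_sym ss_sym by metis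
  have 4: "\<not> ss u P Y" using 2 B(3) ss_trans ss_sym by metis
  have Yp: "Y \<noteq> X" using par_points assms by blast
  show False using angle_swap[of X l Y t P u Q] assms(8,9) Yp t u tu sl 3 4 by blast
qed

lemma par_trans:
  assumes "par P U X Y" "par Q W X Y" "inc P m" "inc U m" "inc Q n" "inc W n" "m \<noteq> n"
  shows "par P U Q W"
proof -
  obtain l where l: "inc X l" "inc Y l" using ex_line by blast
  consider "opp l P Q" | "opp n P X" | "opp m Q X" using one_between[OF assms l] by blast
  then show ?thesis
  proof cases
    case 1 then show ?thesis using par_trans_between[OF assms(1) _ l] par_sym[OF assms(2)] by blast
  next
    case 2 then show ?thesis using par_third[OF assms] by blast
  next
    case 3
    then show ?thesis using par_third[OF assms(2,1,5,6,3,4)] assms(7) par_sym by metis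
  qed
qed

text \<open>By (A5) another line \<open>n\<close> through \<open>P\<close> misses \<open>l\<close>
  too. A line \<open>m\<close> limiting in both directions would leave \<open>n\<close> no place: on
  \<open>X\<close>'s side of \<open>m\<close> it enters one of the two angles and must meet
  \<open>l\<close>.\<close>

lemma par_not_both:
  assumes "par P U X Y" "par P U' X Y'" "inc P m" "inc U m" "inc U' m" "between Y X Y'"
  shows False
proof -
  obtain t l where tl: "inc P t" "inc X t" "inc X l" "inc Y l" using ex_line by metis
  have Y': "inc Y' l" using tl assms btw_inc1 by blast
  note A = parD[OF assms(1) tl(1,2) assms(3,4) tl(3,4)]
  note B = parD[OF assms(2) tl(1,2) assms(3,5) tl(3) Y']
  have off: "\<not> inc P l" "\<not> inc X m" using par_off[OF assms(1,3,4) tl(3,4)] by blast+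
  have o: "opp t Y Y'" using btw_opp assms tl A ssD by blast
  have "opp t U Y'" using A(3) o ss_opp by blast
  then have oU: "opp t U U'" using B(3) ss_opp opp_sym by blast
  obtain n where n: "inc P n" "\<not> meets n l" "n \<noteq> m" using cover[OF off(1)] by metis
  obtain Z where Z: "inc Z n" "ss m Z X" using ray_point[of P n m X] n assms off by blast
  have "meets t l" using tl off meetsI by metis
  then have nt: "n \<noteq> t" using n by blast
  have "Z \<noteq> P" using Z ssD assms by blast
  then have Zt: "\<not> inc Z t" using nt Z n tl line_eq by metis
  have "ss t Z U \<or> ss t Z U'" using Zt oU ss_or_opp opp_opp_ss oppD by metis
  then show False using A(4) B(4) Z n by blast
qed

end

section \<open>Ends of lines\<close>

context incidence_structure begin

text \<open>An end is represented by the set of all lines that have it.\<close>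
definition pencil :: "'p \<Rightarrow> 'p \<Rightarrow> 'l set" where
  "pencil X Y = {k. inc X k \<and> inc Y k} \<union> {k. \<exists>P U. inc P k \<and> inc U k \<and> par P U X Y}"

definition ends :: "'l set set" where
  "ends = {pencil X Y | X Y. X \<noteq> Y}"

text \<open>The rays to both ends start at a point of \<open>l\<close>, so that the side of an end
  becomes the side of a finite point. The ends of \<open>l\<close> itself have no side, because
  \<open>V\<close> and \<open>W\<close> are off \<open>l\<close>.\<close>

definition opp_ends :: "'l \<Rightarrow> 'l set \<Rightarrow> 'l set \<Rightarrow> bool" where
  "opp_ends l e f \<longleftrightarrow> (\<exists>X V W. inc X l \<and> X \<noteq> V \<and> X \<noteq> W \<and> e = pencil X V \<and> f = pencil X W \<and> opp l V W)"

end

context hyperbolic_incidence begin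

section \<open>Parallel rays as sets of points\<close>

lemma mem_ray:
  assumes "X \<noteq> Y" "inc X l" "inc Y l" "inc X t" "\<not> inc Y t"
  shows "V \<in> ray X Y \<longleftrightarrow> V = X \<or> inc V l \<and> ss t V Y"
proof
  assume "V \<in> ray X Y"
  then consider "V = X" | "V = Y" | "between X V Y" | "between X Y V" unfolding ray_def segment_def by blast
  then show "V = X \<or> inc V l \<and> ss t V Y"
  proof cases
    case 2 then show ?thesis using assms ss_refl by blast
  next
    case 3 then show ?thesis using btw_same_side assms btw_inc2 by blast
  next
    case 4 then show ?thesis using btw_same_side assms btw_inc1 ss_sym by blast
  qed blast
next
  assume "V = X \<or> inc V l \<and> ss t V Y"
  then show "V \<in> ray X Y"
  proof
    assume h: "inc V l \<and> ss t V Y"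
    then have n: "\<not> inc V t" using ssD by blast
    then have "V \<noteq> X" using assms by blast
    moreover have "\<not> between V X Y" using btw_opp n assms h ss_not_opp by blast
    ultimately have "V = Y \<or> between X V Y \<or> between X Y V"
      using btw_total[of X V Y l] h assms by metis
    then show ?thesis unfolding ray_def segment_def by blast
  qed (simp add: ray_def segment_def)
qed

lemma ray_line: "X \<noteq> Y \<Longrightarrow> inc X l \<Longrightarrow> inc Y l \<Longrightarrow> V \<in> ray X Y \<Longrightarrow> inc V l"
  unfolding ray_def segment_def using btw_inc1 btw_inc2 by blast

lemma ray_ends: "X \<in> ray X Y" "Y \<in> ray X Y"
  unfolding ray_def segment_def by auto

lemma ray_collinear:
  assumes "collinear (ray P U \<union> ray X Y)"
  shows "\<exists>l. inc P l \<and> inc U l \<and> inc X l \<and> inc Y l"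
  using assms ray_ends unfolding collinear_def points_of_def by blast

text \<open>(A6) sees a ray only as a set, so its origin has to be recovered. For different origins,
  a point \<open>Z\<close> beyond \<open>S\<close> as seen from \<open>X\<close> would lie in
  \<open>ray S Q\<close> together with \<open>X\<close>, although \<open>S\<close> is between
  them.\<close>

lemma ray_origin:
  assumes "X \<noteq> Y" "S \<noteq> Q" "ray X Y = ray S Q"
  shows "X = S"
proof (rule ccontr)
  assume XS: "X \<noteq> S"
  obtain l where l: "inc X l" "inc Y l" using ex_line by blast
  have Sr: "S \<in> ray X Y" "X \<in> ray S Q" using assms ray_ends by metis+
  have Sl: "inc S l" "inc Q l" using ray_line[OF assms(1) l] ray_ends assms(3) by metis+
  obtain Z where Z: "between X S Z" using extend XS by blast
  have Zl: "inc Z l" using Z l Sl btw_inc1 by blast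
  obtain t where t: "inc X t" "t \<noteq> l" using third_line by metis
  obtain u where u: "inc S u" "u \<noteq> l" using third_line by metis
  have n: "\<not> inc Y t" "\<not> inc S t" "\<not> inc Q u" "\<not> inc X u" using t u l Sl assms XS line_eq by metis+
  have "ss t S Y" using mem_ray[OF assms(1) l t(1) n(1), of S] Sr XS by metis
  moreover have "ss t S Z" using btw_same_side Z t n by blast
  ultimately have "Z \<in> ray X Y" using mem_ray[OF assms(1) l t(1) n(1)] Zl ss_trans ss_sym by metis
  then have "ss u Z Q" using mem_ray[OF assms(2) Sl u(1) n(3)] assms(3) Z btw_distinct by metis
  moreover have "ss u X Q" using mem_ray[OF assms(2) Sl u(1) n(3), of X] Sr XS by metis
  moreover have "opp u X Z" using btw_opp Z u n by blast
  ultimately show False using ss_trans ss_sym ss_not_opp by metis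
qed

lemma seg_sym: "segment P X = segment X P"
  unfolding segment_def using btw_sym by auto

lemma par_hits:
  assumes "par P U X Y" "V \<in> ray P U" "inc V k"
  shows "(\<exists>W\<in>ray X Y. inc W k) \<or> (\<exists>W\<in>segment P X. inc W k)"
proof -
  obtain t m l where I: "inc P t" "inc X t" "inc P m" "inc U m" "inc X l" "inc Y l" by (rule parE[OF assms(1)])
  note A = parD[OF assms(1) I]
  have d: "P \<noteq> U" "X \<noteq> Y" using par_points assms by blast+
  have n: "\<not> inc U t" "\<not> inc Y t" using A ssD by blast+
  show ?thesis
  proof (cases "V = P \<or> k = m")
    case True
    then show ?thesis using assms I unfolding segment_def by blast
  next
    case False
    then have V: "inc V m" "ss t V U" using mem_ray[OF d(1) I(3,4,1) n(1)] assms by blast+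
    have "(\<exists>W. inc W k \<and> inc W l \<and> ss t W Y) \<or> opp k P X \<or> inc X k"
      using par_cross[OF assms(1) I V assms(3)] False by blast
    then show ?thesis
      unfolding opp_def segment_def using mem_ray[OF d(2) I(5,6,2) n(2)] by auto
  qed
qed

lemma par_rays_parallel:
  assumes "par P U X Y"
  shows "rays_parallel (ray P U) (ray X Y)"
proof -
  obtain t m l where I: "inc P t" "inc X t" "inc P m" "inc U m" "inc X l" "inc Y l" by (rule parE[OF assms])
  note A = parD[OF assms I]
  have d: "P \<noteq> U" "X \<noteq> Y" "P \<noteq> X" using par_points assms by blast+
  have "\<not> collinear (ray P U \<union> ray X Y)"
    using ray_collinear A(2) I d line_eq by metis
  moreover have "is_ray P (ray P U)" "is_ray X (ray X Y)" unfolding is_ray_def using d by metis+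
  moreover have "(meets_set k (ray P U) \<longrightarrow> meets_set k (ray X Y) \<or> meets_set k (segment P X)) \<and>
             (meets_set k (ray X Y) \<longrightarrow> meets_set k (ray P U) \<or> meets_set k (segment P X))" for k
    unfolding meets_set_def using par_hits[OF assms] par_hits[OF par_sym[OF assms]] seg_sym by metis
  ultimately show ?thesis unfolding rays_parallel_def by blast
qed

text \<open>A ray running along \<open>PX\<close> has a point \<open>U1\<close> outside the segment,
  and a line through \<open>U1\<close> missing \<open>l\<close> then reaches neither
  \<open>ray X Y\<close> nor the segment.\<close>

lemma rays_parallel_off:
  assumes PU: "P \<noteq> U" "inc P m" "inc U m" and XY: "X \<noteq> Y" "inc X l" "inc Y l" and ml: "m \<noteq> l"
    and t: "inc P t" "inc X t" and PX: "P \<noteq> X"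
    and H: "\<And>V k. V \<in> ray P U \<Longrightarrow> inc V k \<Longrightarrow> (\<exists>W\<in>ray X Y. inc W k) \<or> (\<exists>W\<in>segment P X. inc W k)"
  shows "\<not> inc U t"
proof
  assume "inc U t"
  then have mt: "m = t" using PU t line_eq by metis
  have "\<exists>U1. U1 \<in> ray P U \<and> inc U1 m \<and> U1 \<notin> segment P X"
  proof (cases "between U P X")
    case True
    then have "U \<notin> segment P X" unfolding segment_def using btw_distinct btw_unique by auto
    then show ?thesis using ray_ends PU by blast
  next
    case False
    obtain U1 where U1: "between P X U1" using extend PX by blast
    have U1m: "inc U1 m" using U1 mt t btw_inc1 by blast
    have "U1 \<notin> segment P X" unfolding segment_def using U1 btw_distinct btw_unique' by auto
    moreover have "U1 \<in> ray P U"
    proof -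
      obtain u where u: "inc P u" "u \<noteq> m" using third_line by metis
      have nu: "\<not> inc U u" "\<not> inc X u" using u PU PX mt t line_eq by metis+
      have "\<not> opp u U X" using opp_btw[of u U X m P] u PU mt t False by blast
      then have "ss u U X" using nu ss_or_opp by blast
      moreover have "ss u X U1" using btw_same_side U1 u nu by blast
      ultimately have "ss u U1 U" using ss_trans ss_sym by metis
      then show ?thesis using mem_ray[OF PU u(1) nu(1)] U1m by blast
    qed
    ultimately show ?thesis using U1m by blast
  qed
  then obtain U1 where U1: "U1 \<in> ray P U" "inc U1 m" "U1 \<notin> segment P X" by blast
  have "X \<in> segment P X" "P \<in> segment P X" unfolding segment_def by blast+
  then have "U1 \<noteq> X" "U1 \<noteq> P" using U1 by blast+
  then have U1l: "\<not> inc U1 l" using U1 ml XY mt t line_eq by metis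
  obtain k where k: "inc U1 k" "\<not> meets k l" using cover[OF U1l] by metis
  have kl: "k \<noteq> l" using k U1l by blast
  have "meets m l" using ml mt t XY meetsI by metis
  then have km: "k \<noteq> m" using k by blast
  have "\<not> inc W k" if "W \<in> ray X Y" for W using that ray_line[OF XY] k kl meetsI by metis
  moreover have "\<not> inc W k" if "W \<in> segment P X" for W
  proof -
    have "inc W m" using that mt t btw_inc2 unfolding segment_def by auto
    then show ?thesis using that U1 k km line_eq by metis
  qed
  ultimately show False using H U1 k by blast
qed

lemma rays_parallel_same_side:
  assumes XY: "X \<noteq> Y" "inc X l" "inc Y l" and t: "inc P t" "inc X t" and n: "\<not> inc U t" "\<not> inc Y t"
    and H: "\<And>V k. V \<in> ray P U \<Longrightarrow> inc V k \<Longrightarrow> (\<exists>W\<in>ray X Y. inc W k) \<or> (\<exists>W\<in>segment P X. inc W k)"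
  shows "ss t U Y"
proof (rule ccontr)
  assume "\<not> ?thesis"
  then have o: "opp t U Y" using n ss_or_opp by blast
  obtain k where k: "inc U k" "\<not> meets k t" using cover[OF n(1)] by metis
  have kt: "k \<noteq> t" using k n by blast
  have st: "inc W t" if "W \<in> segment P X" for W using that t btw_inc2 unfolding segment_def by auto
  have nW: "\<not> inc W k" if "W \<in> segment P X" for W using that st k kt meetsI by metis
  obtain W where W: "W \<in> ray X Y" "inc W k" using H[OF ray_ends(2) k(1)] nW by blast
  then have "W \<noteq> X" using nW unfolding segment_def by blast
  then have "ss t W Y" using mem_ray[OF XY t(2) n(2)] W by blast
  then have "opp t U W" using o ss_opp opp_sym by metis
  then show False using opp_meets k W by blast
qed

text \<open>If \<open>m\<close> met \<open>l\<close> in \<open>G\<close>, a line missing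
  \<open>l\<close> through a point of the ray beyond \<open>G\<close>, or through \<open>U\<close>
  when \<open>G\<close> lies behind \<open>P\<close>, would avoid both \<open>ray X Y\<close> and
  the segment.\<close>

lemma rays_parallel_disjoint:
  assumes PU: "P \<noteq> U" "inc P m" "inc U m" and XY: "X \<noteq> Y" "inc X l" "inc Y l" and ml: "m \<noteq> l"
    and t: "inc P t" "inc X t" and n: "\<not> inc U t" "\<not> inc Y t"
    and H: "\<And>V k. V \<in> ray P U \<Longrightarrow> inc V k \<Longrightarrow> (\<exists>W\<in>ray X Y. inc W k) \<or> (\<exists>W\<in>segment P X. inc W k)"
  shows "\<not> meets m l"
proof
  assume mtl: "meets m l"
  then obtain G where G: "inc G m" "inc G l" using meetsE by metis
  have tl: "t \<noteq> l" "t \<noteq> m" using n PU XY by blast+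
  have PX: "P \<noteq> X"
  proof
    assume e: "P = X"
    have Ul: "\<not> inc U l" using ml PU XY e line_eq by metis
    obtain k where k: "inc U k" "\<not> meets k l" using cover[OF Ul] by metis
    have kl: "k \<noteq> l" using k Ul by blast
    have "\<not> inc W k" if "inc W l" for W using that k kl meetsI by metis
    moreover have "segment P X = {X}" unfolding segment_def using e btw_distinct by auto
    ultimately show False using H[OF ray_ends(2) k(1)] ray_line[OF XY] XY by (metis singletonD)
  qed
  have Pl: "\<not> inc P l" using tl t XY PX line_eq by metis
  have Gt: "\<not> inc G t" using G Pl tl t PU line_eq by metis
  have main: False if U1: "U1 \<in> ray P U" "U1 \<noteq> P" "inc U1 k" "\<not> meets k l" "inc U1 m" "\<not> inc U1 l"
      and nV: "\<And>V. between P V X \<Longrightarrow> \<not> inc V k" for U1 k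
  proof -
    have kl: "k \<noteq> l" "k \<noteq> m" using U1 mtl by blast+
    have Pk: "\<not> inc P k" using U1 kl PU line_eq by metis
    have l: "\<not> inc W k" if "inc W l" for W using that U1 kl meetsI by metis
    have "\<not> inc W k" if "W \<in> segment P X" for W using that Pk l XY nV unfolding segment_def by auto
    then show False using H[OF U1(1,3)] l ray_line[OF XY] by blast
  qed
  show False
  proof (cases "ss t G U")
    case True
    have GP: "P \<noteq> G" using Gt t by blast
    obtain U1 where U1: "between P G U1" using extend GP by blast
    have U1m: "inc U1 m" using U1 G PU btw_inc1 by blast
    have "ss t U1 U" using btw_same_side[OF U1 t(1)] Gt True ss_trans ss_sym by metis
    then have U1r: "U1 \<in> ray P U" using mem_ray[OF PU t(1) n(1)] U1m by blast
    have U1P: "U1 \<noteq> P" "U1 \<noteq> G" using U1 btw_distinct by blast+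
    have U1l: "\<not> inc U1 l" using U1P U1m G ml line_eq by metis
    obtain k where k: "inc U1 k" "\<not> meets k l" using cover[OF U1l] by metis
    have "\<not> inc V k" if V: "between P V X" for V
    proof
      assume Vk: "inc V k"
      have "opp l P U1" using btw_opp U1 G Pl by blast
      moreover have "ss l P V" using btw_ss V XY Pl by blast
      ultimately have "opp l V U1" using ss_opp ss_sym by metis
      then show False using opp_meets Vk k by blast
    qed
    then show False using main[OF U1r U1P(1) k U1m U1l] by blast
  next
    case False
    then have "opp t G U" using Gt n ss_or_opp by blast
    then have GPU: "between G P U" using opp_btw G PU t by blast
    have Ul: "\<not> inc U l" using GPU btw_distinct G PU ml line_eq by metis
    obtain k where k: "inc U k" "\<not> meets k l" using cover[OF Ul] by metis
    have km: "k \<noteq> m" using k mtl by blast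
    have kl: "k \<noteq> l" using k Ul by blast
    have Pk: "\<not> inc P k" using k km PU line_eq by metis
    have "\<not> inc V k" if V: "between P V X" for V
    proof
      assume Vk: "inc V k"
      have o: "opp k P X" using btw_opp V Vk Pk by blast
      have "ss k P G" using btw_same_side[of U P G k] GPU btw_sym k Pk by blast
      then have "opp k G X" using o ss_opp ss_sym by metis
      then show False using opp_meets[of k G X l] G XY k meets_sym by blast
    qed
    then show False using main[OF ray_ends(2) PU(1)[symmetric] k PU(3) Ul] by blast
  qed
qed

text \<open>If \<open>w\<close> inside the angle missed \<open>l\<close>, take \<open>c\<close>
  through \<open>Y\<close> that meets \<open>w\<close> but misses \<open>m\<close>. The parallel
  rays force \<open>c\<close> to cross the segment \<open>XP\<close> at some \<open>K\<close>, and
  \<open>w\<close> meets \<open>c\<close> between \<open>K\<close> and \<open>Y\<close>, thus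
  separating them; but \<open>K\<close> and \<open>Y\<close> are both on \<open>X\<close>'s side of
  \<open>w\<close>.\<close>

lemma rays_parallel_par:
  assumes PU: "P \<noteq> U" and XY: "X \<noteq> Y" and rp: "\<not> collinear (ray P U \<union> ray X Y)"
    and H: "\<And>V k. V \<in> ray P U \<Longrightarrow> inc V k \<Longrightarrow> (\<exists>W\<in>ray X Y. inc W k) \<or> (\<exists>W\<in>segment P X. inc W k)"
    and H': "\<And>V k. V \<in> ray X Y \<Longrightarrow> inc V k \<Longrightarrow> (\<exists>W\<in>ray P U. inc W k) \<or> (\<exists>W\<in>segment X P. inc W k)"
  shows "par P U X Y"
proof -
  obtain m l where ml: "inc P m" "inc U m" "inc X l" "inc Y l" using ex_line by metis
  obtain t where t: "inc P t" "inc X t" using ex_line by blast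
  have mnl: "m \<noteq> l"
  proof
    assume "m = l"
    then have "collinear (ray P U \<union> ray X Y)"
      unfolding collinear_def points_of_def
      using ray_line[OF PU ml(1,2)] ray_line[OF XY ml(3,4)] by blast
    then show False using rp by blast
  qed
  have PX: "P \<noteq> X"
  proof
    assume e: "P = X"
    have Ul: "\<not> inc U l" using mnl ml PU e line_eq by metis
    obtain k where k: "inc U k" "\<not> meets k l" using cover[OF Ul] by metis
    have kl: "k \<noteq> l" using k Ul by blast
    have "\<not> inc W k" if "inc W l" for W using that k kl meetsI by metis
    moreover have "segment P X = {X}" unfolding segment_def using e btw_distinct by auto
    ultimately show False using H[OF ray_ends(2) k(1)] ray_line[OF XY ml(3,4)] ml by (metis singletonD)
  qed
  have Ut: "\<not> inc U t" by (rule rays_parallel_off[OF PU ml(1,2) XY ml(3,4) mnl t PX H])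
  have Yt: "\<not> inc Y t"
    by (rule rays_parallel_off[OF XY ml(3,4) PU ml(1,2) mnl[symmetric] t(2,1) PX[symmetric] H'])
  have s: "ss t U Y" by (rule rays_parallel_same_side[OF XY ml(3,4) t Ut Yt H])
  have dj: "\<not> meets m l" by (rule rays_parallel_disjoint[OF PU ml(1,2) XY ml(3,4) mnl t Ut Yt H])
  have off: "\<not> inc P l" "\<not> inc X m" "\<not> inc Y m" using dj mnl ml meetsI by metis+
  show ?thesis
  proof (rule parI[OF PX t ml dj mnl s])
    fix Z w assume Z: "ss t Z U" "ss m Z X" "inc P w" "inc Z w"
    show "meets w l"
    proof (rule ccontr)
      assume wl: "\<not> meets w l"
      have wm: "w \<noteq> m" "w \<noteq> t" "w \<noteq> l" using Z ssD off by blast+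
      have "meets w m" using meetsI Z ml wm by blast
      then obtain c where c: "inc Y c" "meets c w" "\<not> meets c m" using off(3) by (rule meeting_only_one)
      have cm: "c \<noteq> m" using c off by blast
      have cm': "\<not> inc W c" if "inc W m" for W using that c cm meetsI by metis
      have cl: "c \<noteq> l" using c wl meets_sym by blast
      have "\<not> inc X c" using c cl ml XY line_eq by metis
      then obtain K where K: "between X K P" "inc K c"
        using H'[OF ray_ends(2) c(1)] cm' ray_line[OF PU ml(1,2)] ml unfolding segment_def by blast
      obtain Z' where Z': "inc Z' c" "inc Z' w" using c meetsE by metis
      have Z'P: "Z' \<noteq> P" using Z' cm' ml by blast
      have "ss m Y Z'" using ss_miss[of Y c Z' m] c Z' off by blast
      moreover have "ss m X Y" using ss_miss[of X l Y m] ml dj meets_sym off by metis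
      ultimately have "ss m Z' Z" using Z ss_trans ss_sym by metis
      then have "ss t Z' Z" using line_side[of P w m t Z' Z] Z ml t wm Z' by blast
      then have Z'Y: "ss t Z' Y" using Z s ss_trans by metis
      have Kt: "inc K t" using K t btw_inc2 by blast
      have n1: "\<not> between Y K Z'" using btw_opp[of Y K Z' t] Kt Yt Z'Y ss_not_opp opp_sym by metis
      have Pl': "ss l P Z'" using ss_miss[of P w Z' l] Z Z' wl off by blast
      have "ss l P K" using btw_ss[of P K X l] K btw_sym ml off by blast
      then have "ss l K Z'" using Pl' ss_trans ss_sym by metis
      then have n2: "\<not> between K Y Z'" using btw_opp[of K Y Z' l] ml ss_not_opp ssD by metis
      have "K \<noteq> Z'" "K \<noteq> Y" "Y \<noteq> Z'" using Kt Z'Y Yt ssD Pl' ml by blast+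
      then have b: "between K Z' Y" using btw_total[of K Z' Y c] K Z' c n1 n2 btw_sym by metis
      have KP: "K \<noteq> P" "K \<noteq> X" using K btw_distinct by blast+
      have Kw: "\<not> inc K w" using KP Kt wm Z t line_eq by metis
      have o: "opp w K Y" using btw_opp b Z' Kw by blast
      have Xw: "\<not> inc X w" using wm Z t PX line_eq by metis
      have "ss w X K" using btw_ss K Z Xw by blast
      moreover have "ss w X Y" using ss_miss[of X l Y w] ml wl meets_sym Xw by metis
      ultimately show False using o ss_trans ss_sym ss_not_opp by metis
    qed
  qed
qed

lemma rays_parallelE:
  assumes "rays_parallel r s"
  obtains P U X Y where "r = ray P U" "s = ray X Y" "par P U X Y"
proof -
  obtain P X where h: "is_ray P r" "is_ray X s" "\<not> collinear (r \<union> s)"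
     "\<And>k. (meets_set k r \<longrightarrow> meets_set k s \<or> meets_set k (segment P X)) \<and>
             (meets_set k s \<longrightarrow> meets_set k r \<or> meets_set k (segment P X))"
    using assms unfolding rays_parallel_def by blast
  obtain U where U: "U \<noteq> P" "r = ray P U" using h is_ray_def by blast
  obtain Y where Y: "Y \<noteq> X" "s = ray X Y" using h is_ray_def by blast
  have "par P U X Y"
  proof (rule rays_parallel_par)
    show "P \<noteq> U" "X \<noteq> Y" "\<not> collinear (ray P U \<union> ray X Y)" using U Y h by blast+
    show "(\<exists>W\<in>ray X Y. inc W k) \<or> (\<exists>W\<in>segment P X. inc W k)" if "V \<in> ray P U" "inc V k" for V k
      using h(4)[of k] that U Y unfolding meets_set_def by blast
    show "(\<exists>W\<in>ray P U. inc W k) \<or> (\<exists>W\<in>segment X P. inc W k)" if "V \<in> ray X Y" "inc V k" for V k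
      using h(4)[of k] that U Y seg_sym[of P X] unfolding meets_set_def by blast
  qed
  then show ?thesis using that U Y by blast
qed

section \<open>Pencils, the two ends of a line, and joins\<close>

lemma pencil_par_aux: "par P U X Y \<Longrightarrow> pencil P U \<subseteq> pencil X Y"
proof
  fix k assume h: "par P U X Y" and k: "k \<in> pencil P U"
  obtain m l where I: "inc P m" "inc U m" "inc X l" "inc Y l" using ex_line by metis
  from k consider "inc P k" "inc U k" | Q W where "inc Q k" "inc W k" "par Q W P U"
    unfolding pencil_def by blast
  then show "k \<in> pencil X Y"
  proof cases
    case 1 then show ?thesis using h unfolding pencil_def by blast
  next
    case 2
    show ?thesis
    proof (cases "k = l")
      case True then show ?thesis using I unfolding pencil_def by blast
    next
      case False
      have "par Q W X Y" using par_trans[OF 2(3) par_sym[OF h] 2(1,2) I(3,4) False] .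
      then show ?thesis using 2 unfolding pencil_def by blast
    qed
  qed
qed

lemma pencil_par: "par P U X Y \<Longrightarrow> pencil P U = pencil X Y"
  using pencil_par_aux par_sym by blast

lemma pencil_move:
  assumes "X \<noteq> Y" "inc X l" "inc Y l" "inc X1 l"
  shows "\<exists>Y1. inc Y1 l \<and> X1 \<noteq> Y1 \<and> pencil X Y = pencil X1 Y1"
proof -
  obtain Y1 where Y1: "inc Y1 l" "X1 \<noteq> Y1" "\<And>P U. par P U X Y \<longleftrightarrow> par P U X1 Y1"
    using par_move[OF assms] by blast
  have "{k. inc X k \<and> inc Y k} = {k. inc X1 k \<and> inc Y1 k}" using assms Y1 line_eq by blast
  then show ?thesis unfolding pencil_def using Y1 by auto
qed

lemma pencil_dir:
  assumes "inc X l" "inc Y l" "inc Y1 l" "inc X t" "ss t Y Y1"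
  shows "pencil X Y = pencil X Y1"
proof -
  have "Y \<noteq> X" "Y1 \<noteq> X" using assms ssD by blast+
  then have "{k. inc X k \<and> inc Y k} = {k. inc X k \<and> inc Y1 k}" using assms line_eq by blast
  then show ?thesis unfolding pencil_def using par_dir[OF assms(1-5)] by auto
qed

lemma pencil_in_ends: "X \<noteq> Y \<Longrightarrow> pencil X Y \<in> ends"
  unfolding ends_def by blast

lemma line_in_pencil: "inc X k \<Longrightarrow> inc Y k \<Longrightarrow> k \<in> pencil X Y"
  unfolding pencil_def by blast

lemma end_at:
  assumes "e \<in> ends" "l \<in> e" "inc X l"
  shows "\<exists>Y. inc Y l \<and> X \<noteq> Y \<and> e = pencil X Y"
proof -
  obtain A B where e: "e = pencil A B" "A \<noteq> B" using assms ends_def by blast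
  consider "inc A l" "inc B l" | P U where "inc P l" "inc U l" "par P U A B"
    using assms e unfolding pencil_def by blast
  then show ?thesis
  proof cases
    case 1 then show ?thesis using pencil_move e assms by blast
  next
    case 2 then show ?thesis using pencil_move pencil_par e assms par_points by metis
  qed
qed

lemma pencil_par_at:
  assumes "l \<in> pencil X Y" "\<not> inc X l" "inc P l"
  shows "\<exists>U. inc U l \<and> par P U X Y"
proof -
  obtain Q W where "inc Q l" "inc W l" "par Q W X Y" using assms unfolding pencil_def by blast
  then show ?thesis using par_move_left assms by blast
qed

lemma end_line_unique:
  assumes "e \<in> ends" "k1 \<in> e" "k2 \<in> e" "inc P k1" "inc P k2"
  shows "k1 = k2"
proof -
  obtain Y where Y: "inc Y k1" "P \<noteq> Y" "e = pencil P Y" using end_at assms by blast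
  consider "inc P k2" "inc Y k2" | Q W where "inc Q k2" "inc W k2" "par Q W P Y"
    using Y assms unfolding pencil_def by blast
  then show ?thesis
  proof cases
    case 1 then show ?thesis using Y assms line_eq by blast
  next
    case 2 then show ?thesis using par_off assms Y by blast
  qed
qed

lemma end_line_ex:
  assumes "e \<in> ends"
  shows "\<exists>k\<in>e. inc P k"
proof -
  obtain X Y where e: "e = pencil X Y" "X \<noteq> Y" using assms ends_def by blast
  obtain l where l: "inc X l" "inc Y l" using ex_line by blast
  show ?thesis
  proof (cases "inc P l")
    case True then show ?thesis using l e line_in_pencil by blast
  next
    case False
    obtain U where U: "par P U X Y" using par_exists[OF False l e(2)] by blast
    obtain m where "inc P m" "inc U m" using ex_line by blast
    then show ?thesis using U e unfolding pencil_def by blast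
  qed
qed

lemma opposite_pencils:
  assumes "between Y X Y'"
  shows "pencil X Y \<noteq> pencil X Y'"
proof
  assume e: "pencil X Y = pencil X Y'"
  have d: "Y \<noteq> X" "X \<noteq> Y'" using assms btw_distinct by blast+
  obtain l where l: "inc X l" "inc Y l" "inc Y' l" using assms btw_line by metis
  obtain P where P: "\<not> inc P l" using off_line by blast
  obtain U where U: "par P U X Y" using par_exists[OF P l(1,2)] d by metis
  obtain m where m: "inc P m" "inc U m" using ex_line by blast
  have "m \<in> pencil X Y'" using e U m unfolding pencil_def by blast
  moreover have "\<not> inc X m" using par_off[OF U m l(1,2)] by blast
  ultimately obtain U' where "inc U' m" "par P U' X Y'" using pencil_par_at m by blast
  then show False using par_not_both[OF U] m assms by blast
qed

lemma same_or_opposite: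
  assumes "inc X l" "inc Y l" "inc Y' l" "X \<noteq> Y" "X \<noteq> Y'" "pencil X Y \<noteq> pencil X Y'"
  shows "between Y X Y'"
proof -
  obtain t where t: "inc X t" "t \<noteq> l" using third_line by metis
  have n: "\<not> inc Y t" "\<not> inc Y' t" using t assms line_eq by metis+
  have "\<not> ss t Y Y'" using pencil_dir assms t by blast
  then have "opp t Y Y'" using n ss_or_opp by blast
  then show ?thesis using opp_btw assms t by blast
qed

text \<open>Seen from a point of \<open>l\<close>, distinct ends of \<open>l\<close> are its
  opposite directions, and by \<open>par_not_both\<close> no second line can be limiting in
  both.\<close>

lemma ends_common_line:
  assumes "e \<in> ends" "f \<in> ends" "e \<noteq> f" "l \<in> e" "l \<in> f" "m \<in> e" "m \<in> f"
  shows "l = m"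
proof (rule ccontr)
  assume lm: "l \<noteq> m"
  obtain X where X: "inc X l" using A2 by blast
  obtain Y where Y: "inc Y l" "X \<noteq> Y" "e = pencil X Y" using end_at assms X by blast
  obtain Y' where Y': "inc Y' l" "X \<noteq> Y'" "f = pencil X Y'" using end_at assms X by blast
  have b: "between Y X Y'" using same_or_opposite X Y Y' assms by blast
  have Xm: "\<not> inc X m" using end_line_unique assms X lm by blast
  obtain P where P: "inc P m" using A2 by blast
  obtain U where U: "inc U m" "par P U X Y" using pencil_par_at Y assms Xm P by metis
  obtain U' where U': "inc U' m" "par P U' X Y'" using pencil_par_at Y' assms Xm P by metis
  show False using par_not_both U U' P b by blast
qed

lemma two_ends:
  assumes "inc X l"
  obtains B C where "inc B l" "inc C l" "between B X C" "pencil X B \<noteq> pencil X C"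
    "\<And>e. e \<in> ends \<Longrightarrow> l \<in> e \<Longrightarrow> e = pencil X B \<or> e = pencil X C"
proof -
  obtain B C where BC: "inc B l" "inc C l" "between B X C" using mid assms by metis
  have d: "X \<noteq> B" "X \<noteq> C" using BC btw_distinct by blast+
  have "e = pencil X B \<or> e = pencil X C" if e: "e \<in> ends" "l \<in> e" for e
  proof (rule ccontr)
    assume n: "\<not> ?thesis"
    obtain Y where Y: "inc Y l" "X \<noteq> Y" "e = pencil X Y" using end_at e assms by blast
    have "between Y X B" "between Y X C" using same_or_opposite[OF assms Y(1)] BC d n Y by blast+
    then show False using no_star[of Y X B C] BC by blast
  qed
  then show ?thesis by (rule that[OF BC opposite_pencils[OF BC(3)]])
qed

text \<open>(A6) is applied to the rays from a single point \<open>X\<close> towards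
  \<open>e\<close> and \<open>f\<close>; what remains is to read \<open>line_parallel_ray\<close> as
  membership in a pencil.\<close>

lemma join_ends:
  assumes "e \<in> ends" "f \<in> ends" "e \<noteq> f"
  shows "\<exists>l. l \<in> e \<and> l \<in> f"
proof -
  obtain X Y where e: "e = pencil X Y" "X \<noteq> Y" using assms ends_def by blast
  obtain k where k: "inc X k" "inc Y k" using ex_line by blast
  obtain k' where k': "k' \<in> f" "inc X k'" using end_line_ex assms by blast
  obtain Y' where Y': "inc Y' k'" "X \<noteq> Y'" "f = pencil X Y'" using end_at assms k' by blast
  show ?thesis
  proof (cases "k = k'")
    case True then show ?thesis using k k' e line_in_pencil by blast
  next
    case False
    have "\<not> collinear (ray X Y \<union> ray X Y')"
      using ray_collinear False k k' Y' e line_eq by metis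
    moreover have "is_ray X (ray X Y)" "is_ray X (ray X Y')" unfolding is_ray_def using e Y' by metis+
    ultimately obtain l where l: "line_parallel_ray l (ray X Y)" "line_parallel_ray l (ray X Y')"
      using A6 by blast
    have "l \<in> pencil X V" if h: "line_parallel_ray l (ray X V)" "X \<noteq> V" for V
    proof -
      consider "ray X V \<subseteq> points_of l" | t where "t \<subseteq> points_of l" "rays_parallel t (ray X V)"
        using h line_parallel_ray_def by blast
      then show ?thesis
      proof cases
        case 1
        then have "inc X l" "inc V l"
          using subsetD[OF 1 ray_ends(1)] subsetD[OF 1 ray_ends(2)] by (simp_all add: points_of_def)
        then show ?thesis by (rule line_in_pencil)
      next
        case 2
        obtain P U S Q where p: "t = ray P U" "ray X V = ray S Q" "par P U S Q"
          using rays_parallelE[OF 2(2)] by metis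
        have sub: "ray P U \<subseteq> points_of l" using 2(1) p(1) by simp
        have PU: "inc P l" "inc U l"
          using subsetD[OF sub ray_ends(1)] subsetD[OF sub ray_ends(2)] by (simp_all add: points_of_def)
        have SX: "S = X" using ray_origin p par_points[OF p(3)] h by metis
        obtain kk where kk: "inc X kk" "inc V kk" using ex_line by blast
        obtain tt where tt: "inc X tt" "tt \<noteq> kk" using third_line by metis
        have Vt: "\<not> inc V tt" using tt kk h line_eq by metis
        have "Q \<in> ray X V" using p ray_ends by metis
        then have "inc Q kk \<and> ss tt Q V" using mem_ray[OF h(2) kk tt(1) Vt] par_points[OF p(3)] SX by blast
        then have "pencil X Q = pencil X V" using pencil_dir kk tt by blast
        moreover have "l \<in> pencil S Q" using p PU unfolding pencil_def by blast
        ultimately show ?thesis using SX by blast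
      qed
    qed
    then show ?thesis using l e Y' by blast
  qed
qed

section \<open>The sides of a line on which ends lie\<close>

text \<open>The side of an end does not depend on the origin chosen on \<open>l\<close>: limiting
  rays from two points of \<open>l\<close> lie on the same side of the line joining their origins,
  which is \<open>l\<close>.\<close>

lemma end_side_unique:
  assumes "inc X1 l" "inc X2 l" "X1 \<noteq> V1" "X2 \<noteq> V2" "pencil X1 V1 = pencil X2 V2" "\<not> inc V1 l" "\<not> inc V2 l"
  shows "ss l V1 V2"
proof -
  obtain k1 k2 where k: "inc X1 k1" "inc V1 k1" "inc X2 k2" "inc V2 k2" using ex_line by metis
  have e: "pencil X1 V1 \<in> ends" "k1 \<in> pencil X1 V1" "k2 \<in> pencil X1 V1"
    using pencil_in_ends assms line_in_pencil k by metis+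
  show ?thesis
  proof (cases "X1 = X2")
    case True
    have "k1 = k2" using end_line_unique[OF e(1-3)] k True by blast
    moreover have "\<not> between V1 X1 V2" using opposite_pencils assms True by blast
    ultimately have "\<not> opp l V1 V2" using opp_btw[of l V1 V2 k1 X1] k assms by blast
    then show ?thesis using assms ss_or_opp by blast
  next
    case False
    have nk: "\<not> inc X2 k1" using k assms False line_eq by metis
    obtain U1 where U1: "inc U1 k1" "par X1 U1 X2 V2"
      using pencil_par_at[of k1 X2 V2 X1] nk e k assms by metis
    have s: "ss l U1 V2" using parD(3)[OF U1(2) assms(1,2) k(1) U1(1) k(3,4)] .
    have "pencil X1 U1 = pencil X1 V1" using pencil_par U1 assms by metis
    then have "\<not> between U1 X1 V1" using opposite_pencils by metis
    then have "\<not> opp l U1 V1" using opp_btw[of l U1 V1 k1 X1] k U1 assms by blast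
    then have "ss l U1 V1" using s assms ssD ss_or_opp by blast
    then show ?thesis using s ss_trans ss_sym by metis
  qed
qed

lemma end_side_exists:
  assumes "e \<in> ends" "l \<notin> e" "inc X l"
  shows "\<exists>V. \<not> inc V l \<and> X \<noteq> V \<and> e = pencil X V"
proof -
  obtain k where k: "k \<in> e" "inc X k" using end_line_ex assms by blast
  obtain V where V: "inc V k" "X \<noteq> V" "e = pencil X V" using end_at assms k by blast
  have "k \<noteq> l" using k assms by blast
  then have "\<not> inc V l" using V k assms line_eq by metis
  then show ?thesis using V by blast
qed

lemma opp_ends_iff:
  assumes "inc X l" "X \<noteq> V" "X \<noteq> W" "\<not> inc V l" "\<not> inc W l"
  shows "opp_ends l (pencil X V) (pencil X W) \<longleftrightarrow> opp l V W"
proof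
  assume "opp l V W" then show "opp_ends l (pencil X V) (pencil X W)" using assms opp_ends_def by blast
next
  assume "opp_ends l (pencil X V) (pencil X W)"
  then obtain X' V' W' where h: "inc X' l" "X' \<noteq> V'" "X' \<noteq> W'" "pencil X V = pencil X' V'"
    "pencil X W = pencil X' W'" "opp l V' W'" unfolding opp_ends_def by (elim exE conjE) (rule that)
  have "ss l V V'" "ss l W W'" using end_side_unique assms h oppD by blast+
  then show "opp l V W" using h ss_opp opp_sym by metis
qed

lemma opp_ends_trans:
  assumes "e \<in> ends" "f \<in> ends" "g \<in> ends" "l \<notin> e" "l \<notin> f" "l \<notin> g"
  shows "opp_ends l e g \<longleftrightarrow> opp_ends l e f \<noteq> opp_ends l f g"
proof -
  obtain X where X: "inc X l" using A2 by blast
  obtain V where V: "\<not> inc V l" "X \<noteq> V" "e = pencil X V" using end_side_exists assms X by metis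
  obtain W where W: "\<not> inc W l" "X \<noteq> W" "f = pencil X W" using end_side_exists assms X by metis
  obtain Z where Z: "\<not> inc Z l" "X \<noteq> Z" "g = pencil X Z" using end_side_exists assms X by metis
  have "opp l V Z \<longleftrightarrow> opp l V W \<noteq> opp l W Z" using opp_trans opp_opp opp_sym V W Z by metis
  then show ?thesis using opp_ends_iff X V W Z by metis
qed

text \<open>A line missing \<open>l\<close> lies on the side of its end. Otherwise, for a line
  \<open>v\<close> through \<open>V\<close> missing \<open>l\<close>, \<open>par_cross\<close> would
  give a point of \<open>v\<close> on \<open>k\<close> or on the segment \<open>XP\<close>, hence on
  \<open>P\<close>'s side of \<open>l\<close>.\<close>

lemma end_side_miss:
  assumes "e \<in> ends" "k \<in> e" "\<not> meets k l" "inc P k" "k \<noteq> l" "inc X l" "X \<noteq> V" "\<not> inc V l" "e = pencil X V"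
  shows "ss l V P"
proof (rule ccontr)
  assume n: "\<not> ?thesis"
  have Pl: "\<not> inc P l" using assms meetsI by metis
  have Xk: "\<not> inc X k" using assms meetsI by metis
  have o: "opp l V P" using n assms Pl ss_or_opp by blast
  obtain U where U: "inc U k" "par P U X V" using pencil_par_at assms Xk by metis
  obtain m where m: "inc X m" "inc V m" using ex_line by blast
  obtain t where t: "inc P t" "inc X t" using ex_line by blast
  obtain v where v: "inc V v" "\<not> meets v l" using cover[OF assms(8)] by metis
  have ml: "meets m l" using m assms meetsI by metis
  have vm: "v \<noteq> m" using v ml by blast
  have p: "par X V P U" using par_sym U by blast
  have Vt: "\<not> inc V t" using parD(3)[OF p t(2,1) m assms(4) U(1)] ssD by blast
  have "(\<exists>G. inc G v \<and> inc G k \<and> ss t G U) \<or> opp v X P \<or> inc P v"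
    using par_cross[OF p t(2,1) m assms(4) U(1) m(2) ss_refl[OF Vt] v(1) vm] .
  moreover have "\<not> inc P v" using o opp_meets v by blast
  moreover have "\<not> (inc G v \<and> inc G k)" for G
  proof
    assume G: "inc G v \<and> inc G k"
    have "ss l V G" using ss_miss v G assms by blast
    moreover have "ss l P G" using ss_miss G assms Pl by blast
    ultimately show False using o ss_trans ss_sym ss_not_opp by metis
  qed
  moreover have "\<not> opp v X P"
  proof
    assume "opp v X P"
    then obtain G where G: "inc G v" "between X G P" using opp_def by blast
    have "ss l P G" using btw_ss[of P G X l] G btw_sym assms Pl by blast
    moreover have "ss l V G" using ss_miss v G assms by blast
    ultimately show False using o ss_trans ss_sym ss_not_opp by metis
  qed
  ultimately show False by blast
qed

text \<open>The bridge from intersections to the order of ends. At a common point the ends of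
  \<open>k\<close> are opposite directions; if there is none, all of \<open>k\<close> lies on one
  side of \<open>l\<close>, and its ends with it.\<close>

lemma opp_ends_meets:
  assumes "e \<in> ends" "f \<in> ends" "e \<noteq> f" "k \<in> e" "k \<in> f" "l \<notin> e" "l \<notin> f"
  shows "opp_ends l e f \<longleftrightarrow> meets k l"
proof
  assume "meets k l"
  then obtain X where X: "inc X k" "inc X l" "k \<noteq> l" using meetsE by metis
  obtain V where V: "inc V k" "X \<noteq> V" "e = pencil X V" using end_at assms X by blast
  obtain W where W: "inc W k" "X \<noteq> W" "f = pencil X W" using end_at assms X by blast
  have b: "between V X W" using same_or_opposite X V W assms by blast
  have "\<not> inc V l" using V X line_eq by metis
  then have "opp l V W" using btw_opp b X by blast
  then show "opp_ends l e f" using X V W opp_ends_def by blast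
next
  assume o: "opp_ends l e f"
  show "meets k l"
  proof (rule ccontr)
    assume n: "\<not> meets k l"
    obtain X V W where h: "inc X l" "X \<noteq> V" "X \<noteq> W" "e = pencil X V" "f = pencil X W" "opp l V W"
      using o unfolding opp_ends_def by (elim exE conjE) (rule that)
    obtain P where P: "inc P k" using A2 by blast
    have "k \<noteq> l" using assms by blast
    then have "ss l V P" "ss l W P" using end_side_miss n P h assms oppD by metis+
    then show False using h ss_trans ss_sym ss_not_opp by metis
  qed
qed

end

section \<open>The cyclic order of the ends\<close>

text \<open>Interlacing of pairs, pictured as crossing chords of a circle. \<open>cr_trans\<close>
  says that a chord has two sides, and \<open>cr_pair\<close>, with the symmetries, that at most one
  of the three pairings of four elements crosses.\<close>

locale separation =
  fixes E :: "'e set" and cr :: "'e \<Rightarrow> 'e \<Rightarrow> 'e \<Rightarrow> 'e \<Rightarrow> bool"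
  assumes cr_dist: "cr a b c d \<Longrightarrow> distinct [a, b, c, d]"
    and cr_swap: "cr a b c d \<Longrightarrow> cr c d a b"
    and cr_flip: "cr a b c d \<Longrightarrow> cr b a c d"
    and cr_trans: "\<lbrakk>{a, b, x, y, z} \<subseteq> E; a \<noteq> b; x \<notin> {a, b}; y \<notin> {a, b}; z \<notin> {a, b}\<rbrakk>
      \<Longrightarrow> cr a b x z \<longleftrightarrow> cr a b x y \<noteq> cr a b y z"
    and cr_pair: "cr a b c d \<Longrightarrow> \<not> cr a c b d"
begin

lemma cr_flip2: "cr a b c d \<longleftrightarrow> cr b a c d" "cr a b c d \<longleftrightarrow> cr a b d c" "cr a b c d \<longleftrightarrow> cr c d a b"
  using cr_flip cr_swap by blast+

context
  fixes R T :: 'e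
  assumes RT: "R \<in> E" "T \<in> E" "R \<noteq> T"
begin

text \<open>Orders the ends on one side of the line with ends \<open>R\<close> and \<open>T\<close> from \<open>R\<close> to \<open>T\<close>.\<close>
definition lt :: "'e \<Rightarrow> 'e \<Rightarrow> bool" where
  "lt X Y \<longleftrightarrow> cr X T R Y"

text \<open>A chord \<open>XY\<close> crossing \<open>RT\<close> separates \<open>R\<close> from
  \<open>T\<close>, so it cuts off exactly one of them from \<open>Z\<close>. Which one decides the
  order of \<open>X\<close> and \<open>Z\<close>.\<close>

lemma lt_cross:
  assumes E: "X \<in> E" "Z \<in> E" "Y \<in> E" and d: "X \<noteq> Z" "X \<notin> {R, T}" "Z \<notin> {R, T}"
    and s: "\<not> cr R T X Z" and Y: "cr R T X Y"
  shows "lt X Z \<longleftrightarrow> cr X Y R Z" "lt Z X \<longleftrightarrow> cr X Y T Z" "lt X Z \<longleftrightarrow> \<not> lt Z X"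
proof -
  have dY: "Y \<noteq> R" "Y \<noteq> T" "Y \<noteq> X" using cr_dist[OF Y] by auto
  have ZY: "cr R T Z Y" using cr_trans[of R T Z X Y] RT E d dY s Y cr_flip2 by auto
  then have dZ: "Y \<noteq> Z" using cr_dist by auto
  have n1: "\<not> cr R Z T Y" using cr_pair ZY by blast
  have n2: "\<not> cr T Z R Y" using cr_pair ZY cr_flip2 by blast
  have "cr R Z X T \<longleftrightarrow> cr R Z X Y \<noteq> cr R Z Y T" using cr_trans[of R Z X Y T] RT E d dY dZ by auto
  then show 1: "lt X Z \<longleftrightarrow> cr X Y R Z" unfolding lt_def using n1 cr_flip2 by metis
  have "cr T Z X R \<longleftrightarrow> cr T Z X Y \<noteq> cr T Z Y R" using cr_trans[of T Z X Y R] RT E d dY dZ by auto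
  then show 2: "lt Z X \<longleftrightarrow> cr X Y T Z" unfolding lt_def using n2 cr_flip2 by metis
  have "cr X Y R T \<longleftrightarrow> cr X Y R Z \<noteq> cr X Y Z T" using cr_trans[of X Y R Z T] RT E d dY dZ by auto
  then show "lt X Z \<longleftrightarrow> \<not> lt Z X" using 1 2 Y cr_flip2 by metis
qed

text \<open>Two chords that both cross \<open>RT\<close> cross each other exactly if their endpoints
  come in opposite orders on the two sides.\<close>

lemma cross_opposite:
  assumes E: "X \<in> E" "Z \<in> E" "Y \<in> E" "W \<in> E" and d: "X \<noteq> Z" "Y \<noteq> W" "X \<notin> {R, T}" "Z \<notin> {R, T}" "Y \<notin> {R, T}" "W \<notin> {R, T}"
    and s: "\<not> cr R T X Z" "\<not> cr R T Y W" and o: "cr R T X Y"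
  shows "cr X Y Z W \<longleftrightarrow> lt X Z \<noteq> lt Y W"
proof -
  have XW: "cr R T X W" using cr_trans[of R T X Y W] RT E d s o by auto
  have ZY: "cr R T Z Y" using cr_trans[of R T Z X Y] RT E d s o cr_flip2 by auto
  have dd: "X \<noteq> Y" "X \<noteq> W" "Z \<noteq> Y" using cr_dist[OF o] cr_dist[OF XW] cr_dist[OF ZY] by auto
  have 1: "lt X Z \<longleftrightarrow> cr X Y R Z" using lt_cross(1)[OF E(1,2,3) d(1,3,4) s(1) o] .
  have o': "cr R T Y X" using o cr_flip2 by blast
  have 2: "lt Y W \<longleftrightarrow> cr Y X R W" using lt_cross(1)[OF E(3,4,1) d(2,5,6) s(2) o'] .
  have "cr X Y Z W \<longleftrightarrow> cr X Y Z R \<noteq> cr X Y R W" using cr_trans[of X Y Z R W] RT E d dd by auto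
  then show ?thesis using 1 2 cr_flip2 by metis
qed

text \<open>With \<open>A\<close>, \<open>B\<close>, \<open>C\<close>, \<open>D\<close> following
  one another from \<open>R\<close> to \<open>T\<close>, the chord \<open>AC\<close> separates
  \<open>B\<close> from \<open>R\<close> but not \<open>D\<close> from \<open>R\<close>.\<close>

lemma cross_same:
  assumes E: "{A, B, C, D} \<subseteq> E" "{A, B, C, D} \<inter> {R, T} = {}"
    and asym: "\<not> lt C B" "A \<noteq> C" "B \<noteq> C" "C \<noteq> D"
    and l: "lt A B" "lt A D" "lt C D"
  shows "cr A C B D"
proof -
  have d: "A \<noteq> B" "A \<noteq> D" using l cr_dist unfolding lt_def by (metis distinct_length_2_or_more)+
  have "cr R B A C \<longleftrightarrow> cr R B A T \<noteq> cr R B T C" using cr_trans[of R B A T C] RT E d asym by auto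
  then have 1: "cr A C B R" using l asym cr_flip2 unfolding lt_def by metis
  have "cr R D A C \<longleftrightarrow> cr R D A T \<noteq> cr R D T C" using cr_trans[of R D A T C] RT E d asym by auto
  then have 2: "\<not> cr A C R D" using l cr_flip2 unfolding lt_def by metis
  have "cr A C B D \<longleftrightarrow> cr A C B R \<noteq> cr A C R D" using cr_trans[of A C B R D] RT E d asym by auto
  then show ?thesis using 1 2 by blast
qed

text \<open>\<open>h\<close> stands for a half-turn about a point of the line \<open>RT\<close>. The
  first claim holds because \<open>h\<close> swaps the sides and reverses both orders. The second
  provides the crossing that the Pascal hexagons rely on, up to exchanging \<open>K\<close> and
  \<open>L\<close>.\<close>

lemma turn_crossings:
  assumes h: "\<And>x. x \<in> E \<Longrightarrow> h x \<in> E \<and> h x \<noteq> x \<and> h (h x) = x"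
      "\<And>x y. x \<in> E \<Longrightarrow> y \<in> E \<Longrightarrow> y \<noteq> x \<Longrightarrow> y \<noteq> h x \<Longrightarrow> cr x (h x) y (h y)"
    and hR: "h R = T"
    and E: "M \<in> E" "N \<in> E" "K \<in> E" "L \<in> E"
    and o: "cr R T M N" "cr R T K L" and s: "\<not> cr R T M K" and c: "cr M N K L"
    and nh: "N \<noteq> h M" "L \<noteq> h K"
  shows "cr (h M) (h N) (h K) (h L)" "cr (h N) L M (h K) \<or> cr (h N) K M (h L)"
proof -
  have hT: "h T = R" using h(1)[OF RT(1)] hR by auto
  have d: "M \<noteq> N" "M \<noteq> K" "M \<noteq> L" "N \<noteq> K" "N \<noteq> L" "K \<noteq> L" using cr_dist[OF c] by auto
  have dRT: "x \<notin> {R, T}" if "x \<in> {M, N, K, L}" for x using that cr_dist[OF o(1)] cr_dist[OF o(2)] by auto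
  have hE: "h M \<in> E" "h N \<in> E" "h K \<in> E" "h L \<in> E" using h E by blast+
  have hh: "h (h M) = M" "h (h N) = N" "h (h K) = K" "h (h L) = L" using h E by blast+
  have hd: "h x \<notin> {R, T}" if "x \<in> {M, N, K, L}" for x
    using dRT[OF that] hR hT hh that by auto
  have hinj: "h x = h y \<Longrightarrow> x = y" if "x \<in> E" "y \<in> E" for x y using h that by metis
  have opp: "cr R T x (h x)" if "x \<in> E" "x \<notin> {R, T}" for x
    using h(2)[OF RT(1) that(1)] that hR by auto
  \<comment> \<open>\<open>sd x\<close> means that \<open>x\<close> lies on the other side of
    \<open>RT\<close> from \<open>M\<close>.\<close>
  define sd where "sd x \<longleftrightarrow> cr R T M x" for x
  have sd: "cr R T x y \<longleftrightarrow> sd x \<noteq> sd y" if "x \<in> E" "y \<in> E" "x \<notin> {R, T}" "y \<notin> {R, T}" for x y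
    using cr_trans[of R T x M y] RT E that dRT cr_flip2(2)[of R T x M] unfolding sd_def by auto
  have M: "\<not> sd M" using cr_dist unfolding sd_def by (metis distinct_length_2_or_more)
  have sds: "sd N" "\<not> sd K" "sd L" using o s M sd[of K L] E dRT unfolding sd_def by auto
  have hs: "sd (h x) \<longleftrightarrow> \<not> sd x" if "x \<in> {M, N, K, L}" for x
    using sd[of x "h x"] opp[of x] that E hE dRT[OF that] hd[OF that] by auto
  have C0: "cr X Y Z W \<longleftrightarrow> lt X Z \<noteq> lt Y W"
    if "X \<in> E" "Z \<in> E" "Y \<in> E" "W \<in> E" "X \<noteq> Z" "Y \<noteq> W" "X \<notin> {R, T}" "Z \<notin> {R, T}" "Y \<notin> {R, T}" "W \<notin> {R, T}"
      "sd X = sd Z" "sd Y = sd W" "sd X \<noteq> sd Y" for X Y Z W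
    by (rule cross_opposite) (use that sd in auto)
  have tot: "lt X Z \<longleftrightarrow> \<not> lt Z X"
    if "X \<in> E" "Z \<in> E" "X \<noteq> Z" "X \<notin> {R, T}" "Z \<notin> {R, T}" "sd X = sd Z" for X Z
    by (rule lt_cross(3)[of X Z "h X"]) (use that sd opp h in auto)
  \<comment> \<open>The chords \<open>X (h X)\<close> and \<open>Z (h Z)\<close> cross, which by
    \<open>C0\<close> means that \<open>h\<close> reverses the order.\<close>
  have rev: "lt (h X) (h Z) \<longleftrightarrow> \<not> lt X Z"
    if "X \<in> E" "Z \<in> E" "X \<noteq> Z" "X \<notin> {R, T}" "Z \<notin> {R, T}" "sd X = sd Z" "h X \<notin> {R, T}" "h Z \<notin> {R, T}" for X Z
  proof -
    have hxE: "h X \<in> E" "h Z \<in> E" using h that by blast+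
    have "cr R T X (h X)" "cr R T Z (h Z)" using opp that by blast+
    then have ss: "sd (h X) \<noteq> sd X" "sd (h Z) \<noteq> sd Z" using sd that hxE by metis+
    then have ne: "Z \<noteq> h X" using that by metis
    have "h X \<noteq> h Z" using hinj that by blast
    then have "cr X (h X) Z (h Z) \<longleftrightarrow> lt X Z \<noteq> lt (h X) (h Z)"
      using C0[of X Z "h X" "h Z"] that hxE ss by blast
    then show ?thesis using h(2)[of X Z] that ne by blast
  qed
  have MK_NL: "lt M K \<noteq> lt N L" using C0[of M K N L] c E d dRT sds M by auto
  have NL': "lt (h N) (h L) \<longleftrightarrow> lt M K" using rev[of N L] MK_NL E d dRT hd sds by auto
  have MK': "lt (h M) (h K) \<longleftrightarrow> \<not> lt M K" using rev[of M K] E d dRT hd sds M by auto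
  have neq: "h N \<noteq> M" "h L \<noteq> K" "h N \<noteq> h L" "h M \<noteq> h K" "L \<noteq> h K" using nh hh hinj E d by metis+
  have "cr (h N) (h M) (h L) (h K) \<longleftrightarrow> lt (h N) (h L) \<noteq> lt (h M) (h K)"
    using C0[of "h N" "h L" "h M" "h K"] hE neq hd hs sds M by auto
  then show "cr (h M) (h N) (h K) (h L)" using NL' MK' cr_flip2 by metis
  have 1: "cr (h N) L M (h K) \<longleftrightarrow> lt (h N) M \<noteq> lt L (h K)"
    using C0[of "h N" M L "h K"] E hE neq hd hs sds M dRT by auto
  have 2: "lt L (h K) \<longleftrightarrow> lt K (h L)"
  proof -
    have "lt (h L) (h (h K)) \<longleftrightarrow> \<not> lt L (h K)"
      using rev[of L "h K"] E hE neq hd hs sds M dRT hh by auto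
    moreover have "lt K (h L) \<longleftrightarrow> \<not> lt (h L) K" using tot[of K "h L"] E hE neq hd hs sds M dRT by auto
    ultimately show ?thesis using hh by auto
  qed
  have C3: "cr A C B D"
    if "{A, B, C, D} \<subseteq> {M, K, h N, h L}" "lt A B" "lt B C" "lt A D" "lt C D" for A B C D
  proof (rule cross_same)
    have mem: "x \<in> E \<and> x \<notin> {R, T} \<and> \<not> sd x" if "x \<in> {M, K, h N, h L}" for x
      using that E hE hd hs sds M dRT by auto
    show "{A, B, C, D} \<subseteq> E" "{A, B, C, D} \<inter> {R, T} = {}" using mem that(1) by blast+
    have ne: "x \<noteq> y" if "lt x y" for x y using that cr_dist unfolding lt_def by (metis distinct_length_2_or_more)
    show bc: "B \<noteq> C" and "C \<noteq> D" using ne that by blast+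
    show nc: "\<not> lt C B" using tot[of B C] mem that bc by blast
    show "A \<noteq> C" using that nc by blast
  qed (use that in auto)
  show "cr (h N) L M (h K) \<or> cr (h N) K M (h L)"
  proof (rule ccontr)
    assume n: "\<not> ?thesis"
    have eq: "lt (h N) M \<longleftrightarrow> lt K (h L)" using n 1 2 by blast
    have t1: "lt M (h N) \<longleftrightarrow> \<not> lt (h N) M" using tot[of M "h N"] E hE neq hd hs sds M dRT by auto
    have t2: "lt (h L) K \<longleftrightarrow> \<not> lt K (h L)" using tot[of "h L" K] E hE neq hd hs sds M dRT by auto
    have t3: "lt K M \<longleftrightarrow> \<not> lt M K" using tot[of K M] E d hd hs sds M dRT by auto
    have t4: "lt (h L) (h N) \<longleftrightarrow> \<not> lt (h N) (h L)" using tot[of "h L" "h N"] hE neq hd hs sds M dRT by auto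
    \<comment> \<open>On the common side, \<open>h N\<close> and \<open>h L\<close> come in the same
      order as \<open>M\<close> and \<open>K\<close>. By \<open>eq\<close> one of the pairs encloses
      the other, so the chord from \<open>h N\<close> to \<open>K\<close> interlaces the one from
      \<open>M\<close> to \<open>h L\<close>.\<close>
    have "cr (h N) K M (h L)"
      using C3[of "h N" M K "h L"] C3[of M "h N" "h L" K] C3[of K "h L" "h N" M] C3[of "h L" K M "h N"]
        eq t1 t2 t3 t4 NL' cr_flip2 by (smt (verit) insert_subset insertCI empty_subsetI)
    then show False using n by blast
  qed
qed

end
end

context incidence_structure begin

text \<open>The rimpoint belonging to an end, written out as the equivalence class that
  \<open>rim_rel_class\<close> identifies it with.\<close>

definition rim_of :: "'l set \<Rightarrow> 'l rim" where
  "rim_of e = {(a, b). a \<noteq> b \<and> a \<in> e \<and> b \<in> e}"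

definition end_join :: "'l set \<Rightarrow> 'l set \<Rightarrow> 'l" where
  "end_join e f = (THE l. l \<in> e \<and> l \<in> f)"

definition turn_end :: "'p \<Rightarrow> 'l set \<Rightarrow> 'l set" where
  "turn_end P e = (THE f. f \<in> ends \<and> f \<noteq> e \<and> inc P (end_join e f))"

definition cross :: "'l set \<Rightarrow> 'l set \<Rightarrow> 'l set \<Rightarrow> 'l set \<Rightarrow> bool" where
  "cross a b c d \<longleftrightarrow> {a, b, c, d} \<subseteq> ends \<and> distinct [a, b, c, d] \<and> meets (end_join a b) (end_join c d)"

end

context hyperbolic_incidence begin

section \<open>Half-turns and crossing lines in terms of ends\<close>

lemma same_end_miss: "e \<in> ends \<Longrightarrow> a \<in> e \<Longrightarrow> b \<in> e \<Longrightarrow> \<not> meets a b"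
  using end_line_unique meetsE by metis

lemma end_join_eq: "e \<in> ends \<Longrightarrow> f \<in> ends \<Longrightarrow> e \<noteq> f \<Longrightarrow> l \<in> e \<Longrightarrow> l \<in> f \<Longrightarrow> end_join e f = l"
  unfolding end_join_def using ends_common_line by blast

lemma end_join_in: "e \<in> ends \<Longrightarrow> f \<in> ends \<Longrightarrow> e \<noteq> f \<Longrightarrow> end_join e f \<in> e \<and> end_join e f \<in> f"
  using join_ends end_join_eq by metis

lemma end_join_sym: "end_join e f = end_join f e"
  unfolding end_join_def by (simp add: conj_commute)

lemma three_ends:
  assumes "e \<in> ends" "f \<in> ends" "g \<in> ends" "l \<in> e" "l \<in> f" "l \<in> g" "e \<noteq> f"
  shows "g = e \<or> g = f"
proof -
  obtain X where X: "inc X l" using A2 by blast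
  obtain B C where "\<And>e. e \<in> ends \<Longrightarrow> l \<in> e \<Longrightarrow> e = pencil X B \<or> e = pencil X C"
    by (rule two_ends[OF X]) (rule that)
  then show ?thesis using assms by blast
qed

lemma line_ends:
  obtains e f where "e \<in> ends" "f \<in> ends" "e \<noteq> f" "l \<in> e" "l \<in> f" "end_join e f = l"
proof -
  obtain X where X: "inc X l" using A2 by blast
  obtain B C where BC: "inc B l" "inc C l" "between B X C" "pencil X B \<noteq> pencil X C"
    by (rule two_ends[OF X]) (rule that)
  have "X \<noteq> B" "X \<noteq> C" using btw_distinct BC(3) by blast+
  then have E: "pencil X B \<in> ends" "pencil X C \<in> ends" using pencil_in_ends by blast+
  have l: "l \<in> pencil X B" "l \<in> pencil X C" using line_in_pencil X BC by blast+
  show ?thesis by (rule that[OF E BC(4) l end_join_eq[OF E BC(4) l]])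
qed

lemma turn_end_eq: "e \<in> ends \<Longrightarrow> f \<in> ends \<Longrightarrow> f \<noteq> e \<Longrightarrow> inc P (end_join e f) \<Longrightarrow> turn_end P e = f"
  unfolding turn_end_def
proof (rule the_equality)
  assume h: "e \<in> ends" "f \<in> ends" "f \<noteq> e" "inc P (end_join e f)"
  then show "f \<in> ends \<and> f \<noteq> e \<and> inc P (end_join e f)" by blast
  fix g assume g: "g \<in> ends \<and> g \<noteq> e \<and> inc P (end_join e g)"
  have "end_join e f = end_join e g" using end_line_unique[of e "end_join e f" "end_join e g" P] end_join_in h g by metis
  then show "g = f" using three_ends[of e f g "end_join e f"] end_join_in h g by metis
qed

lemma turn_end:
  assumes "e \<in> ends"
  shows "turn_end P e \<in> ends" "turn_end P e \<noteq> e" "inc P (end_join e (turn_end P e))" "turn_end P (turn_end P e) = e"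
proof -
  obtain k where k: "k \<in> e" "inc P k" using end_line_ex assms by blast
  obtain a b where ab: "a \<in> ends" "b \<in> ends" "a \<noteq> b" "k \<in> a" "k \<in> b" by (rule line_ends)
  obtain f where f: "f \<in> ends" "f \<noteq> e" "k \<in> f" using ab three_ends[of a b e k] assms k by metis
  have j: "end_join e f = k" using end_join_eq assms f k by metis
  have e: "turn_end P e = f" using turn_end_eq assms f j k by metis
  show "turn_end P e \<in> ends" "turn_end P e \<noteq> e" "inc P (end_join e (turn_end P e))" using e f j k by auto
  show "turn_end P (turn_end P e) = e" using turn_end_eq[of f e P] e f assms j k end_join_sym by metis
qed

lemma not_end: "{a, b, c} \<subseteq> ends \<Longrightarrow> distinct [a, b, c] \<Longrightarrow> end_join a b \<notin> c"
  using three_ends[of a b c "end_join a b"] end_join_in[of a b] by auto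

lemma cross_eopp:
  assumes "{a, b, c, d} \<subseteq> ends" "a \<noteq> b" "c \<notin> {a, b}" "d \<notin> {a, b}"
  shows "cross a b c d \<longleftrightarrow> opp_ends (end_join a b) c d"
proof (cases "c = d")
  case True
  have "\<not> opp_ends (end_join a b) c c"
    using opp_ends_trans[of c c c "end_join a b"] not_end[of a b c] assms by auto
  then show ?thesis using True unfolding cross_def by auto
next
  case False
  have E: "a \<in> ends" "b \<in> ends" "c \<in> ends" "d \<in> ends" using assms(1) by blast+
  have n: "end_join a b \<notin> c" "end_join a b \<notin> d" using not_end[of a b c] not_end[of a b d] assms by auto
  have "opp_ends (end_join a b) c d \<longleftrightarrow> meets (end_join c d) (end_join a b)"
    using opp_ends_meets[OF E(3,4) False] end_join_in[OF E(3,4) False] n by blast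
  moreover have "cross a b c d \<longleftrightarrow> meets (end_join a b) (end_join c d)"
    unfolding cross_def using assms False by auto
  ultimately show ?thesis using meets_sym by blast
qed

text \<open>\<open>cr_trans\<close> expresses the two sides of a line. For \<open>cr_pair\<close>,
  the line \<open>ac\<close> shares an end with \<open>ab\<close> and so lies on the side of
  \<open>c\<close>, while \<open>bd\<close> lies on the side of \<open>d\<close>; these sides are
  opposite, so \<open>ac\<close> and \<open>bd\<close> cannot meet.\<close>

lemma cross_separation: "separation ends cross"
proof
  fix a b c d
  assume c: "cross a b c d"
  then show "distinct [a, b, c, d]" "cross c d a b" "cross b a c d"
    unfolding cross_def using meets_sym end_join_sym[of a b] by auto
  have E: "a \<in> ends" "b \<in> ends" "c \<in> ends" "d \<in> ends" and
    d: "a \<noteq> b" "a \<noteq> c" "a \<noteq> d" "b \<noteq> c" "b \<noteq> d" "c \<noteq> d" using c unfolding cross_def by auto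
  show "\<not> cross a c b d"
  proof
    assume "cross a c b d"
    then have m: "meets (end_join a c) (end_join b d)" unfolding cross_def by blast
    then obtain Z where Z: "inc Z (end_join a c)" "inc Z (end_join b d)" using meetsE by metis
    have "opp_ends (end_join a b) c d" using c cross_eopp[of a b c d] E d by auto
    then obtain X V W where h: "inc X (end_join a b)" "X \<noteq> V" "X \<noteq> W" "c = pencil X V" "d = pencil X W"
        "opp (end_join a b) V W" unfolding opp_ends_def by (elim exE conjE) (rule that)
    have j: "end_join a b \<in> a" "end_join a b \<in> b" "end_join a c \<in> a" "end_join a c \<in> c" "end_join b d \<in> b" "end_join b d \<in> d"
      using end_join_in E d by blast+
    have n: "end_join a b \<notin> c" "end_join a b \<notin> d" using not_end[of a b] E d by auto
    have "\<not> meets (end_join a c) (end_join a b)" "\<not> meets (end_join b d) (end_join a b)" using same_end_miss j E by blast+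
    moreover have "end_join a c \<noteq> end_join a b" "end_join b d \<noteq> end_join a b" using j n by metis+
    ultimately have "ss (end_join a b) V Z" "ss (end_join a b) W Z"
      using end_side_miss[of c "end_join a c" "end_join a b" Z X V] end_side_miss[of d "end_join b d" "end_join a b" Z X W] E j Z h oppD by blast+
    then show False using h ss_trans ss_sym ss_not_opp by metis
  qed
next
  fix a b x y z
  assume h: "{a, b, x, y, z} \<subseteq> ends" "a \<noteq> b" "x \<notin> {a, b}" "y \<notin> {a, b}" "z \<notin> {a, b}"
  have E: "a \<in> ends" "b \<in> ends" "x \<in> ends" "y \<in> ends" "z \<in> ends" using h(1) by simp_all
  have d: "x \<noteq> a" "x \<noteq> b" "y \<noteq> a" "y \<noteq> b" "z \<noteq> a" "z \<noteq> b" using h(3-5) by simp_all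
  have c: "cross a b u v \<longleftrightarrow> opp_ends (end_join a b) u v"
    if "u \<in> ends" "u \<noteq> a" "u \<noteq> b" "v \<in> ends" "v \<noteq> a" "v \<noteq> b" for u v
    by (rule cross_eopp) (use that E h(2) in simp_all)
  have n: "end_join a b \<notin> u" if "u \<in> ends" "u \<noteq> a" "u \<noteq> b" for u
    using not_end[of a b u] h(2) E that by simp
  have "opp_ends (end_join a b) x z \<longleftrightarrow> opp_ends (end_join a b) x y \<noteq> opp_ends (end_join a b) y z"
    by (rule opp_ends_trans[OF E(3-5)]) (use n E d in blast)+
  then show "cross a b x z \<longleftrightarrow> cross a b x y \<noteq> cross a b y z"
    using c[of x z] c[of x y] c[of y z] E d by simp
qed

end

section \<open>Rimpoints and half-turns\<close>

context incidence_structure begin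

definition turn_line :: "'p \<Rightarrow> 'l \<Rightarrow> 'l" where
  "turn_line P l = (THE k. \<exists>e f. e \<in> ends \<and> f \<in> ends \<and> e \<noteq> f \<and> l \<in> e \<and> l \<in> f \<and> k = end_join (turn_end P e) (turn_end P f))"

end

context hyperbolic_incidence begin

section \<open>Identification of rimpoints with ends\<close>

lemma parallel_iff: "parallel a b \<longleftrightarrow> a \<noteq> b \<and> (\<exists>e\<in>ends. a \<in> e \<and> b \<in> e)"
proof
  assume "parallel a b"
  then obtain r s where rs: "r \<subseteq> points_of a" "s \<subseteq> points_of b" "rays_parallel r s" unfolding parallel_def by blast
  obtain P U X Y where p: "r = ray P U" "s = ray X Y" "par P U X Y" using rays_parallelE[OF rs(3)] by metis
  have I: "inc P a" "inc U a" "inc X b" "inc Y b"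
    using subsetD[OF rs(1), of P] subsetD[OF rs(1), of U] subsetD[OF rs(2), of X] subsetD[OF rs(2), of Y] p ray_ends
    by (simp_all add: points_of_def)
  obtain t where t: "inc P t" "inc X t" using ex_line by blast
  have "a \<noteq> b" using parD(2)[OF p(3) t I] .
  moreover have "pencil X Y \<in> ends" using pencil_in_ends par_points[OF p(3)] by metis
  moreover have "a \<in> pencil X Y" using p(3) I unfolding pencil_def by blast
  moreover have "b \<in> pencil X Y" using I line_in_pencil by blast
  ultimately show "a \<noteq> b \<and> (\<exists>e\<in>ends. a \<in> e \<and> b \<in> e)" by blast
next
  assume "a \<noteq> b \<and> (\<exists>e\<in>ends. a \<in> e \<and> b \<in> e)"
  then obtain e where h: "a \<noteq> b" "e \<in> ends" "a \<in> e" "b \<in> e" by blast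
  obtain X where X: "inc X b" using A2 by blast
  obtain Y where Y: "inc Y b" "X \<noteq> Y" "e = pencil X Y" using end_at h X by blast
  have Xa: "\<not> inc X a" using end_line_unique h X by blast
  obtain P where P: "inc P a" using A2 by blast
  obtain U where U: "inc U a" "par P U X Y" using pencil_par_at Y h Xa P by metis
  have "ray P U \<subseteq> points_of a" using ray_line[of P U a] P U par_points[OF U(2)] by (auto simp: points_of_def)
  moreover have "ray X Y \<subseteq> points_of b" using ray_line[of X Y b] X Y by (auto simp: points_of_def)
  moreover have "rays_parallel (ray P U) (ray X Y)" using par_rays_parallel U by blast
  ultimately show "parallel a b"
    unfolding parallel_def by (intro exI[of _ "ray P U"] exI[of _ "ray X Y"]) simp
qed

lemma common_end_side:
  assumes "f \<in> ends" "u \<in> f" "v \<in> f" "w \<notin> f" "\<not> meets u w" "\<not> meets v w" "inc A u" "inc B v"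
  shows "ss w A B"
proof -
  obtain X where X: "inc X w" using A2 by blast
  obtain V where V: "\<not> inc V w" "X \<noteq> V" "f = pencil X V" using end_side_exists assms X by metis
  have "u \<noteq> w" "v \<noteq> w" using assms by blast+
  then have "ss w V A" "ss w V B" using end_side_miss[of f _ w _ X V] assms X V by blast+
  then show ?thesis using ss_trans ss_sym by metis
qed

text \<open>By \<open>one_between\<close> one of the lines separates points of the other two, and
  the line joining those points meets all three.\<close>

lemma common_end_transversal:
  assumes "e \<in> ends" "a \<in> e" "b \<in> e" "l \<in> e" "a \<noteq> b" "l \<noteq> a" "l \<noteq> b"
  shows "\<exists>t. meets t a \<and> meets t b \<and> meets t l"
proof -
  obtain X where X: "inc X l" using A2 by blast
  obtain Y where Y: "inc Y l" "X \<noteq> Y" "e = pencil X Y" using end_at assms X by blast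
  have n: "\<not> inc X a" "\<not> inc X b" using end_line_unique assms X by blast+
  obtain P Q where PQ: "inc P a" "inc Q b" using A2 by metis
  obtain U where U: "inc U a" "par P U X Y" using pencil_par_at Y assms n PQ by metis
  obtain W where W: "inc W b" "par Q W X Y" using pencil_par_at Y assms n PQ by metis
  have off: "\<not> inc P b" "\<not> inc Q a" "\<not> inc P l" "\<not> inc Q l" using end_line_unique assms PQ by blast+
  have tr: "\<exists>t. meets t u \<and> meets t v \<and> meets t w"
    if "opp w A B" "inc A u" "inc B v" "\<not> inc A v" "\<not> inc B u" for u v w A B
  proof -
    obtain t where t: "inc A t" "inc B t" using ex_line by blast
    have "t \<noteq> u" "t \<noteq> v" using t that by blast+
    then show ?thesis using t that opp_meets meetsI by metis
  qed
  consider "opp l P Q" | "opp b P X" | "opp a Q X"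
    using one_between[OF U(2) W(2) PQ(1) U(1) PQ(2) W(1) assms(5) X Y(1)] by blast
  then show ?thesis
  proof cases
    case 1 then show ?thesis using tr[of l P Q a b] PQ off by blast
  next
    case 2 then show ?thesis using tr[of b P X a l] PQ off X n by blast
  next
    case 3 then show ?thesis using tr[of a Q X b l] PQ off X n by blast
  qed
qed

text \<open>The transversal is what excludes triangles with three ends as vertices. Of its three
  points one is in the middle, and the line through that point would separate the other two lines,
  although these share an end and miss it.\<close>

lemma concurrent_parallels_iff:
  assumes "e \<in> ends" "a \<in> e" "b \<in> e" "a \<noteq> b"
  shows "concurrent_parallels a b l \<longleftrightarrow> l \<in> e \<and> l \<noteq> a \<and> l \<noteq> b"
proof
  assume "l \<in> e \<and> l \<noteq> a \<and> l \<noteq> b"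
  then show "concurrent_parallels a b l"
    unfolding concurrent_parallels_def parallel_iff using common_end_transversal assms by blast
next
  assume "concurrent_parallels a b l"
  then obtain f g t where f: "f \<in> ends" "l \<in> f" "a \<in> f" and g: "g \<in> ends" "l \<in> g" "b \<in> g"
    and ne: "l \<noteq> a" "l \<noteq> b" and t: "meets t a" "meets t b" "meets t l"
    unfolding concurrent_parallels_def parallel_iff by blast
  have "l \<in> e"
  proof (rule ccontr)
    assume le: "l \<notin> e"
    have fb: "b \<notin> f" using ends_common_line[of e f a b] assms f le by blast
    have ga: "a \<notin> g" using ends_common_line[of e g a b] assms g le by blast
    have m: "\<not> meets a b" "\<not> meets b a" "\<not> meets l a" "\<not> meets a l" "\<not> meets l b" "\<not> meets b l"
      using same_end_miss assms f g by blast+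
    obtain A B L where ABL: "inc A a" "inc A t" "inc B b" "inc B t" "inc L l" "inc L t"
      using t meetsE by metis
    have off: "\<not> inc A b" "\<not> inc A l" "\<not> inc B a" "\<not> inc B l" "\<not> inc L a" "\<not> inc L b"
      using m ABL assms(4) ne meetsI by metis+
    have d: "A \<noteq> B" "A \<noteq> L" "B \<noteq> L" using off ABL by blast+
    consider "between A B L" | "between B A L" | "between A L B" using btw_total[of A B L t] d ABL by blast
    then show False
    proof cases
      case 1
      then have "opp b A L" using btw_opp ABL off by blast
      then show False using common_end_side[of f a l b A L] f fb m ABL ss_not_opp by blast
    next
      case 2
      then have "opp a B L" using btw_opp ABL off by blast
      then show False using common_end_side[of g b l a B L] g ga m ABL ss_not_opp by blast
    next
      case 3
      then have "opp l A B" using btw_opp ABL off by blast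
      then show False using common_end_side[of e a b l A B] assms le m ABL ss_not_opp by blast
    qed
  qed
  then show "l \<in> e \<and> l \<noteq> a \<and> l \<noteq> b" using ne by blast
qed

lemma third_of_end:
  assumes "e \<in> ends"
  shows "\<exists>l\<in>e. l \<noteq> a \<and> l \<noteq> b"
proof -
  obtain P where P: "inc P a" using A2 by blast
  obtain k where k: "inc P k" "k \<noteq> a" "k \<noteq> b" using third_line by metis
  obtain B C where BC: "inc B k" "inc C k" "between B P C" using mid k by metis
  have d: "B \<noteq> P" "P \<noteq> C" "B \<noteq> C" using BC btw_distinct by blast+
  have "\<not> inc B a" "\<not> inc C a" using BC k P d line_eq by metis+
  moreover have "\<not> inc B b \<or> \<not> inc C b" using BC k d line_eq by metis
  ultimately obtain Z where "\<not> inc Z a" "\<not> inc Z b" by blast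
  then show ?thesis using end_line_ex[OF assms, of Z] by metis
qed

lemma rim_pairs_iff: "(a, b) \<in> rim_pairs \<longleftrightarrow> a \<noteq> b \<and> (\<exists>e\<in>ends. a \<in> e \<and> b \<in> e)"
proof -
  have "\<exists>l. concurrent_parallels a b l" if "e \<in> ends" "a \<in> e" "b \<in> e" "a \<noteq> b" for e
    using concurrent_parallels_iff[OF that] third_of_end[OF that(1)] by blast
  then show ?thesis unfolding rim_pairs_def parallel_iff by blast
qed

lemma pair_on_iff:
  assumes "e \<in> ends" "(a, b) \<in> rim_of e"
  shows "pair_on (a, b) l \<longleftrightarrow> l \<in> e"
proof -
  have "a \<in> e" "b \<in> e" "a \<noteq> b" using assms unfolding rim_of_def by auto
  then show ?thesis unfolding pair_on_def using concurrent_parallels_iff[OF assms(1)] by auto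
qed

lemma rim_rel_class:
  assumes "e \<in> ends" "p \<in> rim_of e"
  shows "rim_rel `` {p} = rim_of e"
proof -
  obtain a b where p: "p = (a, b)" "a \<noteq> b" "a \<in> e" "b \<in> e" using assms unfolding rim_of_def by auto
  have ab: "(a, b) \<in> rim_of e" using assms p by simp
  have "(p, (c, d)) \<in> rim_rel \<longleftrightarrow> (c, d) \<in> rim_of e" for c d
  proof
    assume "(p, (c, d)) \<in> rim_rel"
    then have h: "(c, d) \<in> rim_pairs" "pair_on (a, b) c" "pair_on (a, b) d" unfolding rim_rel_def p by auto
    then have "c \<in> e" "d \<in> e" using pair_on_iff[OF assms(1) ab] by blast+
    then show "(c, d) \<in> rim_of e" using h rim_pairs_iff unfolding rim_of_def by blast
  next
    assume "(c, d) \<in> rim_of e"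
    then have c: "c \<noteq> d" "c \<in> e" "d \<in> e" unfolding rim_of_def by auto
    then have "(a, b) \<in> rim_pairs" "(c, d) \<in> rim_pairs" using rim_pairs_iff p assms(1) by blast+
    moreover have "x = y \<or> parallel x y" if "x \<in> e" "y \<in> e" for x y using that parallel_iff assms(1) by blast
    moreover have "pair_on (a, b) c" "pair_on (a, b) d" using pair_on_iff[OF assms(1) ab] c by blast+
    ultimately show "(p, (c, d)) \<in> rim_rel" unfolding rim_rel_def p using p(3,4) c by auto
  qed
  then show ?thesis by auto
qed

lemma rim_of_nonempty: "e \<in> ends \<Longrightarrow> \<exists>p. p \<in> rim_of e"
  using third_of_end unfolding rim_of_def by blast

lemma rimpoints_iff: "X \<in> rimpoints \<longleftrightarrow> (\<exists>e\<in>ends. X = rim_of e)"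
proof
  assume "X \<in> rimpoints"
  then obtain p where p: "p \<in> rim_pairs" "X = rim_rel `` {p}" unfolding rimpoints_def quotient_def by blast
  obtain a b where ab: "p = (a, b)" by (cases p)
  obtain e where e: "e \<in> ends" "a \<noteq> b" "a \<in> e" "b \<in> e" using p ab rim_pairs_iff by blast
  then have "p \<in> rim_of e" using ab unfolding rim_of_def by blast
  then show "\<exists>e\<in>ends. X = rim_of e" using rim_rel_class e p by blast
next
  assume "\<exists>e\<in>ends. X = rim_of e"
  then obtain e where e: "e \<in> ends" "X = rim_of e" by blast
  obtain a b where p: "(a, b) \<in> rim_of e" using rim_of_nonempty e by fastforce
  then have "(a, b) \<in> rim_pairs" using rim_pairs_iff e unfolding rim_of_def by blast
  then show "X \<in> rimpoints" unfolding rimpoints_def quotient_def using rim_rel_class[OF e(1) p] e by blast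
qed

lemma rim_on_iff: "e \<in> ends \<Longrightarrow> rim_on (rim_of e) l \<longleftrightarrow> l \<in> e"
proof -
  assume e: "e \<in> ends"
  have "pair_on p l \<longleftrightarrow> l \<in> e" if "p \<in> rim_of e" for p using pair_on_iff[OF e] that by (cases p) blast
  then show ?thesis unfolding rim_on_def using rim_of_nonempty[OF e] rimpoints_iff e by blast
qed

lemma rim_of_inj: "e \<in> ends \<Longrightarrow> f \<in> ends \<Longrightarrow> rim_of e = rim_of f \<Longrightarrow> e = f"
  using rim_on_iff[of e] rim_on_iff[of f] by (intro set_eqI) simp

lemma join_rims:
  "e \<in> ends \<Longrightarrow> f \<in> ends \<Longrightarrow> join (Rim (rim_of e)) (Rim (rim_of f)) = end_join e f"
  unfolding join_def end_join_def on_def using rim_on_iff by simp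

lemma join_fin_rim:
  assumes "e \<in> ends"
  shows "join (Fin P) (Rim (rim_of e)) = end_join e (turn_end P e)"
  unfolding join_def
proof (rule the_equality)
  note h = turn_end[OF assms, of P]
  show "on (Fin P) (end_join e (turn_end P e)) \<and> on (Rim (rim_of e)) (end_join e (turn_end P e))"
    unfolding on_def using h end_join_in[OF assms h(1)] rim_on_iff[OF assms] by auto
  fix l assume "on (Fin P) l \<and> on (Rim (rim_of e)) l"
  then show "l = end_join e (turn_end P e)"
    unfolding on_def using h end_join_in[OF assms h(1)] rim_on_iff[OF assms] end_line_unique[OF assms] by auto
qed

lemma half_turn_rim:
  assumes "e \<in> ends"
  shows "half_turn P (rim_of e) = rim_of (turn_end P e)"
  unfolding half_turn_def join_fin_rim[OF assms]
proof (rule the_equality)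
  note h = turn_end[OF assms, of P]
  note j = end_join_in[OF assms h(1) h(2)[symmetric]]
  show "rim_of (turn_end P e) \<noteq> rim_of e \<and> rim_on (rim_of (turn_end P e)) (end_join e (turn_end P e))"
    using rim_of_inj h assms rim_on_iff j by blast
  fix Y assume Y: "Y \<noteq> rim_of e \<and> rim_on Y (end_join e (turn_end P e))"
  then obtain f where f: "f \<in> ends" "Y = rim_of f" unfolding rim_on_def using rimpoints_iff by blast
  then have "end_join e (turn_end P e) \<in> f" "f \<noteq> e" using Y rim_on_iff by blast+
  then show "Y = rim_of (turn_end P e)" using three_ends[of e "turn_end P e" f] assms h j f by blast
qed

section \<open>Pascal and the images of lines through a point\<close>

lemma pascal:
  assumes E: "a \<in> ends" "b \<in> ends" "c \<in> ends" "d \<in> ends" "e \<in> ends" "f \<in> ends"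
    and d: "a \<noteq> b" "b \<noteq> c" "c \<noteq> d" "d \<noteq> e" "e \<noteq> f" "f \<noteq> a"
    and U: "end_join a b \<noteq> end_join d e" "inc U (end_join a b)" "inc U (end_join d e)"
    and V: "end_join b c \<noteq> end_join e f" "inc V (end_join b c)" "inc V (end_join e f)"
    and W: "end_join c d \<noteq> end_join f a" "inc W (end_join c d)" "inc W (end_join f a)"
  shows "\<exists>l. inc U l \<and> inc V l \<and> inc W l"
proof -
  have "collinear {U, V, W}"
  proof (rule A7[of "Rim (rim_of a)" "Rim (rim_of b)" "Rim (rim_of c)" "Rim (rim_of d)" "Rim (rim_of e)" "Rim (rim_of f)"])
    show "{Rim (rim_of a), Rim (rim_of b), Rim (rim_of c), Rim (rim_of d), Rim (rim_of e), Rim (rim_of f)} \<subseteq> Rim ` rimpoints"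
      using rimpoints_iff E by blast
    show "(Rim (rim_of a) :: ('p, 'l) gpoint) \<noteq> Rim (rim_of b)" "(Rim (rim_of b) :: ('p, 'l) gpoint) \<noteq> Rim (rim_of c)"
      "(Rim (rim_of c) :: ('p, 'l) gpoint) \<noteq> Rim (rim_of d)" "(Rim (rim_of d) :: ('p, 'l) gpoint) \<noteq> Rim (rim_of e)"
      "(Rim (rim_of e) :: ('p, 'l) gpoint) \<noteq> Rim (rim_of f)" "(Rim (rim_of f) :: ('p, 'l) gpoint) \<noteq> Rim (rim_of a)"
      using rim_of_inj E d by blast+
    show "meet_at (join (Rim (rim_of a)) (Rim (rim_of b))) (join (Rim (rim_of d)) (Rim (rim_of e))) U"
      "meet_at (join (Rim (rim_of b)) (Rim (rim_of c))) (join (Rim (rim_of e)) (Rim (rim_of f))) V"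
      "meet_at (join (Rim (rim_of c)) (Rim (rim_of d))) (join (Rim (rim_of f)) (Rim (rim_of a))) W"
      unfolding meet_at_def using join_rims E U V W by simp_all
  qed
  then show ?thesis unfolding collinear_def points_of_def by auto
qed

lemma point_eq: "a \<noteq> b \<Longrightarrow> inc X a \<Longrightarrow> inc X b \<Longrightarrow> inc Y a \<Longrightarrow> inc Y b \<Longrightarrow> X = Y"
  using line_eq by blast

lemma turn_end_inj: "e \<in> ends \<Longrightarrow> f \<in> ends \<Longrightarrow> turn_end P e = turn_end P f \<Longrightarrow> e = f"
  using turn_end(4) by metis

lemma turn_lines_meet:
  assumes "x \<in> ends" "y \<in> ends" "y \<noteq> x" "y \<noteq> turn_end P x"
  shows "cross x (turn_end P x) y (turn_end P y)"
proof -
  note hx = turn_end[OF assms(1), of P] and hy = turn_end[OF assms(2), of P]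
  have d: "turn_end P y \<noteq> x" "turn_end P y \<noteq> turn_end P x" using hx hy assms turn_end_inj by metis+
  have "end_join x (turn_end P x) \<noteq> end_join y (turn_end P y)"
    using three_ends[of x "turn_end P x" y "end_join x (turn_end P x)"] end_join_in[OF assms(1) hx(1)] end_join_in[OF assms(2) hy(1)] hx hy assms
    by metis
  then have "meets (end_join x (turn_end P x)) (end_join y (turn_end P y))" using hx(3) hy(3) meetsI by blast
  then show ?thesis unfolding cross_def using assms hx hy d by auto
qed

text \<open>Pascal for the hexagon \<open>M N N' L K K'\<close> puts the intersection \<open>W\<close> of \<open>N'L\<close> and \<open>MK'\<close> on the line
  \<open>PQ\<close>; then Pascal for \<open>M M' N' L L' K'\<close> does the same for the intersection \<open>V\<close> of \<open>M'N'\<close> and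
  \<open>K'L'\<close>. One of the two hexagons degenerates when \<open>K = N'\<close> or \<open>L = M'\<close>.\<close>
lemma pascal_step:
  assumes c: "cross M N K L" and Q: "inc Q (end_join M N)" "inc Q (end_join K L)"
    and t: "inc P t" "inc Q t" "P \<noteq> Q"
    and nP: "\<not> inc P (end_join M N)" "\<not> inc P (end_join K L)"
    and V: "meets (end_join (turn_end P M) (turn_end P N)) (end_join (turn_end P K) (turn_end P L))"
      "inc V (end_join (turn_end P M) (turn_end P N))" "inc V (end_join (turn_end P K) (turn_end P L))"
    and w: "cross (turn_end P N) L M (turn_end P K)"
  shows "inc V t"
proof -
  define h where "h = turn_end P"
  have E: "M \<in> ends" "N \<in> ends" "K \<in> ends" "L \<in> ends" and
    d: "M \<noteq> N" "M \<noteq> K" "M \<noteq> L" "N \<noteq> K" "N \<noteq> L" "K \<noteq> L" and mt: "meets (end_join M N) (end_join K L)"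
    using c unfolding cross_def by auto
  have hE: "h M \<in> ends" "h N \<in> ends" "h K \<in> ends" "h L \<in> ends" using turn_end(1) E unfolding h_def by blast+
  have hn: "h M \<noteq> M" "h N \<noteq> N" "h K \<noteq> K" "h L \<noteq> L" using turn_end(2) E unfolding h_def by blast+
  have hh: "h (h M) = M" "h (h N) = N" "h (h K) = K" "h (h L) = L" using turn_end(4) E unfolding h_def by blast+
  have hd: "h M \<noteq> h N" "h K \<noteq> h L" using hh d by metis+
  have hP: "inc P (end_join M (h M))" "inc P (end_join N (h N))" "inc P (end_join K (h K))" "inc P (end_join L (h L))"
    using turn_end(3) E unfolding h_def by blast+
  have wd: "h N \<noteq> L" "h N \<noteq> M" "L \<noteq> h K" "M \<noteq> h K" and wm: "meets (end_join (h N) L) (end_join M (h K))"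
    using w unfolding cross_def h_def by auto
  obtain W where W: "inc W (end_join (h N) L)" "inc W (end_join M (h K))" "end_join (h N) L \<noteq> end_join M (h K)" using wm meetsE by metis
  have MNKL: "end_join M N \<noteq> end_join K L" using mt meetsE by metis
  have Vne: "end_join (h M) (h N) \<noteq> end_join (h K) (h L)" using V(1) meetsE unfolding h_def by metis
  have tl: "l = t" if "inc P l" "inc Q l" for l using that t line_eq by metis
  have Wt: "inc W t"
  proof (cases "K = h N")
    case True
    then have "h K = N" using hh by metis
    then have "W = Q" using point_eq[OF MNKL] W Q True by metis
    then show ?thesis using t by blast
  next
    case False
    have 1: "end_join N (h N) \<noteq> end_join K (h K)"
      using three_ends[of N "h N" K "end_join N (h N)"] end_join_in[of N "h N"] end_join_in[of K "h K"] E hE hn d False by metis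
    have "\<exists>l. inc Q l \<and> inc P l \<and> inc W l"
      by (rule pascal[of M N "h N" L K "h K"])
        (use E hE d hn wd MNKL Q 1 hP W end_join_sym[of L K] end_join_sym[of "h K" M] in \<open>simp_all add: eq_commute\<close>)
    then show ?thesis using tl by metis
  qed
  show ?thesis
  proof (cases "L = h M")
    case True
    then have "h L = M" using hh by metis
    then have "W = V" using point_eq[OF Vne, of W V] W V True end_join_sym[of "h N" "h M"] end_join_sym[of "h K" "h L"]
      unfolding h_def by metis
    then show ?thesis using Wt by blast
  next
    case False
    have 1: "end_join M (h M) \<noteq> end_join L (h L)"
      using three_ends[of M "h M" L "end_join M (h M)"] end_join_in[of M "h M"] end_join_in[of L "h L"] E hE hn d False by metis
    have "\<exists>l. inc P l \<and> inc V l \<and> inc W l"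
      by (rule pascal[of M "h M" "h N" L "h L" "h K"])
        (use E hE d hn wd hd Vne 1 hP W V(2,3) end_join_sym[of "h L" "h K"] end_join_sym[of "h K" M]
          in \<open>simp_all add: h_def[symmetric] eq_commute\<close>)
    \<comment> \<open>Only distinct \<open>W\<close> and \<open>P\<close> identify the Pascal line
      with \<open>t\<close>. If they coincided, the line with ends \<open>N'\<close> and
      \<open>L\<close> would pass through \<open>P\<close>, and \<open>L\<close> would be
      \<open>N\<close>.\<close>
    moreover have "W \<noteq> P"
    proof
      assume "W = P"
      then have "turn_end P (h N) = L" using turn_end_eq[of "h N" L P] E hE wd W by metis
      then show False using hh d unfolding h_def by metis
    qed
    ultimately show ?thesis using Wt t line_eq by metis
  qed
qed

lemma turn_line_eq:
  assumes "e \<in> ends" "f \<in> ends" "e \<noteq> f" "l \<in> e" "l \<in> f"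
  shows "turn_line P l = end_join (turn_end P e) (turn_end P f)"
  unfolding turn_line_def
proof (rule the_equality)
  show "\<exists>e' f'. e' \<in> ends \<and> f' \<in> ends \<and> e' \<noteq> f' \<and> l \<in> e' \<and> l \<in> f' \<and>
     end_join (turn_end P e) (turn_end P f) = end_join (turn_end P e') (turn_end P f')" using assms by blast
  fix k assume "\<exists>e f. e \<in> ends \<and> f \<in> ends \<and> e \<noteq> f \<and> l \<in> e \<and> l \<in> f \<and> k = end_join (turn_end P e) (turn_end P f)"
  then obtain a b where h: "a \<in> ends" "b \<in> ends" "a \<noteq> b" "l \<in> a" "l \<in> b" "k = end_join (turn_end P a) (turn_end P b)" by blast
  have "a = e \<or> a = f" "b = e \<or> b = f" using three_ends[OF assms(1,2)] assms h by blast+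
  then show "k = end_join (turn_end P e) (turn_end P f)" using h end_join_sym by metis
qed

lemma turn_line_ends:
  assumes "e \<in> ends" "f \<in> ends" "e \<noteq> f" "l \<in> e" "l \<in> f"
  shows "turn_line P l \<in> turn_end P e" "turn_line P l \<in> turn_end P f"
  using turn_line_eq[OF assms] end_join_in[of "turn_end P e" "turn_end P f"] turn_end(1) turn_end_inj assms by metis+

lemma turn_line_involution: "turn_line P (turn_line P l) = l"
proof -
  obtain e f where h: "e \<in> ends" "f \<in> ends" "e \<noteq> f" "l \<in> e" "l \<in> f" "end_join e f = l" by (rule line_ends)
  have "turn_line P (turn_line P l) = end_join (turn_end P (turn_end P e)) (turn_end P (turn_end P f))"
    using turn_line_eq turn_line_ends[OF h(1-5)] turn_end(1) turn_end_inj h by metis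
  then show ?thesis using turn_end(4) h by metis
qed

lemma turn_line_fixed: "inc P l \<Longrightarrow> turn_line P l = l"
proof -
  assume P: "inc P l"
  obtain e f where h: "e \<in> ends" "f \<in> ends" "e \<noteq> f" "l \<in> e" "l \<in> f" "end_join e f = l" by (rule line_ends)
  have "turn_end P e = f" "turn_end P f = e" using turn_end_eq h P end_join_sym by metis+
  then show ?thesis using turn_line_eq h end_join_sym by metis
qed

lemma turn_lines_concurrent_pair:
  assumes "inc P t" "inc Q t" "P \<noteq> Q" "inc Q a" "inc Q b" "a \<noteq> t" "b \<noteq> t" "a \<noteq> b"
  shows "\<exists>V. inc V t \<and> inc V (turn_line P a) \<and> inc V (turn_line P b)"
proof -
  interpret separation ends cross by (rule cross_separation)
  obtain R T where t: "R \<in> ends" "T \<in> ends" "R \<noteq> T" "t \<in> R" "t \<in> T" "end_join R T = t" by (rule line_ends)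
  obtain M N where a: "M \<in> ends" "N \<in> ends" "M \<noteq> N" "a \<in> M" "a \<in> N" "end_join M N = a" by (rule line_ends)
  obtain K' L' where b': "K' \<in> ends" "L' \<in> ends" "K' \<noteq> L'" "b \<in> K'" "b \<in> L'" "end_join K' L' = b" by (rule line_ends)
  have m: "meets t a" "meets t b" "meets a b" using assms meetsI by metis+
  have no: "x \<noteq> y" if "x \<in> ends" "y \<in> ends" "u \<in> x" "v \<in> y" "meets u v" for x y u v
    using same_end_miss that by blast
  have o1: "cross R T M N" unfolding cross_def using t a m(1) no[OF _ _ _ _ m(1)] by auto
  have o2: "cross R T K' L'" unfolding cross_def using t b' m(2) no[OF _ _ _ _ m(2)] by auto
  \<comment> \<open>The ends of \<open>b\<close> are named so that \<open>K\<close> lies on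
    \<open>M\<close>'s side of \<open>t\<close>, as \<open>turn_crossings\<close> demands.\<close>
  obtain K L where b: "K \<in> ends" "L \<in> ends" "K \<noteq> L" "b \<in> K" "b \<in> L" "end_join K L = b" "cross R T K L" "\<not> cross R T M K"
  proof (cases "cross R T M K'")
    case True
    have "M \<noteq> R" "M \<noteq> T" "K' \<noteq> R" "K' \<noteq> T" "L' \<noteq> R" "L' \<noteq> T"
      using cr_dist[OF o1] cr_dist[OF o2] by auto
    then have "cross R T M L' \<longleftrightarrow> cross R T M K' \<noteq> cross R T K' L'"
      using cr_trans[of R T M K' L'] t(1-3) a(1) b'(1,2) by simp
    then have "\<not> cross R T M L'" using True o2 by blast
    then show ?thesis using that[of L' K'] b' o2 cr_flip2(2)[of R T K' L'] end_join_sym[of K' L'] by metis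
  next
    case False then show ?thesis using that[of K' L'] b' o2 by blast
  qed
  have c: "cross M N K L" unfolding cross_def using a b m(3) no[OF _ _ _ _ m(3)] by auto
  have c': "cross M N L K" using c cr_flip2 by blast
  have nP: "\<not> inc P a" "\<not> inc P b" using assms line_eq by metis+
  have hR: "turn_end P R = T" using turn_end_eq[of R T P] t assms by metis
  have nh: "N \<noteq> turn_end P M" "L \<noteq> turn_end P K" using turn_end(3)[of M P] turn_end(3)[of K P] a b nP by metis+
  have h: "turn_end P x \<in> ends \<and> turn_end P x \<noteq> x \<and> turn_end P (turn_end P x) = x" if "x \<in> ends" for x
    using turn_end that by blast
  note tc = turn_crossings[OF t(1-3) h turn_lines_meet hR a(1,2) b(1,2) o1 b(7,8) c nh]
  have ga: "turn_line P a = end_join (turn_end P M) (turn_end P N)" using turn_line_eq[OF a(1-5)] .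
  have gb: "turn_line P b = end_join (turn_end P K) (turn_end P L)" using turn_line_eq[OF b(1-5)] .
  have mv: "meets (turn_line P a) (turn_line P b)" using tc(1) unfolding cross_def ga gb by blast
  then obtain V where V: "inc V (turn_line P a)" "inc V (turn_line P b)" using meetsE by metis
  have "inc V t"
    using tc(2)
  proof
    assume w: "cross (turn_end P N) L M (turn_end P K)"
    show ?thesis
      by (rule pascal_step[OF c _ _ assms(1,2,3) _ _ _ _ _ w]) (use a b assms nP mv V ga gb in auto)
  next
    \<comment> \<open>The same hexagons with \<open>K\<close> and \<open>L\<close> exchanged, which
      changes neither \<open>b\<close> nor its image.\<close>
    assume w: "cross (turn_end P N) K M (turn_end P L)"
    show ?thesis
      by (rule pascal_step[OF c' _ _ assms(1,2,3) _ _ _ _ _ w])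
        (use a b assms nP mv V ga gb end_join_sym[of L K] end_join_sym[of "turn_end P L" "turn_end P K"] in auto)
  qed
  then show ?thesis using V by blast
qed

text \<open>The pairwise intersections all lie on \<open>t\<close>, and the image of a fixed line
  \<open>a\<close> meets \<open>t\<close> only once. Comparing every other line with
  \<open>a\<close> therefore always gives the same point.\<close>

lemma turn_lines_concurrent: "\<exists>V. \<forall>a. inc Q a \<longrightarrow> inc V (turn_line P a)"
proof (cases "P = Q")
  case True then show ?thesis using turn_line_fixed by metis
next
  case PQ: False
  obtain t where t: "inc P t" "inc Q t" using ex_line by blast
  have gt: "turn_line P t = t" using turn_line_fixed t by blast
  obtain a where a: "inc Q a" "a \<noteq> t" using third_line by metis
  obtain b where b: "inc Q b" "b \<noteq> t" "b \<noteq> a" using third_line by metis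
  obtain V where V: "inc V t" "inc V (turn_line P a)"
    using turn_lines_concurrent_pair[OF t PQ a(1) b(1) a(2) b(2)] b by metis
  have at: "turn_line P a \<noteq> t" using turn_line_involution gt a by metis
  have "inc V (turn_line P k)" if k: "inc Q k" for k
  proof -
    consider "k = t" | "k = a" | "k \<noteq> t" "k \<noteq> a" by blast
    then show ?thesis
    proof cases
      case 1 then show ?thesis using gt V by simp
    next
      case 2 then show ?thesis using V by simp
    next
      case 3
      obtain V' where V': "inc V' t" "inc V' (turn_line P a)" "inc V' (turn_line P k)"
        using turn_lines_concurrent_pair[OF t PQ a(1) k a(2) 3(1)] 3 by metis
      then have "V' = V" using point_eq[OF at] V by blast
      then show ?thesis using V' by blast
    qed
  qed
  then show ?thesis by blast
qed

text \<open>Both maps are involutions, so they are bijective, and preserving incidence in one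
  direction already gives the other.\<close>

lemma half_turn_automorphism:
  "\<exists>f g. automorphism f g \<and>
    (\<forall>l M N. has_rimpoints l M N \<longrightarrow> has_rimpoints (g l) (half_turn P M) (half_turn P N))"
proof -
  \<comment> \<open>The choice is harmless: distinct lines through \<open>Q\<close> have distinct
    images, so only one point lies on all of them.\<close>
  define f where "f Q = (SOME V. \<forall>a. inc Q a \<longrightarrow> inc V (turn_line P a))" for Q
  have f: "inc (f Q) (turn_line P a)" if "inc Q a" for Q a
    unfolding f_def using someI_ex[OF turn_lines_concurrent[of Q P]] that by blast
  have ff: "f (f Q) = Q" for Q
  proof -
    obtain a where a: "inc Q a" using ex_line by blast
    obtain b where b: "inc Q b" "b \<noteq> a" using third_line by metis
    have "inc (f (f Q)) a" "inc (f (f Q)) b" using f[OF f] a b turn_line_involution by metis+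
    then show ?thesis using point_eq[of a b] a b by metis
  qed
  have i: "inc (f X) (turn_line P l) \<longleftrightarrow> inc X l" for X l
    using f[of X l] f[of "f X" "turn_line P l"] ff turn_line_involution by metis
  have "bij f" by (rule o_bij[of f f]) (simp_all add: fun_eq_iff ff)
  moreover have "bij (turn_line P)"
    by (rule o_bij[of "turn_line P" "turn_line P"]) (simp_all add: fun_eq_iff turn_line_involution)
  ultimately have "automorphism f (turn_line P)" unfolding automorphism_def using i by blast
  moreover have "has_rimpoints (turn_line P l) (half_turn P M) (half_turn P N)" if h: "has_rimpoints l M N" for l M N
  proof -
    obtain e e' where e: "e \<in> ends" "e' \<in> ends" "M = rim_of e" "N = rim_of e'"
      using h rimpoints_iff unfolding has_rimpoints_def rim_on_def by metis
    have l: "l \<in> e" "l \<in> e'" "e \<noteq> e'" using h e rim_on_iff unfolding has_rimpoints_def by blast+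
    have t: "turn_line P l \<in> turn_end P e" "turn_line P l \<in> turn_end P e'" using turn_line_ends e l by blast+
    have E: "turn_end P e \<in> ends" "turn_end P e' \<in> ends" "turn_end P e \<noteq> turn_end P e'" using turn_end(1) turn_end_inj e l by blast+
    then show ?thesis
      unfolding has_rimpoints_def e half_turn_rim[OF e(1)] half_turn_rim[OF e(2)]
      using rim_of_inj rim_on_iff t by blast
  qed
  ultimately show ?thesis by blast
qed

end

theorem theorem3p8:
  fixes inc :: "'p \<Rightarrow> 'l \<Rightarrow> bool"
  assumes "hyperbolic_incidence inc"
  shows "\<forall>P. \<exists>f g. incidence_structure.automorphism inc f g \<and>
    (\<forall>l M N. incidence_structure.has_rimpoints inc l M N \<longrightarrow>
      incidence_structure.has_rimpoints inc (g l)
        (incidence_structure.half_turn inc P M) (incidence_structure.half_turn inc P N))"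
proof -
  interpret hyperbolic_incidence inc by (rule assms)
  show ?thesis using half_turn_automorphism by blast
qed

end
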